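(* Let $F=\alpha^{1+m}\beta^{-m}$, $m\neq0$, be an $m$-Kropina metric of Berwald type on a $4$-dimensional smooth manifold $M$, built from a Lorentzian metric $a$ (signature $(-,+,+,+)$) and a 1-form $b$ with $|b|^2=a^{ij}b_ib_j\neq0$ everywhere on $M$. Then $F$ is Ricci-flat if and only if it is locally of the form $$F=\left|\eta_{ij}\,dx^i dx^j\right|^{(1+m)/2}\left(c_i\,dx^i\right)^{-m},$$ with $[\eta_{ij}]=\mathrm{diag}(-1,1,1,1)$ and $c_i$ constants; that is, if and only if around each point of $M$ there are coordinates $(x^i)$ and constants $c_i$ such that $F$ has this form.
   Context: Finsler metrics. Let $M$ be a smooth manifold of dimension $n$, with local coordinates $x^i$ and induced coordinates $(x,y)$ on $TM$ (a tangent vector is $y^i\partial_i$); write $\partial_i=\partial/\partial x^i$, $\bar\partial_i=\partial/\partial y^i$. A conic subbundle of $TM$ is an open subset $\mathcal A\subset TM$ such that $(x,\lambda y)\in\mathcal A$ for all $(x,y)\in\mathcal A$, $\lambda>0$, and whose projection to $M$ is all of $M$. A Finsler metric on $\mathcal A$ is a smooth map $F:\mathcal A\to[0,\infty)$ with $F(x,\lambda y)=\lambda F(x,y)$ for $\lambda>0$ and with nondegenerate fundamental tensor $g_{ij}=\bar\partial_i\bar\partial_j(\tfrac12F^2)$. Connection and curvature. The canonical nonlinear connection has coefficients $N^j_i=\tfrac14\bar\partial_i\big[g^{jk}(y^l\partial_l\bar\partial_kF^2-\partial_kF^2)\big]$. With $\delta_i=\partial_i-N^j_i\bar\partial_j$,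 its curvature is $R^k_{ij}=\delta_iN^k_j-\delta_jN^k_i$; put $\mathrm{Ric}=R^i_{ij}y^j$ and $R_{ij}=\tfrac12\bar\partial_i\bar\partial_j\mathrm{Ric}$ (the Finsler-Ricci tensor). $F$ is Ricci-flat if $R_{ij}=0$, equivalently $\mathrm{Ric}=0$. $F$ is of Berwald type if $N^k_i=\Gamma^k_{ij}(x)y^j$ for functions $\Gamma^k_{ij}$ on the base; these are then the Christoffel symbols of a torsion-free affine connection on $M$, called the affine connection of $F$. $m$-Kropina metrics. An $m$-Kropina metric is a Finsler metric of the form $F=\alpha^{1+m}\beta^{-m}$ with $\alpha=\sqrt{|a_{ij}y^iy^j|}$, $\beta=b_iy^i$, where $a$ is a (pseudo-)Riemannian metric and $b$ a 1-form on $M$, and $m\in\mathbb R$; $b$ is then nowhere vanishing. The trivial case $m=0$ is excluded. Indices are raised and lowered with $a_{ij}$, and $\mathring\nabla$, $\mathring\Gamma$ denote the Levi-Civita connection of $a$ and its Christoffel symbols. Known fact: for $n>2$, $F$ is of Berwald type iff there is a smooth vector field $f^i$ on $M$ with $\mathring\nabla_j b_i = m (f_k b^k)a_{ij} + b_i f_j - m f_i b_j$. In that case $f$ is unique and the affine connection of $F$ is $\Gamma^\ell_{ij}=\mathring\Gamma^\ell_{ij}+m a^{\ell k}(a_{ij}f_k-a_{jk}f_i-a_{ki}f_j)$. Notation: in a formula for $F$, quadratic forms and 1-forms are evaluated on the tangent vector $y$, i.e. $dx^i$ stands for $y^i$. *)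

theory Defs
  imports "HOL-Analysis.Analysis"
begin

section \<open>Smooth maps and smooth manifolds\<close>

text \<open>The set \<open>S\<close> is always open below, so \<open>at x\<close> is the right filter.\<close>

primrec higher_differentiable_on ::
  "nat \<Rightarrow> 'a::real_normed_vector set \<Rightarrow> ('a \<Rightarrow> 'b::real_normed_vector) \<Rightarrow> bool" where
  "higher_differentiable_on 0 S f \<longleftrightarrow> continuous_on S f"
| "higher_differentiable_on (Suc n) S f \<longleftrightarrow>
     (\<forall>x\<in>S. f differentiable (at x)) \<and>
     (\<forall>v. higher_differentiable_on n S (\<lambda>x. frechet_derivative f (at x) v))"

definition smooth_on :: "'a::real_normed_vector set \<Rightarrow> ('a \<Rightarrow> 'b::real_normed_vector) \<Rightarrow> bool" where
  "smooth_on S f \<longleftrightarrow> (\<forall>n. higher_differentiable_on n S f)"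

text \<open>A chart is a coordinate domain together with a coordinate map; the values of the map
  outside the domain are irrelevant.\<close>

type_synonym ('p, 'n) chart = "'p set \<times> ('p \<Rightarrow> real ^ 'n)"

abbreviation chart_dom :: "('p, 'n) chart \<Rightarrow> 'p set" where
  "chart_dom c \<equiv> fst c"

abbreviation chart_map :: "('p, 'n) chart \<Rightarrow> 'p \<Rightarrow> real ^ 'n" where
  "chart_map c \<equiv> snd c"

definition chart_image :: "('p, 'n) chart \<Rightarrow> (real ^ 'n) set" where
  "chart_image c = chart_map c ` chart_dom c"

definition chart_inv :: "('p, 'n) chart \<Rightarrow> real ^ 'n \<Rightarrow> 'p" where
  "chart_inv c = inv_into (chart_dom c) (chart_map c)"

definition is_chart :: "'p topology \<Rightarrow> ('p, 'n::finite) chart \<Rightarrow> bool" where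
  "is_chart T c \<longleftrightarrow>
     openin T (chart_dom c) \<and> open (chart_image c) \<and>
     homeomorphic_map (subtopology T (chart_dom c)) (top_of_set (chart_image c)) (chart_map c)"

definition transition :: "('p, 'n) chart \<Rightarrow> ('p, 'n) chart \<Rightarrow> real ^ 'n \<Rightarrow> real ^ 'n" where
  "transition c d = chart_map d \<circ> chart_inv c"

definition smooth_compatible :: "('p, 'n::finite) chart \<Rightarrow> ('p, 'n) chart \<Rightarrow> bool" where
  "smooth_compatible c d \<longleftrightarrow>
     smooth_on (chart_map c ` (chart_dom c \<inter> chart_dom d)) (transition c d) \<and>
     smooth_on (chart_map d ` (chart_dom c \<inter> chart_dom d)) (transition d c)"

text \<open>A smooth manifold of dimension \<open>CARD('n)\<close>; the smooth structure is a maximal atlas, so that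
  ``coordinates around a point'' are exactly the members of \<open>\<A>\<close> whose domain contains it.\<close>

definition smooth_manifold :: "'p topology \<Rightarrow> ('p, 'n::finite) chart set \<Rightarrow> bool" where
  "smooth_manifold T \<A> \<longleftrightarrow>
     Hausdorff_space T \<and> second_countable T \<and>
     (\<forall>c\<in>\<A>. is_chart T c) \<and>
     (\<Union>c\<in>\<A>. chart_dom c) = topspace T \<and>
     (\<forall>c\<in>\<A>. \<forall>d\<in>\<A>. smooth_compatible c d) \<and>
     (\<forall>c. is_chart T c \<and> (\<forall>d\<in>\<A>. smooth_compatible c d) \<longrightarrow> c \<in> \<A>)"


section \<open>The tangent bundle\<close>

text \<open>A tangent vector at \<open>p\<close> is the family of its components in all charts around \<open>p\<close>, related by
  the Jacobians of the transition maps. The components in other charts are set to \<open>0\<close>, so that a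
  tangent vector is determined by its components in any one chart around \<open>p\<close>.\<close>

type_synonym ('p, 'n) tvec = "('p, 'n) chart \<Rightarrow> real ^ 'n"

definition tangent_space :: "('p, 'n::finite) chart set \<Rightarrow> 'p \<Rightarrow> ('p, 'n) tvec set" where
  "tangent_space \<A> p = {v.
     (\<forall>c\<in>\<A>. \<forall>d\<in>\<A>. p \<in> chart_dom c \<inter> chart_dom d \<longrightarrow>
        v d = frechet_derivative (transition c d) (at (chart_map c p)) (v c)) \<and>
     (\<forall>c. \<not> (c \<in> \<A> \<and> p \<in> chart_dom c) \<longrightarrow> v c = 0)}"

definition tangent_bundle ::
  "'p topology \<Rightarrow> ('p, 'n::finite) chart set \<Rightarrow> ('p \<times> ('p, 'n) tvec) set" where
  "tangent_bundle T \<A> = Sigma (topspace T) (tangent_space \<A>)"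

definition tvec_scale :: "real \<Rightarrow> ('p, 'n::finite) tvec \<Rightarrow> ('p, 'n) tvec" where
  "tvec_scale r v = (\<lambda>c. r *\<^sub>R v c)"

text \<open>The tangent vector $y^i\partial_i$ at \<open>p\<close>, with $\partial_i$ the coordinate fields of \<open>c\<close>.\<close>

definition coord_tvec ::
  "('p, 'n::finite) chart set \<Rightarrow> ('p, 'n) chart \<Rightarrow> 'p \<Rightarrow> real ^ 'n \<Rightarrow> ('p, 'n) tvec" where
  "coord_tvec \<A> c p y =
     (\<lambda>d. if d \<in> \<A> \<and> p \<in> chart_dom d
          then frechet_derivative (transition c d) (at (chart_map c p)) y else 0)"

text \<open>The point of the tangent bundle with induced coordinates \<open>(x, y)\<close>.\<close>

definition TM_point ::
  "('p, 'n::finite) chart set \<Rightarrow> ('p, 'n) chart \<Rightarrow> (real ^ 'n) \<times> (real ^ 'n) \<Rightarrow> 'p \<times> ('p, 'n) tvec" where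
  "TM_point \<A> c = (\<lambda>(x, y). (chart_inv c x, coord_tvec \<A> c (chart_inv c x) y))"

definition TM_coords ::
  "('p, 'n::finite) chart set \<Rightarrow> ('p, 'n) chart \<Rightarrow> ('p \<times> ('p, 'n) tvec) set
     \<Rightarrow> ((real ^ 'n) \<times> (real ^ 'n)) set" where
  "TM_coords \<A> c A = {z. fst z \<in> chart_image c \<and> TM_point \<A> c z \<in> A}"


section \<open>Tensor fields on the base\<close>

definition one_form_comp ::
  "('p, 'n::finite) chart set \<Rightarrow> ('p, 'n) chart \<Rightarrow> ('p \<Rightarrow> ('p, 'n) tvec \<Rightarrow> real)
     \<Rightarrow> real ^ 'n \<Rightarrow> real ^ 'n" where
  "one_form_comp \<A> c b x =
     (let p = chart_inv c x in \<chi> i. b p (coord_tvec \<A> c p (axis i 1)))"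

definition one_form ::
  "('p, 'n::finite) chart set \<Rightarrow> ('p \<Rightarrow> ('p, 'n) tvec \<Rightarrow> real) \<Rightarrow> bool" where
  "one_form \<A> b \<longleftrightarrow> (\<forall>c\<in>\<A>.
     (\<forall>p\<in>chart_dom c. linear (\<lambda>y. b p (coord_tvec \<A> c p y))) \<and>
     smooth_on (chart_image c) (one_form_comp \<A> c b))"

definition metric_comp ::
  "('p, 'n::finite) chart set \<Rightarrow> ('p, 'n) chart \<Rightarrow> ('p \<Rightarrow> ('p, 'n) tvec \<Rightarrow> ('p, 'n) tvec \<Rightarrow> real)
     \<Rightarrow> real ^ 'n \<Rightarrow> real ^ 'n ^ 'n" where
  "metric_comp \<A> c a x =
     (let p = chart_inv c x in
      \<chi> i j. a p (coord_tvec \<A> c p (axis i 1)) (coord_tvec \<A> c p (axis j 1)))"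

definition pseudo_riemannian_metric ::
  "('p, 'n::finite) chart set \<Rightarrow> ('p \<Rightarrow> ('p, 'n) tvec \<Rightarrow> ('p, 'n) tvec \<Rightarrow> real) \<Rightarrow> bool" where
  "pseudo_riemannian_metric \<A> a \<longleftrightarrow> (\<forall>c\<in>\<A>.
     (\<forall>p\<in>chart_dom c. bilinear (\<lambda>y z. a p (coord_tvec \<A> c p y) (coord_tvec \<A> c p z))) \<and>
     smooth_on (chart_image c) (metric_comp \<A> c a) \<and>
     (\<forall>x\<in>chart_image c. transpose (metric_comp \<A> c a x) = metric_comp \<A> c a x \<and>
        invertible (metric_comp \<A> c a x)))"

definition minkowski :: "real ^ 4 ^ 4" where
  "minkowski = (\<chi> i j. if i = j then (if i = 1 then - 1 else 1) else 0)"

text \<open>Signature $(-,+,+,+)$: at every point some basis (the columns of \<open>P\<close>) is orthonormal.\<close>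

definition lorentzian_metric ::
  "('p, 4) chart set \<Rightarrow> ('p \<Rightarrow> ('p, 4) tvec \<Rightarrow> ('p, 4) tvec \<Rightarrow> real) \<Rightarrow> bool" where
  "lorentzian_metric \<A> a \<longleftrightarrow> pseudo_riemannian_metric \<A> a \<and>
     (\<forall>c\<in>\<A>. \<forall>x\<in>chart_image c. \<exists>P. invertible P \<and>
        transpose P ** metric_comp \<A> c a x ** P = minkowski)"

text \<open>$|b|^2 = a^{ij} b_i b_j$, computed in the chart \<open>c\<close>.\<close>

definition one_form_norm_sq ::
  "('p, 'n::finite) chart set \<Rightarrow> ('p, 'n) chart \<Rightarrow> ('p \<Rightarrow> ('p, 'n) tvec \<Rightarrow> ('p, 'n) tvec \<Rightarrow> real)
     \<Rightarrow> ('p \<Rightarrow> ('p, 'n) tvec \<Rightarrow> real) \<Rightarrow> real ^ 'n \<Rightarrow> real" where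
  "one_form_norm_sq \<A> c a b x =
     (\<Sum>i\<in>UNIV. \<Sum>j\<in>UNIV. matrix_inv (metric_comp \<A> c a x) $ i $ j *
        one_form_comp \<A> c b x $ i * one_form_comp \<A> c b x $ j)"


section \<open>Finsler geometry in induced coordinates\<close>

text \<open>$\partial_i$ and $\bar\partial_i$ for functions of $(x,y)$.\<close>

definition dx :: "'n::finite \<Rightarrow> ((real ^ 'n) \<times> (real ^ 'n) \<Rightarrow> real) \<Rightarrow> (real ^ 'n) \<times> (real ^ 'n) \<Rightarrow> real"
  where "dx i f z = frechet_derivative f (at z) (axis i 1, 0)"

definition dy :: "'n::finite \<Rightarrow> ((real ^ 'n) \<times> (real ^ 'n) \<Rightarrow> real) \<Rightarrow> (real ^ 'n) \<times> (real ^ 'n) \<Rightarrow> real"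
  where "dy i f z = frechet_derivative f (at z) (0, axis i 1)"

text \<open>In the following, \<open>f\<close> is the coordinate expression of the Finsler metric.\<close>

definition fundamental_tensor ::
  "((real ^ 'n) \<times> (real ^ 'n::finite) \<Rightarrow> real) \<Rightarrow> (real ^ 'n) \<times> (real ^ 'n) \<Rightarrow> real ^ 'n ^ 'n" where
  "fundamental_tensor f z = (\<chi> i j. dy i (dy j (\<lambda>w. (f w)\<^sup>2 / 2)) z)"

text \<open>$N^j_i$, with the upper index first.\<close>

definition nonlinear_connection ::
  "((real ^ 'n) \<times> (real ^ 'n::finite) \<Rightarrow> real) \<Rightarrow> 'n \<Rightarrow> 'n \<Rightarrow> (real ^ 'n) \<times> (real ^ 'n) \<Rightarrow> real" where
  "nonlinear_connection f j i z =
     (1/4) * dy i (\<lambda>w. \<Sum>k\<in>UNIV. matrix_inv (fundamental_tensor f w) $ j $ k *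
       ((\<Sum>l\<in>UNIV. snd w $ l * dx l (dy k (\<lambda>u. (f u)\<^sup>2)) w) - dx k (\<lambda>u. (f u)\<^sup>2) w)) z"

definition delta ::
  "((real ^ 'n) \<times> (real ^ 'n::finite) \<Rightarrow> real) \<Rightarrow> 'n \<Rightarrow> ((real ^ 'n) \<times> (real ^ 'n) \<Rightarrow> real)
     \<Rightarrow> (real ^ 'n) \<times> (real ^ 'n) \<Rightarrow> real" where
  "delta f i h z = dx i h z - (\<Sum>j\<in>UNIV. nonlinear_connection f j i z * dy j h z)"

text \<open>$R^k_{ij}$\<close>

definition connection_curvature ::
  "((real ^ 'n) \<times> (real ^ 'n::finite) \<Rightarrow> real) \<Rightarrow> 'n \<Rightarrow> 'n \<Rightarrow> 'n \<Rightarrow> (real ^ 'n) \<times> (real ^ 'n) \<Rightarrow> real" where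
  "connection_curvature f k i j z =
     delta f i (nonlinear_connection f k j) z - delta f j (nonlinear_connection f k i) z"

definition Ric :: "((real ^ 'n) \<times> (real ^ 'n::finite) \<Rightarrow> real) \<Rightarrow> (real ^ 'n) \<times> (real ^ 'n) \<Rightarrow> real" where
  "Ric f z = (\<Sum>i\<in>UNIV. \<Sum>j\<in>UNIV. connection_curvature f i i j z * snd z $ j)"

definition finsler_ricci_tensor ::
  "((real ^ 'n) \<times> (real ^ 'n::finite) \<Rightarrow> real) \<Rightarrow> 'n \<Rightarrow> 'n \<Rightarrow> (real ^ 'n) \<times> (real ^ 'n) \<Rightarrow> real" where
  "finsler_ricci_tensor f i j z = dy i (dy j (Ric f)) z / 2"


section \<open>Finsler metrics\<close>

definition conic_subbundle ::
  "'p topology \<Rightarrow> ('p, 'n::finite) chart set \<Rightarrow> ('p \<times> ('p, 'n) tvec) set \<Rightarrow> bool" where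
  "conic_subbundle T \<A> A \<longleftrightarrow>
     A \<subseteq> tangent_bundle T \<A> \<and>
     (\<forall>c\<in>\<A>. open (TM_coords \<A> c A)) \<and>
     (\<forall>p v r. (p, v) \<in> A \<and> r > 0 \<longrightarrow> (p, tvec_scale r v) \<in> A) \<and>
     fst ` A = topspace T"

definition finsler_metric ::
  "'p topology \<Rightarrow> ('p, 'n::finite) chart set \<Rightarrow> ('p \<times> ('p, 'n) tvec) set
     \<Rightarrow> ('p \<times> ('p, 'n) tvec \<Rightarrow> real) \<Rightarrow> bool" where
  "finsler_metric T \<A> A F \<longleftrightarrow>
     conic_subbundle T \<A> A \<and>
     (\<forall>z\<in>A. F z \<ge> 0) \<and>
     (\<forall>p v r. (p, v) \<in> A \<and> r > 0 \<longrightarrow> F (p, tvec_scale r v) = r * F (p, v)) \<and>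
     (\<forall>c\<in>\<A>. smooth_on (TM_coords \<A> c A) (F \<circ> TM_point \<A> c) \<and>
        (\<forall>z\<in>TM_coords \<A> c A. invertible (fundamental_tensor (F \<circ> TM_point \<A> c) z)))"

definition ricci_flat ::
  "('p, 'n::finite) chart set \<Rightarrow> ('p \<times> ('p, 'n) tvec) set \<Rightarrow> ('p \<times> ('p, 'n) tvec \<Rightarrow> real) \<Rightarrow> bool" where
  "ricci_flat \<A> A F \<longleftrightarrow>
     (\<forall>c\<in>\<A>. \<forall>z\<in>TM_coords \<A> c A. \<forall>i j. finsler_ricci_tensor (F \<circ> TM_point \<A> c) i j z = 0)"

definition berwald_type ::
  "('p, 'n::finite) chart set \<Rightarrow> ('p \<times> ('p, 'n) tvec) set \<Rightarrow> ('p \<times> ('p, 'n) tvec \<Rightarrow> real) \<Rightarrow> bool" where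
  "berwald_type \<A> A F \<longleftrightarrow>
     (\<forall>c\<in>\<A>. \<exists>\<Gamma>. \<forall>(x, y)\<in>TM_coords \<A> c A. \<forall>k i.
        nonlinear_connection (F \<circ> TM_point \<A> c) k i (x, y) = (\<Sum>j\<in>UNIV. \<Gamma> k i j x * y $ j))"


section \<open>m-Kropina metrics\<close>

text \<open>The power $t^r$ with real exponent $r$: defined for \<open>t > 0\<close>, and for integer \<open>r\<close> also for
  \<open>t < 0\<close>. The latter matters because, e.g. for even \<open>m\<close>, a metric $\alpha^{1+m}\beta^{-m}$ may be
  defined where \<open>\<beta> < 0\<close>.\<close>

definition real_power :: "real \<Rightarrow> real \<Rightarrow> real" where
  "real_power t r = (if r \<in> \<int> then t powi \<lfloor>r\<rfloor> else t powr r)"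

lemma real_power_eq_powr: "t > 0 \<Longrightarrow> real_power t r = t powr r"
  unfolding real_power_def by (auto simp: powr_real_of_int' elim!: Ints_cases)

text \<open>The condition on the values \<open>q\<close> and \<open>t\<close> of the quadratic form and of the 1-form under which
  $|q|^{(1+m)/2}\,t^{-m}$ is meaningful. Requiring \<open>q \<noteq> 0\<close> and \<open>t \<noteq> 0\<close> also for nonnegative
  exponents loses nothing: for \<open>m \<noteq> 0\<close>, where one of them vanishes the metric
  would fail to be smooth or its fundamental tensor would be degenerate.\<close>

definition kropina_domain :: "real \<Rightarrow> real \<Rightarrow> real \<Rightarrow> bool" where
  "kropina_domain m q t \<longleftrightarrow> q \<noteq> 0 \<and> t \<noteq> 0 \<and> (t > 0 \<or> m \<in> \<int>)"

definition m_kropina_metric ::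
  "'p topology \<Rightarrow> ('p, 'n::finite) chart set \<Rightarrow> ('p \<times> ('p, 'n) tvec) set
     \<Rightarrow> ('p \<times> ('p, 'n) tvec \<Rightarrow> real) \<Rightarrow> real
     \<Rightarrow> ('p \<Rightarrow> ('p, 'n) tvec \<Rightarrow> ('p, 'n) tvec \<Rightarrow> real) \<Rightarrow> ('p \<Rightarrow> ('p, 'n) tvec \<Rightarrow> real) \<Rightarrow> bool" where
  "m_kropina_metric T \<A> A F m a b \<longleftrightarrow>
     finsler_metric T \<A> A F \<and> pseudo_riemannian_metric \<A> a \<and> one_form \<A> b \<and>
     (\<forall>(p, v)\<in>A. kropina_domain m (a p v v) (b p v) \<and>
        F (p, v) = sqrt \<bar>a p v v\<bar> powr (1 + m) * real_power (b p v) (- m))"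

end

theory Submission
  imports Defs
begin

text \<open>Since \<open>F\<close> is of Berwald type, its affine connection leaves \<open>F\<close> invariant. Comparing both sides of
  this identity as polynomials in \<open>y\<close> gives $\nabla_j b_i = (1+m) f_j b_i$ and
  $\nabla_k a_{ij} = 2 m f_k a_{ij}$. Then $d|b|^2 = 2|b|^2 f$, so that $||b|^2|^{-m}\, a$ and
  $||b|^2|^{-(1+m)/2}\, b$ are parallel, and they define the same \<open>F\<close>. A Ricci-flat metric in dimension
  four with a parallel nonnull covector is flat, because it is locally a product of a line and a
  Ricci-flat metric in dimension three. Flat coordinates, obtained from parallel coframes, bring \<open>F\<close> to
  the claimed form. Conversely, where \<open>F\<close> does not depend on the coordinates \<open>x\<close> its connection
  vanishes in these coordinates, hence has zero curvature in all coordinates.\<close>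

section \<open>Calculus of smooth maps\<close>

text \<open>Berwald type supplies bare functions \<open>\<Gamma> k i j x\<close> with no regularity
  in x, so at first the connection cannot be differentiated. Smoothness appears only once the
  rescaled metric is found: the connection is then its Levi-Civita connection, and the Koszul
  formula expresses it through a smooth metric. Nonnullity of b enters three times. It keeps \<beta>
  from dividing the quadratic form, so that the cubic identity in y separates into its factors; it
  makes |b|^2 available as a conformal factor; and it lets b be completed to an orthonormal frame,
  so that the curvature lives in the three complementary directions, where Ricci determines Riemann.
  The sign of \<beta> and the real exponents disappear by passing to F^2 and its logarithmic
  derivative, which is rational in y. Both directions rest on one equivalence: a symmetric bilinear
  G is the connection of F exactly when the derivative of F^2 in x along v equals its derivative in
  y along G(v,y). The flat coordinates and the parallel coframe are obtained together, from a single
  linear total differential equation.\<close>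

abbreviation fd :: "('a::real_normed_vector \<Rightarrow> 'b::real_normed_vector) \<Rightarrow> 'a \<Rightarrow> 'a \<Rightarrow> 'b" where
  "fd f x \<equiv> frechet_derivative f (at x)"

lemma fd_eq: "(f has_derivative f') (at x) \<Longrightarrow> fd f x = f'"
  by (metis frechet_derivative_at)

lemma fd_works: "f differentiable at x \<Longrightarrow> (f has_derivative fd f x) (at x)"
  by (simp add: frechet_derivative_works)

text \<open>\<open>frechet_derivative\<close> is a choice among all derivatives; both sides choose
  from the same predicate, so the equality holds even where \<open>f\<close> has no
  derivative.\<close>

lemma fd_cong_open:
  assumes "open S" "x \<in> S" "\<And>y. y \<in> S \<Longrightarrow> f y = g y"
  shows "fd f x = fd g x"
proof -
  have "(f has_derivative f') (at x) \<longleftrightarrow> (g has_derivative f') (at x)" for f'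
    by (metis assms has_derivative_transform_within_open)
  then show ?thesis by (simp add: frechet_derivative_def)
qed

lemma differentiable_cong_open:
  assumes "open S" "x \<in> S" "\<And>y. y \<in> S \<Longrightarrow> f y = g y"
  shows "f differentiable at x \<longleftrightarrow> g differentiable at x"
  unfolding differentiable_def by (metis assms has_derivative_transform_within_open)

lemma higher_differentiable_on_cong:
  assumes "open S" "\<And>x. x \<in> S \<Longrightarrow> f x = g x"
  shows "higher_differentiable_on n S f \<longleftrightarrow> higher_differentiable_on n S g"
  using assms(2)
proof (induction n arbitrary: f g)
  case 0
  then show ?case by (simp cong: continuous_on_cong)
next
  case (Suc n)
  have "higher_differentiable_on n S (\<lambda>x. fd f x v) \<longleftrightarrow> higher_differentiable_on n S (\<lambda>x. fd g x v)" for v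
  proof (rule Suc.IH)
    fix x assume "x \<in> S"
    then have "fd f x = fd g x" using Suc.prems by (rule fd_cong_open[OF assms(1)])
    then show "fd f x v = fd g x v" by simp
  qed
  moreover have "f differentiable at x \<longleftrightarrow> g differentiable at x" if "x \<in> S" for x
    using differentiable_cong_open[OF assms(1) that Suc.prems] .
  ultimately show ?case by simp
qed

lemma higher_differentiable_on_subset:
  "higher_differentiable_on n S f \<Longrightarrow> T \<subseteq> S \<Longrightarrow> higher_differentiable_on n T f"
  by (induction n arbitrary: f) (auto intro: continuous_on_subset)

lemma higher_differentiable_on_SucD:
  "higher_differentiable_on (Suc n) S f \<Longrightarrow> higher_differentiable_on n S f"
proof (induction n arbitrary: f)
  case 0
  then show ?case
    by (auto intro!: continuous_at_imp_continuous_on differentiable_imp_continuous_within)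
next
  case (Suc n)
  then show ?case by (metis higher_differentiable_on.simps(2))
qed

lemma higher_differentiable_on_const: "higher_differentiable_on n S (\<lambda>x. c)"
  by (induction n arbitrary: c) (auto simp: frechet_derivative_const)

text \<open>Replaces the chosen derivative by an explicit one, which is what the inductions on the
  order exhibit.\<close>

lemma higher_differentiable_on_SucI:
  assumes "open S" and "\<And>x. x \<in> S \<Longrightarrow> (f has_derivative f' x) (at x)"
    and "\<And>v. higher_differentiable_on n S (\<lambda>x. f' x v)"
  shows "higher_differentiable_on (Suc n) S f"
proof -
  have "higher_differentiable_on n S (\<lambda>x. fd f x v)" for v
    using higher_differentiable_on_cong[of S "\<lambda>x. fd f x v" "\<lambda>x. f' x v" n] assms(1,3) by (simp add: fd_eq[OF assms(2)])
  then show ?thesis using assms(2) by (auto simp: differentiable_def)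
qed

lemma higher_differentiable_on_linear:
  assumes "bounded_linear h"
  shows "higher_differentiable_on n S h"
proof (cases n)
  case 0
  then show ?thesis using assms by (simp add: linear_continuous_on)
next
  case (Suc k)
  have "fd h x = h" for x
    using assms by (intro fd_eq bounded_linear_imp_has_derivative)
  then show ?thesis
    using Suc assms by (simp add: higher_differentiable_on_const bounded_linear_imp_differentiable)
qed

lemma higher_differentiable_on_add:
  assumes "open S" "higher_differentiable_on n S f" "higher_differentiable_on n S g"
  shows "higher_differentiable_on n S (\<lambda>x. f x + g x)"
  using assms(2,3)
proof (induction n arbitrary: f g)
  case 0
  then show ?case by (simp add: continuous_on_add)
next
  case (Suc n)
  show ?case
    by (rule higher_differentiable_on_SucI[where f'="\<lambda>x v. fd f x v + fd g x v"])
      (use Suc assms(1) in \<open>auto intro!: has_derivative_add simp: fd_works\<close>)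
qed

lemma higher_differentiable_on_sum:
  assumes "open S" "\<And>i. i \<in> I \<Longrightarrow> higher_differentiable_on n S (f i)"
  shows "higher_differentiable_on n S (\<lambda>x. \<Sum>i\<in>I. f i x)"
  using assms(2)
  by (induction I rule: infinite_finite_induct)
    (auto simp: higher_differentiable_on_const assms(1) higher_differentiable_on_add)

lemma higher_differentiable_on_bilinear:
  assumes "bounded_bilinear B" "open S" "higher_differentiable_on n S f" "higher_differentiable_on n S g"
  shows "higher_differentiable_on n S (\<lambda>x. B (f x) (g x))"
  using assms(3,4)
proof (induction n arbitrary: f g)
  case 0
  then show ?case by (simp add: bounded_bilinear.continuous_on[OF assms(1)])
next
  case (Suc n)
  show ?case
  proof (rule higher_differentiable_on_SucI[where f'="\<lambda>x v. B (f x) (fd g x v) + B (fd f x v) (g x)", OF assms(2)])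
    fix x assume "x \<in> S"
    then show "((\<lambda>x. B (f x) (g x)) has_derivative (\<lambda>v. B (f x) (fd g x v) + B (fd f x v) (g x))) (at x)"
      using Suc.prems by (intro bounded_bilinear.FDERIV[OF assms(1)]) (auto simp: fd_works)
  next
    fix v
    show "higher_differentiable_on n S (\<lambda>x. B (f x) (fd g x v) + B (fd f x v) (g x))"
      using Suc.prems higher_differentiable_on_SucD[OF Suc.prems(1)] higher_differentiable_on_SucD[OF Suc.prems(2)]
      by (auto intro!: higher_differentiable_on_add assms intro: Suc.IH)
  qed
qed

lemma higher_differentiable_on_compose:
  fixes f :: "'b::euclidean_space \<Rightarrow> 'c::real_normed_vector"
  assumes "open S" "open T" "g ` S \<subseteq> T" "higher_differentiable_on n T f" "higher_differentiable_on n S g"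
  shows "higher_differentiable_on n S (\<lambda>x. f (g x))"
  using assms(4,5)
proof (induction n arbitrary: f)
  case 0
  then show ?case using assms(3) by (auto intro: continuous_on_compose2)
next
  case (Suc n)
  have gd: "(g has_derivative fd g x) (at x)" if "x \<in> S" for x
    using that Suc.prems by (auto simp: fd_works)
  have fdf: "(f has_derivative fd f (g x)) (at (g x))" if "x \<in> S" for x
    using that Suc.prems assms(3) by (auto simp: fd_works)
  \<comment> \<open>The chain rule differentiates \<open>f\<close> in the direction
    \<open>fd g x v\<close>, which moves with x, while the induction hypothesis covers fixed
    directions only. Expanding over \<open>Basis\<close> leaves fixed directions with scalar
    coefficients.\<close>
  show ?case
  proof (rule higher_differentiable_on_SucI[where f'="\<lambda>x v. \<Sum>b\<in>Basis. (fd g x v \<bullet> b) *\<^sub>R fd f (g x) b", OF assms(1)])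
    fix x assume x: "x \<in> S"
    have "((\<lambda>x. f (g x)) has_derivative (\<lambda>v. fd f (g x) (fd g x v))) (at x)"
      using diff_chain_at[OF gd[OF x] fdf[OF x]] by (simp add: o_def)
    moreover have "fd f (g x) w = (\<Sum>b\<in>Basis. (w \<bullet> b) *\<^sub>R fd f (g x) b)" for w
    proof -
      have l: "linear (fd f (g x))"
        using fdf[OF x] by (simp add: has_derivative_linear)
      have "fd f (g x) w = fd f (g x) (\<Sum>b\<in>Basis. (w \<bullet> b) *\<^sub>R b)" by (simp add: euclidean_representation)
      also have "\<dots> = (\<Sum>b\<in>Basis. (w \<bullet> b) *\<^sub>R fd f (g x) b)"
        by (simp add: linear_sum[OF l] linear_cmul[OF l])
      finally show ?thesis .
    qed
    ultimately show "((\<lambda>x. f (g x)) has_derivative (\<lambda>v. \<Sum>b\<in>Basis. (fd g x v \<bullet> b) *\<^sub>R fd f (g x) b)) (at x)"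
      by (rule has_derivative_eq_rhs[OF _ ext])
  next
    fix v
    show "higher_differentiable_on n S (\<lambda>x. \<Sum>b\<in>Basis. (fd g x v \<bullet> b) *\<^sub>R fd f (g x) b)"
    proof (intro higher_differentiable_on_sum higher_differentiable_on_bilinear[OF bounded_bilinear_scaleR]
        higher_differentiable_on_bilinear[OF bounded_bilinear_inner] assms(1) higher_differentiable_on_const)
      show "higher_differentiable_on n S (\<lambda>x. fd g x v)" using Suc.prems by simp
    next
      fix b :: 'b
      show "higher_differentiable_on n S (\<lambda>x. fd f (g x) b)"
        by (rule Suc.IH[OF _ higher_differentiable_on_SucD[OF Suc.prems(2)]]) (use Suc.prems in simp)
    qed
  qed
qed

lemma smooth_on_cong:
  "open S \<Longrightarrow> (\<And>x. x \<in> S \<Longrightarrow> f x = g x) \<Longrightarrow> smooth_on S f \<longleftrightarrow> smooth_on S g"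
  unfolding smooth_on_def using higher_differentiable_on_cong[of S f g] by simp

lemma smooth_on_subset: "smooth_on S f \<Longrightarrow> T \<subseteq> S \<Longrightarrow> smooth_on T f"
  unfolding smooth_on_def using higher_differentiable_on_subset[of _ S f T] by simp

lemma smooth_on_const: "smooth_on S (\<lambda>x. c)"
  by (simp add: smooth_on_def higher_differentiable_on_const)

lemma smooth_on_linear: "bounded_linear h \<Longrightarrow> smooth_on S h"
  by (simp add: smooth_on_def higher_differentiable_on_linear)

lemma smooth_on_add: "open S \<Longrightarrow> smooth_on S f \<Longrightarrow> smooth_on S g \<Longrightarrow> smooth_on S (\<lambda>x. f x + g x)"
  by (simp add: smooth_on_def higher_differentiable_on_add)

lemma smooth_on_sum:
  "open S \<Longrightarrow> (\<And>i. i \<in> I \<Longrightarrow> smooth_on S (f i)) \<Longrightarrow> smooth_on S (\<lambda>x. \<Sum>i\<in>I. f i x)"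
  by (simp add: smooth_on_def higher_differentiable_on_sum)

lemma smooth_on_bilinear:
  "bounded_bilinear B \<Longrightarrow> open S \<Longrightarrow> smooth_on S f \<Longrightarrow> smooth_on S g \<Longrightarrow> smooth_on S (\<lambda>x. B (f x) (g x))"
  by (simp add: smooth_on_def higher_differentiable_on_bilinear)

lemmas smooth_on_scaleR = smooth_on_bilinear[OF bounded_bilinear_scaleR]
lemmas smooth_on_inner = smooth_on_bilinear[OF bounded_bilinear_inner]

lemma smooth_on_mult:
  fixes f g :: "'a::real_normed_vector \<Rightarrow> real"
  shows "open S \<Longrightarrow> smooth_on S f \<Longrightarrow> smooth_on S g \<Longrightarrow> smooth_on S (\<lambda>x. f x * g x)"
  by (rule smooth_on_bilinear[OF bounded_bilinear_mult])

lemma smooth_on_minus: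
  fixes f :: "'a::real_normed_vector \<Rightarrow> 'b::real_normed_vector"
  shows "open S \<Longrightarrow> smooth_on S f \<Longrightarrow> smooth_on S (\<lambda>x. - f x)"
  using smooth_on_scaleR[of S "\<lambda>x. -1" f] by (simp add: smooth_on_const)

lemma smooth_on_diff:
  fixes f :: "'a::real_normed_vector \<Rightarrow> 'b::real_normed_vector"
  shows "open S \<Longrightarrow> smooth_on S f \<Longrightarrow> smooth_on S g \<Longrightarrow> smooth_on S (\<lambda>x. f x - g x)"
  using smooth_on_add[of S f "\<lambda>x. - g x"] by (simp add: smooth_on_minus)

lemma smooth_on_prod:
  fixes f :: "'i \<Rightarrow> 'a::real_normed_vector \<Rightarrow> real"
  assumes "open S"
  shows "(\<And>i. i \<in> I \<Longrightarrow> smooth_on S (f i)) \<Longrightarrow> smooth_on S (\<lambda>x. \<Prod>i\<in>I. f i x)"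
  by (induction I rule: infinite_finite_induct) (auto simp: smooth_on_const assms smooth_on_mult)

lemma smooth_on_compose:
  fixes f :: "'b::euclidean_space \<Rightarrow> 'c::real_normed_vector"
  shows "open S \<Longrightarrow> open T \<Longrightarrow> g ` S \<subseteq> T \<Longrightarrow> smooth_on T f \<Longrightarrow> smooth_on S g \<Longrightarrow> smooth_on S (\<lambda>x. f (g x))"
  unfolding smooth_on_def by (simp add: higher_differentiable_on_compose[of S T g _ f])

lemma smooth_on_linear_compose:
  fixes f :: "'a::real_normed_vector \<Rightarrow> 'b::euclidean_space"
  assumes "linear h" "open S" "smooth_on S f"
  shows "smooth_on S (\<lambda>x. h (f x))"
  using assms smooth_on_compose[of S UNIV f h] smooth_on_linear[of h UNIV]
  by (simp add: linear_conv_bounded_linear)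

lemma smooth_on_differentiable: "smooth_on S f \<Longrightarrow> x \<in> S \<Longrightarrow> f differentiable at x"
  unfolding smooth_on_def by (metis higher_differentiable_on.simps(2))

lemma smooth_on_continuous: "smooth_on S f \<Longrightarrow> continuous_on S f"
  unfolding smooth_on_def by (metis higher_differentiable_on.simps(1))

lemma smooth_on_fd: "smooth_on S f \<Longrightarrow> smooth_on S (\<lambda>x. fd f x v)"
  unfolding smooth_on_def by (metis higher_differentiable_on.simps(2))

lemma smooth_on_has_derivative: "smooth_on S f \<Longrightarrow> x \<in> S \<Longrightarrow> (f has_derivative fd f x) (at x)"
  by (simp add: fd_works smooth_on_differentiable)

lemma smooth_on_componentwise:
  fixes f :: "'a::real_normed_vector \<Rightarrow> 'b::euclidean_space"
  assumes "open S" "\<And>b. b \<in> Basis \<Longrightarrow> smooth_on S (\<lambda>x. f x \<bullet> b)"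
  shows "smooth_on S f"
proof -
  have "smooth_on S (\<lambda>x. \<Sum>b\<in>Basis. (f x \<bullet> b) *\<^sub>R b)"
    using assms by (intro smooth_on_sum smooth_on_scaleR smooth_on_const) auto
  then show ?thesis by (simp add: euclidean_representation)
qed

lemma smooth_on_vec_iff:
  fixes f :: "'a::real_normed_vector \<Rightarrow> real ^ 'n"
  assumes "open S"
  shows "smooth_on S f \<longleftrightarrow> (\<forall>i. smooth_on S (\<lambda>x. f x $ i))"
proof
  assume f: "smooth_on S f"
  have "linear (\<lambda>v::real^'n. v $ i)" for i by (simp add: linear_iff)
  then show "\<forall>i. smooth_on S (\<lambda>x. f x $ i)"
    using smooth_on_linear_compose[OF _ assms f] by blast
next
  assume f: "\<forall>i. smooth_on S (\<lambda>x. f x $ i)"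
  show "smooth_on S f"
  proof (rule smooth_on_componentwise[OF assms])
    fix b :: "real ^ 'n" assume "b \<in> Basis"
    then obtain i where "b = axis i 1" by (auto simp: Basis_vec_def)
    then show "smooth_on S (\<lambda>x. f x \<bullet> b)" using f by (simp add: inner_axis)
  qed
qed

lemma smooth_on_mat_iff:
  fixes f :: "'a::real_normed_vector \<Rightarrow> real ^ 'n ^ 'm"
  assumes "open S"
  shows "smooth_on S f \<longleftrightarrow> (\<forall>i j. smooth_on S (\<lambda>x. f x $ i $ j))"
proof
  assume f: "smooth_on S f"
  have "linear (\<lambda>v::real^'n^'m. v $ i $ j)" for i j by (simp add: linear_iff)
  then show "\<forall>i j. smooth_on S (\<lambda>x. f x $ i $ j)"
    using smooth_on_linear_compose[OF _ assms f] by blast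
next
  assume f: "\<forall>i j. smooth_on S (\<lambda>x. f x $ i $ j)"
  show "smooth_on S f"
  proof (rule smooth_on_componentwise[OF assms])
    fix b :: "real ^ 'n ^ 'm" assume "b \<in> Basis"
    then obtain i j where "b = axis i (axis j 1)" by (auto simp: Basis_vec_def)
    then show "smooth_on S (\<lambda>x. f x \<bullet> b)" using f by (simp add: inner_axis)
  qed
qed

lemma smooth_on_Pair:
  fixes f :: "'a::real_normed_vector \<Rightarrow> 'b::euclidean_space" and g :: "'a \<Rightarrow> 'c::euclidean_space"
  assumes "open S" "smooth_on S f" "smooth_on S g"
  shows "smooth_on S (\<lambda>x. (f x, g x))"
proof (rule smooth_on_componentwise[OF assms(1)])
  fix b :: "'b \<times> 'c" assume "b \<in> Basis"
  have "smooth_on S (\<lambda>x. f x \<bullet> fst b + g x \<bullet> snd b)"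
    by (intro smooth_on_add smooth_on_inner smooth_on_const assms)
  then show "smooth_on S (\<lambda>x. (f x, g x) \<bullet> b)" by (simp add: inner_prod_def)
qed

lemma smooth_on_fst: "smooth_on S fst" and smooth_on_snd: "smooth_on S snd"
  by (auto intro!: smooth_on_linear bounded_linear_intros)

section \<open>Smoothness of reciprocals, real powers and matrix inverses\<close>

lemma smooth_on_inverse: "smooth_on (- {0}) (inverse :: real \<Rightarrow> real)"
proof -
  have "higher_differentiable_on n (- {0}) (inverse :: real \<Rightarrow> real)" for n
  proof (induction n)
    case 0
    show ?case by (auto intro!: continuous_intros)
  next
    case (Suc n)
    have "higher_differentiable_on n (- {0}) (\<lambda>x. (inverse x * inverse x) * (- v))" for v :: real
      by (intro higher_differentiable_on_bilinear[OF bounded_bilinear_mult] Suc higher_differentiable_on_const) auto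
    then show ?case
      by (intro higher_differentiable_on_SucI[where f'="\<lambda>x v. (inverse x * inverse x) * (- v)"])
        (auto intro!: derivative_eq_intros simp: algebra_simps)
  qed
  then show ?thesis by (simp add: smooth_on_def)
qed

lemma smooth_on_divide:
  fixes f g :: "'a::real_normed_vector \<Rightarrow> real"
  assumes "open S" "smooth_on S f" "smooth_on S g" "\<And>x. x \<in> S \<Longrightarrow> g x \<noteq> 0"
  shows "smooth_on S (\<lambda>x. f x / g x)"
proof -
  have "smooth_on S (\<lambda>x. inverse (g x))"
    using assms by (intro smooth_on_compose[OF _ _ _ smooth_on_inverse]) auto
  then show ?thesis using smooth_on_mult[OF assms(1,2)] by (simp add: divide_inverse)
qed

lemma smooth_on_powr: "smooth_on {0<..} (\<lambda>x::real. x powr p)"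
proof -
  have "higher_differentiable_on n {0<..} (\<lambda>x::real. x powr p)" for n
  proof (induction n arbitrary: p)
    case 0
    show ?case by (auto intro!: continuous_intros)
  next
    case (Suc n)
    have "higher_differentiable_on n {0<..} (\<lambda>x. x powr (p - 1) * (p * v))" for v :: real
      by (intro higher_differentiable_on_bilinear[OF bounded_bilinear_mult] Suc higher_differentiable_on_const) auto
    then show ?case
      by (intro higher_differentiable_on_SucI[where f'="\<lambda>x v. x powr (p - 1) * (p * v)"])
        (auto intro!: derivative_eq_intros simp: algebra_simps powr_diff)
  qed
  then show ?thesis by (simp add: smooth_on_def)
qed

text \<open>Writing |t|^p as (t^2)^(p/2) removes the absolute value, so that both signs of
  \<open>f\<close> are covered at once.\<close>

lemma smooth_on_abs_powr:
  fixes f :: "'a::real_normed_vector \<Rightarrow> real"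
  assumes "open S" "smooth_on S f" "\<And>x. x \<in> S \<Longrightarrow> f x \<noteq> 0"
  shows "smooth_on S (\<lambda>x. \<bar>f x\<bar> powr p)"
proof -
  have e: "\<bar>f x\<bar> powr p = (f x * f x) powr (p / 2)" for x
  proof -
    have "(f x * f x) powr (p / 2) = (\<bar>f x\<bar> * \<bar>f x\<bar>) powr (p / 2)" by simp
    also have "\<dots> = \<bar>f x\<bar> powr (p / 2) * \<bar>f x\<bar> powr (p / 2)" by (rule powr_mult)
    also have "\<dots> = \<bar>f x\<bar> powr p" by (simp flip: powr_add)
    finally show ?thesis ..
  qed
  have "smooth_on S (\<lambda>x. (f x * f x) powr (p / 2))"
    by (rule smooth_on_compose[OF _ _ _ smooth_on_powr smooth_on_mult[OF _ assms(2,2)]])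
      (use assms in \<open>simp_all add: image_subset_iff less_le\<close>)
  then show ?thesis by (simp add: e)
qed

lemma smooth_on_det:
  fixes M :: "'a::real_normed_vector \<Rightarrow> real ^ 'n::finite ^ 'n"
  assumes "open S" "\<And>i j. smooth_on S (\<lambda>x. M x $ i $ j)"
  shows "smooth_on S (\<lambda>x. det (M x))"
  unfolding det_def using assms by (intro smooth_on_sum smooth_on_mult smooth_on_prod smooth_on_const)

lemma matrix_inv_left: "invertible (A :: real ^ 'n ^ 'n) \<Longrightarrow> matrix_inv A ** A = mat 1"
  and matrix_inv_right: "invertible (A :: real ^ 'n ^ 'n) \<Longrightarrow> A ** matrix_inv A = mat 1"
  using someI_ex[of "\<lambda>A'. A ** A' = mat 1 \<and> A' ** A = mat 1"] unfolding invertible_def matrix_inv_def by auto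

text \<open>Cramer's rule: the entries of the inverse are quotients of determinants, hence smooth in
  any parameter on which \<open>A\<close> depends smoothly.\<close>

lemma matrix_inv_entry:
  fixes A :: "real ^ 'n::finite ^ 'n"
  assumes "invertible A"
  shows "matrix_inv A $ k $ j = det (\<chi> i l. if l = k then axis j 1 $ i else A $ i $ l) / det A"
proof -
  have "A *v (matrix_inv A *v axis j 1) = axis j 1"
    using assms by (simp add: matrix_vector_mul_assoc matrix_inv_right)
  then have "matrix_inv A *v axis j 1 = (\<chi> k. det (\<chi> i l. if l = k then axis j 1 $ i else A $ i $ l) / det A)"
    using assms by (subst (asm) cramer) (auto simp: invertible_det_nz)
  then have "(matrix_inv A *v axis j 1) $ k = det (\<chi> i l. if l = k then axis j 1 $ i else A $ i $ l) / det A"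
    by simp
  then show ?thesis by (simp add: matrix_vector_mult_basis column_def)
qed

lemma smooth_on_matrix_inv:
  fixes M :: "'a::real_normed_vector \<Rightarrow> real ^ 'n::finite ^ 'n"
  assumes "open S" "smooth_on S M" "\<And>x. x \<in> S \<Longrightarrow> invertible (M x)"
  shows "smooth_on S (\<lambda>x. matrix_inv (M x))"
proof -
  have M: "smooth_on S (\<lambda>x. M x $ i $ j)" for i j
    using assms(1,2) smooth_on_mat_iff by blast
  have "smooth_on S (\<lambda>x. matrix_inv (M x) $ k $ j)" for k j
  proof -
    have "smooth_on S (\<lambda>x. det (\<chi> i l. if l = k then axis j 1 $ i else M x $ i $ l) / det (M x))"
    proof (intro smooth_on_divide smooth_on_det assms(1) M)
      show "smooth_on S (\<lambda>x. (\<chi> i l. if l = k then axis j 1 $ i else M x $ i $ l) $ i $ l)" for i l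
        using M by (cases "l = k") (auto simp: smooth_on_const)
      show "det (M x) \<noteq> 0" if "x \<in> S" for x
        using assms(3)[OF that] by (simp add: invertible_det_nz)
    qed
    then show ?thesis
      by (subst smooth_on_cong[OF assms(1) matrix_inv_entry[OF assms(3)]])
  qed
  then show ?thesis using assms(1) smooth_on_mat_iff by blast
qed

section \<open>Linear total differential equations\<close>

text \<open>Gronwall: \<open>exp (- 2 * C * t) * (g t \<bullet> g t)\<close> is nonincreasing,
  nonnegative and starts at 0. This is the uniqueness principle for linear equations along a
  segment.\<close>

lemma linear_growth_zero:
  fixes g :: "real \<Rightarrow> 'v::real_inner"
  assumes g: "\<And>t. t \<in> {0..1} \<Longrightarrow> (g has_vector_derivative g' t) (at t within {0..1})"
    and bound: "\<And>t. t \<in> {0..1} \<Longrightarrow> norm (g' t) \<le> C * norm (g t)" and "g 0 = 0"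
  shows "g 1 = 0"
proof -
  define f where "f t = exp (- 2 * C * t) * (g t \<bullet> g t)" for t
  have cont: "continuous_on {0..1} g"
    using g by (meson continuous_on_eq_continuous_within has_vector_derivative_continuous)
  have "f 1 \<le> f 0"
  proof (rule DERIV_nonpos_imp_decreasing_open[where f=f and a=0 and b=1])
    show "continuous_on {0..1} f" unfolding f_def by (intro continuous_intros cont)
    fix t :: real assume t: "0 < t" "t < 1"
    then have "(g has_vector_derivative g' t) (at t)"
      using g[of t] by (simp add: at_within_Icc_at)
    then have d: "(g has_derivative (\<lambda>h. h *\<^sub>R g' t)) (at t)"
      by (simp add: has_vector_derivative_def)
    have "(f has_derivative (\<lambda>h. h * (exp (- 2 * C * t) * (2 * (g t \<bullet> g' t) - 2 * C * (g t \<bullet> g t))))) (at t)"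
      unfolding f_def
      by (rule derivative_eq_intros d refl ext | simp add: algebra_simps inner_commute)+
    then have "(f has_real_derivative exp (- 2 * C * t) * (2 * (g t \<bullet> g' t) - 2 * C * (g t \<bullet> g t))) (at t)"
      by (simp add: has_field_derivative_def mult_commute_abs)
    moreover have "g t \<bullet> g' t \<le> C * (g t \<bullet> g t)"
    proof -
      have "g t \<bullet> g' t \<le> norm (g t) * norm (g' t)" by (rule norm_cauchy_schwarz)
      also have "\<dots> \<le> norm (g t) * (C * norm (g t))"
        using bound[of t] t by (intro mult_left_mono) auto
      also have "\<dots> = C * (g t \<bullet> g t)" by (simp add: power2_norm_eq_inner[symmetric] power2_eq_square)
      finally show ?thesis .
    qed
    ultimately show "\<exists>y. (f has_real_derivative y) (at t) \<and> y \<le> 0"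
      by (intro exI[of _ "exp (- 2 * C * t) * (2 * (g t \<bullet> g' t) - 2 * C * (g t \<bullet> g t))"] conjI)
        (simp_all add: mult_nonneg_nonpos)
  qed simp
  then have "exp (- 2 * C) * (g 1 \<bullet> g 1) \<le> 0" using \<open>g 0 = 0\<close> by (simp add: f_def)
  then have "g 1 \<bullet> g 1 \<le> 0" by (simp only: mult_le_0_iff) (auto simp: not_le[symmetric])
  then show ?thesis by (metis inner_eq_zero_iff inner_ge_zero order_antisym)
qed

text \<open>Substituting \<tau> = t s shows that the integral is the primitive of \<open>k\<close>
  from 0 to s. The fundamental theorem is applied in t, so that s = 0 needs no separate case. The
  integrals of the Picard operator take this form along a ray.\<close>

lemma integral_rescale_has_vector_derivative:
  fixes k :: "real \<Rightarrow> 'v::banach"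
  assumes k: "continuous_on {0..1} k" and s: "s \<in> {0..1}"
  shows "((\<lambda>s. integral {0..1} (\<lambda>t. s *\<^sub>R k (t * s))) has_vector_derivative k s) (at s within {0..1})"
proof -
  define K where "K s = integral {0..s} k" for s
  have K: "(K has_vector_derivative k s) (at s within {0..1})" if "s \<in> {0..1}" for s
    unfolding K_def using integral_has_vector_derivative[OF k that] .
  have "integral {0..1} (\<lambda>t. s *\<^sub>R k (t * s)) = K s" if s: "s \<in> {0..1}" for s
  proof -
    have "((\<lambda>t. s *\<^sub>R k (t * s)) has_integral (K (1 * s) - K (0 * s))) {0..1}"
    proof (rule fundamental_theorem_of_calculus)
      fix t :: real assume t: "t \<in> {0..1}"
      have ts: "t * s \<in> {0..1}" using s t by (auto simp: mult_le_one)
      have img: "(\<lambda>t. t * s) ` {0..1} \<subseteq> {0..1}" using s by (auto simp: mult_le_one)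
      have "((\<lambda>t. t * s) has_vector_derivative s) (at t within {0..1})"
        by (auto intro!: derivative_eq_intros simp: has_vector_derivative_def)
      moreover have "(K has_vector_derivative k (t * s)) (at (t * s) within (\<lambda>t. t * s) ` {0..1})"
        using has_vector_derivative_within_subset[OF K[OF ts] img] .
      ultimately show "((\<lambda>t. K (t * s)) has_vector_derivative s *\<^sub>R k (t * s)) (at t within {0..1})"
        using vector_diff_chain_within[of "\<lambda>t. t * s" s t "{0..1}" K "k (t * s)"] by (simp add: o_def)
    qed simp
    then have "integral {0..1} (\<lambda>t. s *\<^sub>R k (t * s)) = K (1 * s) - K (0 * s)" by (rule integral_unique)
    also have "\<dots> = K s" by (simp add: K_def)
    finally show ?thesis .
  qed
  then show ?thesis
    by (intro has_vector_derivative_transform[OF s _ K[OF s]]) auto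
qed

lemma norm_integral_unit_le:
  fixes f :: "real \<Rightarrow> 'v::banach"
  assumes "continuous_on {0..1} f" "\<And>t. t \<in> {0..1} \<Longrightarrow> norm (f t) \<le> B"
  shows "norm (integral {0..1} f) \<le> B"
  using integral_bound[of 0 1 f B] assms by simp

section \<open>Picard iteration along the rays from a base point\<close>

context
  fixes \<omega> :: "'a::euclidean_space \<Rightarrow> 'a \<Rightarrow>\<^sub>L 'v::euclidean_space \<Rightarrow>\<^sub>L 'v"
    and \<omega>' :: "'a \<Rightarrow> 'a \<Rightarrow>\<^sub>L 'a \<Rightarrow>\<^sub>L 'v \<Rightarrow>\<^sub>L 'v"
    and x0 :: 'a and r C C' :: real
  assumes r: "r > 0"
    and deriv: "\<And>x. x \<in> ball x0 r \<Longrightarrow> (\<omega> has_derivative \<omega>' x) (at x)"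
    and cont': "continuous_on (ball x0 r) \<omega>'"
    and bnd: "\<And>x. x \<in> ball x0 r \<Longrightarrow> norm (\<omega> x) \<le> C"
    and bnd': "\<And>x. x \<in> ball x0 r \<Longrightarrow> norm (\<omega>' x) \<le> C'"
    and small: "r * C \<le> 1 / 4"
begin

definition ray :: "'a \<Rightarrow> real \<Rightarrow> 'a" where
  "ray x t = x0 + t *\<^sub>R (x - x0)"

text \<open>The equation dz = \<open>\<omega>\<close> z integrated along the segment from
  \<open>x0\<close> to x. A fixed point z = z0 + \<open>picard z\<close> solves the equation in the
  radial direction by construction; the other directions need vanishing curvature.\<close>

definition picard :: "('a \<Rightarrow> 'v) \<Rightarrow> 'a \<Rightarrow> 'v" where
  "picard u x = integral {0..1} (\<lambda>t. \<omega> (ray x t) (x - x0) (u (ray x t)))"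

text \<open>Derivative in x of the integrand of \<open>picard\<close>: the outer terms come from the
  dependence through \<open>ray x t\<close>, which contributes the factor t, the middle one from x -
  x0. \<open>blinfun.prod_left v\<close> is evaluation at v, and \<open>u'\<close> stands for the
  derivative of \<open>u\<close>.\<close>

definition picard_kernel' :: "('a \<Rightarrow> 'v) \<Rightarrow> ('a \<Rightarrow> 'a \<Rightarrow>\<^sub>L 'v) \<Rightarrow> 'a \<Rightarrow> real \<Rightarrow> 'a \<Rightarrow>\<^sub>L 'v" where
  "picard_kernel' u u' x t =
     t *\<^sub>R (blinfun.prod_left (u (ray x t)) o\<^sub>L blinfun.prod_left (x - x0) o\<^sub>L \<omega>' (ray x t))
     + (blinfun.prod_left (u (ray x t)) o\<^sub>L \<omega> (ray x t))
     + t *\<^sub>R (\<omega> (ray x t) (x - x0) o\<^sub>L u' (ray x t))"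

definition picard' :: "('a \<Rightarrow> 'v) \<Rightarrow> ('a \<Rightarrow> 'a \<Rightarrow>\<^sub>L 'v) \<Rightarrow> 'a \<Rightarrow> 'a \<Rightarrow>\<^sub>L 'v" where
  "picard' u u' x = integral {0..1} (picard_kernel' u u' x)"

lemma ray_in: "x \<in> ball x0 r \<Longrightarrow> t \<in> {0..1} \<Longrightarrow> ray x t \<in> ball x0 r"
proof -
  assume x: "x \<in> ball x0 r" and t: "t \<in> {0..1}"
  have "norm (t *\<^sub>R (x - x0)) \<le> norm (x - x0)" using t by (simp add: mult_left_le_one_le)
  also have "\<dots> < r" using x by (simp add: dist_norm norm_minus_commute)
  finally show ?thesis by (simp add: ray_def dist_norm)
qed

lemma cont: "continuous_on (ball x0 r) \<omega>"
  using deriv by (auto intro!: continuous_at_imp_continuous_on has_derivative_continuous)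

lemma cont_ray: "continuous_on S (\<lambda>z. ray (fst z) (snd z))"
  unfolding ray_def by (intro continuous_intros)

lemma norm_ray: "x \<in> ball x0 r \<Longrightarrow> norm (x - x0) \<le> r"
  by (simp add: dist_norm norm_minus_commute)

lemma continuous_on_ray_compose:
  assumes "continuous_on (ball x0 r) f"
  shows "continuous_on (ball x0 r \<times> {0..1}) (\<lambda>z. f (ray (fst z) (snd z)))"
  by (rule continuous_on_compose2[OF assms cont_ray]) (use ray_in in auto)

lemma continuous_on_ray_compose1:
  assumes "continuous_on (ball x0 r) f" "x \<in> ball x0 r"
  shows "continuous_on {0..1} (\<lambda>t. f (ray x t))"
  by (rule continuous_on_compose2[OF assms(1)]) (use ray_in assms in \<open>auto simp: ray_def intro!: continuous_intros\<close>)

lemma picard_kernel_continuous: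
  assumes "continuous_on (ball x0 r) u" "x \<in> ball x0 r"
  shows "continuous_on {0..1} (\<lambda>t. \<omega> (ray x t) (x - x0) (u (ray x t)))"
  using assms cont by (intro continuous_intros continuous_on_ray_compose1) auto

lemma picard_kernel'_continuous:
  assumes "continuous_on (ball x0 r) u" "continuous_on (ball x0 r) u'"
  shows "continuous_on (ball x0 r \<times> {0..1}) (\<lambda>(x, t). picard_kernel' u u' x t)"
  unfolding picard_kernel'_def split_beta
  by (intro continuous_intros bounded_linear.continuous_on[OF blinfun.bounded_linear_prod_left]
      continuous_on_ray_compose assms cont cont')

lemma picard_kernel'_continuous1:
  assumes "continuous_on (ball x0 r) u" "continuous_on (ball x0 r) u'" "x \<in> ball x0 r"
  shows "continuous_on {0..1} (picard_kernel' u u' x)"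
proof -
  have "continuous_on {0..1} (\<lambda>t. (\<lambda>(x, t). picard_kernel' u u' x t) (x, t))"
    by (rule continuous_on_compose2[OF picard_kernel'_continuous[OF assms(1,2)]])
      (use assms(3) in \<open>auto intro!: continuous_intros\<close>)
  then show ?thesis by simp
qed

lemma picard_has_derivative:
  assumes u: "\<And>x. x \<in> ball x0 r \<Longrightarrow> (u has_derivative blinfun_apply (u' x)) (at x)"
    and u': "continuous_on (ball x0 r) u'" and x: "x \<in> ball x0 r"
  shows "(picard u has_derivative picard' u u' x) (at x)"
proof -
  have uc: "continuous_on (ball x0 r) u"
    using u by (auto intro!: continuous_at_imp_continuous_on has_derivative_continuous)
  have "((\<lambda>x. integral (cbox 0 1) (\<lambda>t. \<omega> (ray x t) (x - x0) (u (ray x t)))) has_derivative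
      integral (cbox 0 1) (picard_kernel' u u' x)) (at x within ball x0 r)"
  proof (rule leibniz_rule)
    fix x and t :: real assume x: "x \<in> ball x0 r" and "t \<in> cbox 0 1"
    then have t: "t \<in> {0..1}" by simp
    have dr: "((\<lambda>x. ray x t) has_derivative (\<lambda>h. t *\<^sub>R h)) (at x)"
      unfolding ray_def by (auto intro!: derivative_eq_intros)
    have dw: "((\<lambda>x. \<omega> (ray x t)) has_derivative (\<lambda>h. \<omega>' (ray x t) (t *\<^sub>R h))) (at x)"
      using diff_chain_at[OF dr deriv[OF ray_in[OF x t]]] by (simp add: o_def)
    have du: "((\<lambda>x. u (ray x t)) has_derivative (\<lambda>h. u' (ray x t) (t *\<^sub>R h))) (at x)"
      using diff_chain_at[OF dr u[OF ray_in[OF x t]]] by (simp add: o_def)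
    have dm: "((\<lambda>x. x - x0) has_derivative (\<lambda>h. h)) (at x)" by (auto intro!: derivative_eq_intros)
    have "((\<lambda>x. \<omega> (ray x t) (x - x0) (u (ray x t))) has_derivative
       (\<lambda>h. \<omega> (ray x t) (x - x0) (u' (ray x t) (t *\<^sub>R h)) +
            (\<omega> (ray x t) h + \<omega>' (ray x t) (t *\<^sub>R h) (x - x0)) (u (ray x t)))) (at x)"
      by (rule bounded_bilinear.FDERIV[OF bounded_bilinear_blinfun_apply
            bounded_bilinear.FDERIV[OF bounded_bilinear_blinfun_apply dw dm] du])
    then have "((\<lambda>x. \<omega> (ray x t) (x - x0) (u (ray x t))) has_derivative picard_kernel' u u' x t) (at x)"
      by (rule has_derivative_eq_rhs)
        (simp add: fun_eq_iff picard_kernel'_def blinfun.add_left blinfun.scaleR_left blinfun.scaleR_right algebra_simps)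
    then show "((\<lambda>x. \<omega> (ray x t) (x - x0) (u (ray x t))) has_derivative picard_kernel' u u' x t)
        (at x within ball x0 r)"
      by (rule has_derivative_at_withinI)
  next
    fix x assume "x \<in> ball x0 r"
    then show "(\<lambda>t. \<omega> (ray x t) (x - x0) (u (ray x t))) integrable_on cbox 0 1"
      using picard_kernel_continuous[OF uc] by (intro integrable_continuous) auto
  next
    show "continuous_on (ball x0 r \<times> cbox 0 1) (\<lambda>(x, t). picard_kernel' u u' x t)"
      using picard_kernel'_continuous[OF uc u'] by simp
  qed (use x in auto)
  then have "(picard u has_derivative picard' u u' x) (at x within ball x0 r)"
    unfolding picard_def[abs_def] picard'_def[abs_def] by simp
  then show ?thesis by (simp only: at_within_open[OF x open_ball])
qed

lemma picard'_continuous: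
  assumes "continuous_on (ball x0 r) u" "continuous_on (ball x0 r) u'"
  shows "continuous_on (ball x0 r) (picard' u u')"
  unfolding picard'_def[abs_def]
  using integral_continuous_on_param[of "ball x0 r" 0 1 "picard_kernel' u u'"]
    picard_kernel'_continuous[OF assms] by simp

lemma C_nonneg: "0 \<le> C" and C'_nonneg: "0 \<le> C'"
  using bnd[of x0] bnd'[of x0] r norm_ge_zero[of "\<omega> x0"] norm_ge_zero[of "\<omega>' x0"] by (auto simp del: norm_ge_zero)

text \<open>\<open>small\<close> makes the operator a contraction with factor 1/4 in the supremum
  norm.\<close>

lemma norm_picard_le:
  assumes "continuous_on (ball x0 r) u" "x \<in> ball x0 r" "\<And>x. x \<in> ball x0 r \<Longrightarrow> norm (u x) \<le> B"
  shows "norm (picard u x) \<le> B / 4"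
  unfolding picard_def
proof (rule norm_integral_unit_le[OF picard_kernel_continuous[OF assms(1,2)]])
  fix t :: real assume "t \<in> {0..1}"
  then have q: "ray x t \<in> ball x0 r" using ray_in assms(2) by blast
  have "norm (\<omega> (ray x t) (x - x0) (u (ray x t))) \<le> norm (\<omega> (ray x t)) * norm (x - x0) * norm (u (ray x t))"
    by (meson norm_blinfun order_trans mult_right_mono norm_ge_zero)
  also have "\<dots> \<le> C * r * B"
    using bnd[OF q] norm_ray[OF assms(2)] assms(3)[OF q] C_nonneg r by (intro mult_mono) auto
  also have "\<dots> \<le> 1 / 4 * B"
    using small order_trans[OF norm_ge_zero assms(3)[OF q]] by (intro mult_right_mono) (auto simp: mult.commute)
  finally show "norm (\<omega> (ray x t) (x - x0) (u (ray x t))) \<le> B / 4" by simp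
qed

text \<open>The part linear in \<open>u'\<close> contracts by 1/4 as well; the other terms see only
  \<open>u\<close> and enter as an inhomogeneity of size \<open>(r * C' + C) * B\<close>.\<close>

lemma norm_picard'_le:
  assumes "continuous_on (ball x0 r) u" "continuous_on (ball x0 r) u'" "x \<in> ball x0 r"
    "\<And>x. x \<in> ball x0 r \<Longrightarrow> norm (u x) \<le> B" "\<And>x. x \<in> ball x0 r \<Longrightarrow> norm (u' x) \<le> B'"
  shows "norm (picard' u u' x) \<le> (r * C' + C) * B + B' / 4"
  unfolding picard'_def
proof (rule norm_integral_unit_le[OF picard_kernel'_continuous1[OF assms(1-3)]])
  fix t :: real assume t: "t \<in> {0..1}"
  then have q: "ray x t \<in> ball x0 r" using ray_in assms(3) by blast
  note bounds = bnd[OF q] bnd'[OF q] norm_ray[OF assms(3)] assms(4)[OF q] assms(5)[OF q]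
  have B0: "0 \<le> B" "0 \<le> B'" using order_trans[OF norm_ge_zero bounds(4)] order_trans[OF norm_ge_zero bounds(5)] .
  show "norm (picard_kernel' u u' x t) \<le> (r * C' + C) * B + B' / 4"
  proof (rule norm_blinfun_bound)
    show "0 \<le> (r * C' + C) * B + B' / 4" using B0 r C_nonneg C'_nonneg by simp
    fix h
    have 1: "norm (\<omega>' (ray x t) h (x - x0) (u (ray x t))) \<le> C' * norm h * r * B"
    proof -
      have "norm (\<omega>' (ray x t) h (x - x0) (u (ray x t)))
          \<le> norm (\<omega>' (ray x t)) * norm h * norm (x - x0) * norm (u (ray x t))"
        by (meson norm_blinfun order_trans mult_right_mono norm_ge_zero)
      also have "\<dots> \<le> C' * norm h * r * B"
        using bounds C'_nonneg r by (intro mult_mono) auto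
      finally show ?thesis .
    qed
    have 2: "norm (\<omega> (ray x t) h (u (ray x t))) \<le> C * norm h * B"
    proof -
      have "norm (\<omega> (ray x t) h (u (ray x t))) \<le> norm (\<omega> (ray x t)) * norm h * norm (u (ray x t))"
        by (meson norm_blinfun order_trans mult_right_mono norm_ge_zero)
      also have "\<dots> \<le> C * norm h * B" using bounds C_nonneg by (intro mult_mono) auto
      finally show ?thesis .
    qed
    have 3: "norm (\<omega> (ray x t) (x - x0) (u' (ray x t) h)) \<le> 1 / 4 * (B' * norm h)"
    proof -
      have "norm (\<omega> (ray x t) (x - x0) (u' (ray x t) h)) \<le> norm (\<omega> (ray x t)) * norm (x - x0) * norm (u' (ray x t) h)"
        by (meson norm_blinfun order_trans mult_right_mono norm_ge_zero)
      also have "\<dots> \<le> (C * r) * (B' * norm h)"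
        using bounds C_nonneg r
        by (intro mult_mono order_trans[OF norm_blinfun mult_right_mono]) auto
      also have "\<dots> \<le> 1 / 4 * (B' * norm h)" using small B0 by (intro mult_right_mono) (auto simp: mult.commute)
      finally show ?thesis .
    qed
    have "norm (picard_kernel' u u' x t h) \<le>
        t * norm (\<omega>' (ray x t) h (x - x0) (u (ray x t))) + norm (\<omega> (ray x t) h (u (ray x t)))
        + t * norm (\<omega> (ray x t) (x - x0) (u' (ray x t) h))"
    proof -
      have "picard_kernel' u u' x t h = t *\<^sub>R (\<omega>' (ray x t) h (x - x0) (u (ray x t)))
          + \<omega> (ray x t) h (u (ray x t)) + t *\<^sub>R (\<omega> (ray x t) (x - x0) (u' (ray x t) h))"
        by (simp add: picard_kernel'_def blinfun.add_left blinfun.scaleR_left)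
      also have "norm \<dots> \<le> norm (t *\<^sub>R (\<omega>' (ray x t) h (x - x0) (u (ray x t))))
          + norm (\<omega> (ray x t) h (u (ray x t))) + norm (t *\<^sub>R (\<omega> (ray x t) (x - x0) (u' (ray x t) h)))"
        by (intro norm_triangle_mono order_refl)
      finally show ?thesis using t by simp
    qed
    also have "\<dots> \<le> 1 * (C' * norm h * r * B) + C * norm h * B + 1 * (1 / 4 * (B' * norm h))"
      using t 1 2 3 by (intro add_mono mult_mono) auto
    finally show "norm (picard_kernel' u u' x t h) \<le> ((r * C' + C) * B + B' / 4) * norm h"
      by (simp add: algebra_simps)
  qed
qed

text \<open>Terms of the Neumann series rather than Picard iterates: the equation is linear, so the
  solution is the sum of the powers of \<open>picard\<close> applied to the constant
  \<open>z0\<close>. The derivatives are carried along as bounded linear maps.\<close>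

fun picard_seq :: "'v \<Rightarrow> nat \<Rightarrow> 'a \<Rightarrow> 'v" and picard_seq' :: "'v \<Rightarrow> nat \<Rightarrow> 'a \<Rightarrow> 'a \<Rightarrow>\<^sub>L 'v" where
  "picard_seq z0 0 = (\<lambda>x. z0)"
| "picard_seq z0 (Suc n) = picard (picard_seq z0 n)"
| "picard_seq' z0 0 = (\<lambda>x. 0)"
| "picard_seq' z0 (Suc n) = picard' (picard_seq z0 n) (picard_seq' z0 n)"

lemma picard_seq_C1:
  "(\<forall>x\<in>ball x0 r. (picard_seq z0 n has_derivative picard_seq' z0 n x) (at x)) \<and>
   continuous_on (ball x0 r) (picard_seq' z0 n)"
proof (induction n)
  case 0
  show ?case by (auto simp: zero_blinfun.rep_eq)
next
  case (Suc n)
  then have "continuous_on (ball x0 r) (picard_seq z0 n)"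
    by (auto intro!: continuous_at_imp_continuous_on has_derivative_continuous)
  then show ?case using Suc picard_has_derivative picard'_continuous by simp
qed

lemma picard_seq_continuous: "continuous_on (ball x0 r) (picard_seq z0 n)"
  using picard_seq_C1[of z0 n] by (auto intro!: continuous_at_imp_continuous_on has_derivative_continuous)

lemma norm_picard_seq_le: "x \<in> ball x0 r \<Longrightarrow> norm (picard_seq z0 n x) \<le> norm z0 * (1 / 4) ^ n"
proof (induction n arbitrary: x)
  case (Suc n)
  then show ?case using norm_picard_le[OF picard_seq_continuous Suc.prems Suc.IH] by simp
qed simp

text \<open>The recursion is d(n+1) \<le> (r C' + C) |z0| 4^(-n) + d(n) / 4. The prefactor 4 turns
  the first summand into a quarter of the bound at ratio 1/4, and relaxing that ratio to 1/2 leaves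
  room for both summands.\<close>

lemma norm_picard_seq'_le:
  "x \<in> ball x0 r \<Longrightarrow> norm (picard_seq' z0 n x) \<le> 4 * (r * C' + C) * norm z0 * (1 / 2) ^ n"
proof (induction n arbitrary: x)
  case 0
  then show ?case using r C_nonneg C'_nonneg by simp
next
  case (Suc n)
  let ?M = "4 * (r * C' + C) * norm z0"
  have M: "0 \<le> ?M" using r C_nonneg C'_nonneg by simp
  have "norm (picard_seq' z0 (Suc n) x) \<le> (r * C' + C) * (norm z0 * (1 / 4) ^ n) + ?M * (1 / 2) ^ n / 4"
    using norm_picard'_le[OF picard_seq_continuous _ Suc.prems norm_picard_seq_le Suc.IH] picard_seq_C1 by simp
  also have "\<dots> = ?M / 4 * (1 / 4) ^ n + ?M / 4 * (1 / 2) ^ n" by simp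
  also have "\<dots> \<le> ?M / 4 * (1 / 2) ^ n + ?M / 4 * (1 / 2) ^ n"
    using M by (intro add_mono mult_left_mono power_mono) auto
  also have "\<dots> = ?M * (1 / 2) ^ Suc n" by simp
  finally show ?case .
qed

text \<open>The Neumann series and its termwise derivative both converge uniformly by the
  Weierstrass test; hence the sum is continuously differentiable, and the operator passes through
  the limit.\<close>

lemma picard_fixpoint:
  obtains z z' where "\<And>x. x \<in> ball x0 r \<Longrightarrow> (z has_derivative blinfun_apply (z' x)) (at x)"
    "continuous_on (ball x0 r) z'" "\<And>x. x \<in> ball x0 r \<Longrightarrow> z x = z0 + picard z x"
proof -
  let ?K = "ball x0 r" and ?u = "picard_seq z0" and ?u' = "picard_seq' z0"
  let ?M = "4 * (r * C' + C) * norm z0"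
  define z where "z x = (\<Sum>n. ?u n x)" for x
  define z' where "z' x = (\<Sum>n. ?u' n x)" for x
  have ul: "uniform_limit ?K (\<lambda>n x. \<Sum>i<n. ?u i x) z sequentially"
    unfolding z_def
    by (rule Weierstrass_m_test[OF norm_picard_seq_le]) (auto intro!: summable_mult summable_geometric)
  have ul': "uniform_limit ?K (\<lambda>n x. \<Sum>i<n. ?u' i x) z' sequentially"
    unfolding z'_def
    by (rule Weierstrass_m_test[OF norm_picard_seq'_le]) (auto intro!: summable_mult summable_geometric)
  have zc': "continuous_on ?K z'"
    using ul' by (rule uniform_limit_theorem[rotated]) (auto intro!: always_eventually continuous_on_sum simp: picard_seq_C1)
  have zc: "continuous_on ?K z"
    using ul by (rule uniform_limit_theorem[rotated]) (auto intro!: always_eventually continuous_on_sum simp: picard_seq_continuous)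
  have sums: "(\<lambda>n. ?u n x) sums z x" if "x \<in> ?K" for x
    using tendsto_uniform_limitI[OF ul that] by (simp add: sums_def)
  have "\<exists>g. \<forall>x\<in>?K. (\<lambda>n. ?u n x) sums (g x) \<and> (g has_derivative z' x) (at x within ?K)"
  proof (rule has_derivative_series[OF convex_ball])
    show "(?u n has_derivative ?u' n x) (at x within ?K)" if "x \<in> ?K" for n x
      using picard_seq_C1 that by (blast intro: has_derivative_at_withinI)
    show "x0 \<in> ?K" using r by simp
    then show "(\<lambda>n. ?u n x0) sums z x0" by (rule sums)
    fix e :: real assume "e > 0"
    then have "\<forall>\<^sub>F n in sequentially. \<forall>x\<in>?K. dist (\<Sum>i<n. ?u' i x) (z' x) < e"
      using ul' by (simp add: uniform_limit_iff)
    then show "\<forall>\<^sub>F n in sequentially. \<forall>x\<in>?K. \<forall>h. norm ((\<Sum>i<n. ?u' i x h) - z' x h) \<le> e * norm h"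
    proof (rule eventually_mono, intro ballI allI)
      fix n x h assume "\<forall>x\<in>?K. dist (\<Sum>i<n. ?u' i x) (z' x) < e" "x \<in> ?K"
      then have *: "norm ((\<Sum>i<n. ?u' i x) - z' x) \<le> e" by (simp add: dist_norm less_imp_le)
      have "norm ((\<Sum>i<n. ?u' i x h) - z' x h) = norm (((\<Sum>i<n. ?u' i x) - z' x) h)"
        by (simp add: blinfun.sum_left blinfun.diff_left)
      also have "\<dots> \<le> norm ((\<Sum>i<n. ?u' i x) - z' x) * norm h" by (rule norm_blinfun)
      also have "\<dots> \<le> e * norm h" using * by (rule mult_right_mono) simp
      finally show "norm ((\<Sum>i<n. ?u' i x h) - z' x h) \<le> e * norm h" .
    qed
  qed
  then obtain g where g: "\<And>x. x \<in> ?K \<Longrightarrow> (\<lambda>n. ?u n x) sums (g x)"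
    "\<And>x. x \<in> ?K \<Longrightarrow> (g has_derivative z' x) (at x within ?K)" by blast
  have "g x = z x" if "x \<in> ?K" for x using sums_unique2[OF g(1) sums] that by blast
  then have zd: "(z has_derivative z' x) (at x)" if "x \<in> ?K" for x
    using g(2)[OF that] that
    by (metis at_within_open has_derivative_transform_within_open open_ball)
  have fp: "z x = z0 + picard z x" if x: "x \<in> ?K" for x
  proof -
    define S where "S n x = (\<Sum>i<n. ?u i x)" for n x
    have Sc: "continuous_on ?K (S n)" for n
      unfolding S_def by (intro continuous_on_sum picard_seq_continuous)
    have pS: "picard (S n) x = S (Suc n) x - z0" for n
    proof -
      have "picard (S n) x = (\<Sum>i<n. picard (?u i) x)"
        unfolding picard_def S_def blinfun.sum_right
        by (intro integral_sum integrable_continuous_interval picard_kernel_continuous picard_seq_continuous x) auto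
      also have "\<dots> = (\<Sum>i<n. ?u (Suc i) x)" by simp
      also have "\<dots> = S (Suc n) x - z0" unfolding S_def by (simp only: sum.lessThan_Suc_shift) simp
      finally show ?thesis .
    qed
    have "(\<lambda>n. picard (S n) x) \<longlonglongrightarrow> picard z x"
    proof (rule LIMSEQ_I)
      fix e :: real assume e: "e > 0"
      then have "\<forall>\<^sub>F n in sequentially. \<forall>x\<in>?K. dist (S n x) (z x) < e"
        using ul by (simp add: uniform_limit_iff S_def)
      then obtain N where N: "\<And>n x. n \<ge> N \<Longrightarrow> x \<in> ?K \<Longrightarrow> dist (S n x) (z x) < e"
        unfolding eventually_sequentially by meson
      have "norm (picard (S n) x - picard z x) < e" if n: "n \<ge> N" for n
      proof -
        have "picard (S n) x - picard z x
            = integral {0..1} (\<lambda>t. \<omega> (ray x t) (x - x0) (S n (ray x t)) - \<omega> (ray x t) (x - x0) (z (ray x t)))"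
          unfolding picard_def
          by (intro integral_diff[symmetric] integrable_continuous_interval picard_kernel_continuous Sc zc x)
        also have "\<dots> = picard (\<lambda>x. S n x - z x) x"
          unfolding picard_def blinfun.diff_right ..
        also have "norm \<dots> \<le> e / 4"
          using N[OF n] by (intro norm_picard_le x continuous_on_diff Sc zc) (auto simp: dist_norm less_imp_le)
        finally show ?thesis using e by simp
      qed
      then show "\<exists>no. \<forall>n\<ge>no. norm (picard (S n) x - picard z x) < e" by blast
    qed
    moreover have "(\<lambda>n. picard (S n) x) \<longlonglongrightarrow> z x - z0"
    proof -
      have "(\<lambda>n. S n x) \<longlonglongrightarrow> z x" using sums[OF x] by (simp add: sums_def S_def)
      then have "(\<lambda>n. S (Suc n) x) \<longlonglongrightarrow> z x" by (rule LIMSEQ_Suc)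
      then show ?thesis unfolding pS by (intro tendsto_diff tendsto_const)
    qed
    ultimately have "picard z x = z x - z0" by (rule LIMSEQ_unique)
    then show ?thesis by simp
  qed
  show thesis using that[OF zd zc' fp] .
qed

text \<open>A fixed point satisfies the equation radially. In another direction h the defect,
  multiplied by the ray parameter s, obeys a homogeneous linear equation along the ray, because
  \<open>flat\<close> exchanges the two directions. It vanishes at s = 0 and therefore at s =
  1.\<close>

lemma parallel_extension:
  assumes flat: "\<And>x h k v. x \<in> ball x0 r \<Longrightarrow>
      \<omega>' x h k v + \<omega> x k (\<omega> x h v) = \<omega>' x k h v + \<omega> x h (\<omega> x k v)"
  obtains z where "z x0 = z0"
    "\<And>x. x \<in> ball x0 r \<Longrightarrow> (z has_derivative (\<lambda>h. \<omega> x h (z x))) (at x)"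
proof -
  let ?K = "ball x0 r"
  obtain z z' where z: "\<And>x. x \<in> ?K \<Longrightarrow> (z has_derivative blinfun_apply (z' x)) (at x)"
    and z'c: "continuous_on ?K z'" and fp: "\<And>x. x \<in> ?K \<Longrightarrow> z x = z0 + picard z x"
    using picard_fixpoint[of z0] by blast
  have zc: "continuous_on ?K z"
    using z by (auto intro!: continuous_at_imp_continuous_on has_derivative_continuous)
  have z'_eq: "z' x = picard' z z' x" if x: "x \<in> ?K" for x
  proof -
    have "((\<lambda>x. z0 + picard z x) has_derivative picard' z z' x) (at x)"
      using picard_has_derivative[OF z z'c x] by (auto intro!: derivative_eq_intros)
    then have "(z has_derivative picard' z z' x) (at x)"
      using fp x by (metis has_derivative_transform_within_open open_ball)
    then show ?thesis using z[OF x] has_derivative_unique blinfun_apply_inject by blast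
  qed
  have z0: "z x0 = z0" using fp[of x0] r by (simp add: picard_def)
  have "z' x h = \<omega> x h (z x)" if x: "x \<in> ?K" for x h
  proof -
    define y where "y = x - x0"
    define q where "q s = x0 + s *\<^sub>R y" for s
    have qK: "q s \<in> ?K" if "s \<in> {0..1}" for s
      using ray_in[OF x that] by (simp add: ray_def q_def y_def)
    have dq: "(q has_vector_derivative y) (at s within {0..1})" for s
      unfolding q_def has_vector_derivative_def by (auto intro!: derivative_eq_intros)
    have rayq: "ray (q s) t = q (t * s)" for s t by (simp add: ray_def q_def)
    have qc: "continuous_on {0..1} (\<lambda>s. f (q s))" if "continuous_on ?K f" for f :: "'a \<Rightarrow> 'w::topological_space"
      by (rule continuous_on_compose2[OF that]) (use qK in \<open>auto simp: q_def intro!: continuous_intros\<close>)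
    have dqf: "((\<lambda>s. f (q s)) has_vector_derivative f' y) (at s within {0..1})"
      if "(f has_derivative f') (at (q s))" for f f' and s
    proof -
      have "(f \<circ> q has_derivative f' \<circ> (\<lambda>h. h *\<^sub>R y)) (at s within {0..1})"
        using dq[of s] has_derivative_at_withinI[OF that]
        by (intro diff_chain_within) (auto simp: has_vector_derivative_def)
      then show ?thesis
        using that by (simp add: has_vector_derivative_def o_def linear_cmul[OF has_derivative_linear])
    qed
    have radial: "z' (q s) y = \<omega> (q s) y (z (q s))" if s: "s \<in> {0..1}" for s
    proof -
      define k where "k s = \<omega> (q s) y (z (q s))" for s
      have kc: "continuous_on {0..1} k" unfolding k_def by (intro continuous_intros qc cont zc)
      have "z (q s) = z0 + integral {0..1} (\<lambda>t. s *\<^sub>R k (t * s))" if "s \<in> {0..1}" for s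
        using fp[OF qK[OF that]]
        by (simp add: picard_def rayq k_def) (simp add: q_def blinfun.scaleR_right blinfun.scaleR_left)
      moreover have "((\<lambda>s. z0 + integral {0..1} (\<lambda>t. s *\<^sub>R k (t * s))) has_vector_derivative 0 + k s) (at s within {0..1})"
        by (intro has_vector_derivative_add has_vector_derivative_const integral_rescale_has_vector_derivative kc s)
      ultimately have "((\<lambda>s. z (q s)) has_vector_derivative 0 + k s) (at s within {0..1})"
        by (rule has_vector_derivative_transform[OF s])
      moreover have "((\<lambda>s. z (q s)) has_vector_derivative z' (q s) y) (at s within {0..1})"
        by (rule dqf[OF z[OF qK[OF s]]])
      ultimately have "0 + k s = z' (q s) y"
        using s by (intro vector_derivative_unique_within_closed_interval[of 0 1 s "\<lambda>s. z (q s)"]) simp_all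
      then show ?thesis by (simp add: k_def)
    qed
    \<comment> \<open>\<open>k\<close> is the derivative of \<open>s *\<^sub>R z' (q s) h\<close>
      along the ray, read off from the fixed point equation differentiated in x. In this way no
      second derivative of \<open>z\<close> is involved.\<close>
    define k where "k s = s *\<^sub>R \<omega>' (q s) h y (z (q s)) + \<omega> (q s) h (z (q s)) + s *\<^sub>R \<omega> (q s) y (z' (q s) h)" for s
    have kc: "continuous_on {0..1} k" unfolding k_def by (intro continuous_intros qc cont cont' zc z'c)
    have g_eq: "s *\<^sub>R z' (q s) h = integral {0..1} (\<lambda>t. s *\<^sub>R k (t * s))" if s: "s \<in> {0..1}" for s
    proof -
      have "z' (q s) h = integral {0..1} (\<lambda>t. picard_kernel' z z' (q s) t h)"
        unfolding z'_eq[OF qK[OF s]] picard'_def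
        by (intro blinfun_apply_integral integrable_continuous_interval picard_kernel'_continuous1 zc z'c qK s)
      then have "s *\<^sub>R z' (q s) h = integral {0..1} (\<lambda>t. s *\<^sub>R picard_kernel' z z' (q s) t h)"
        by simp
      also have "(\<lambda>t. s *\<^sub>R picard_kernel' z z' (q s) t h) = (\<lambda>t. s *\<^sub>R k (t * s))"
        by (simp add: picard_kernel'_def rayq k_def blinfun.add_left blinfun.scaleR_left fun_eq_iff)
          (simp add: q_def blinfun.scaleR_right blinfun.scaleR_left)
      finally show ?thesis .
    qed
    \<comment> \<open>Moving x by h displaces the point q s by s h, whence the factor s; it also
      makes \<open>D\<close> vanish at 0.\<close>
    define D where "D s = s *\<^sub>R (z' (q s) h - \<omega> (q s) h (z (q s)))" for s
    have "D 1 = 0"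
    proof (rule linear_growth_zero)
      fix s :: real assume s: "s \<in> {0..1}"
      have 1: "((\<lambda>s. s *\<^sub>R z' (q s) h) has_vector_derivative k s) (at s within {0..1})"
        by (rule has_vector_derivative_transform[OF s g_eq integral_rescale_has_vector_derivative[OF kc s]])
      have dw: "((\<lambda>s. \<omega> (q s)) has_vector_derivative \<omega>' (q s) y) (at s within {0..1})"
        by (rule dqf[OF deriv[OF qK[OF s]]])
      have dwh: "((\<lambda>s. \<omega> (q s) h) has_vector_derivative \<omega>' (q s) y h) (at s within {0..1})"
        using bounded_linear.has_vector_derivative[OF blinfun.bounded_linear_left dw] .
      have dz: "((\<lambda>s. z (q s)) has_vector_derivative z' (q s) y) (at s within {0..1})"
        by (rule dqf[OF z[OF qK[OF s]]])
      have 2: "((\<lambda>s. \<omega> (q s) h (z (q s))) has_vector_derivative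
          \<omega> (q s) h (z' (q s) y) + \<omega>' (q s) y h (z (q s))) (at s within {0..1})"
        by (rule bounded_bilinear.has_vector_derivative[OF bounded_bilinear_blinfun_apply dwh dz])
      have 3: "((\<lambda>s. s *\<^sub>R \<omega> (q s) h (z (q s))) has_vector_derivative
          s *\<^sub>R (\<omega> (q s) h (z' (q s) y) + \<omega>' (q s) y h (z (q s))) + 1 *\<^sub>R \<omega> (q s) h (z (q s))) (at s within {0..1})"
        by (rule bounded_bilinear.has_vector_derivative[OF bounded_bilinear_scaleR has_vector_derivative_id 2, unfolded id_def])
      have "k s - (s *\<^sub>R (\<omega> (q s) h (z' (q s) y) + \<omega>' (q s) y h (z (q s))) + 1 *\<^sub>R \<omega> (q s) h (z (q s)))
          = \<omega> (q s) y (D s)"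
      proof -
        have "\<omega>' (q s) h y (z (q s)) = \<omega>' (q s) y h (z (q s)) + \<omega> (q s) h (\<omega> (q s) y (z (q s)))
            - \<omega> (q s) y (\<omega> (q s) h (z (q s)))"
          using flat[OF qK[OF s], of h y "z (q s)"] by (simp add: eq_diff_eq)
        then show ?thesis
          by (simp add: k_def radial[OF s] D_def blinfun.scaleR_right blinfun.diff_right
              scaleR_add_right scaleR_diff_right)
      qed
      then show "(D has_vector_derivative \<omega> (q s) y (D s)) (at s within {0..1})"
        using has_vector_derivative_diff[OF 1 3] by (simp add: D_def[abs_def] scaleR_diff_right)
      show "norm (\<omega> (q s) y (D s)) \<le> norm y * C * norm (D s)"
      proof -
        have "norm (\<omega> (q s) y (D s)) \<le> norm (\<omega> (q s)) * norm y * norm (D s)"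
          by (meson norm_blinfun order_trans mult_right_mono norm_ge_zero)
        also have "\<dots> \<le> C * norm y * norm (D s)"
          using bnd[OF qK[OF s]] by (intro mult_right_mono) auto
        finally show ?thesis by (simp add: mult.commute)
      qed
    qed (simp add: D_def)
    then show ?thesis by (simp add: D_def q_def y_def)
  qed
  then have "blinfun_apply (z' x) = (\<lambda>h. \<omega> x h (z x))" if "x \<in> ?K" for x using that by blast
  then have "(z has_derivative (\<lambda>h. \<omega> x h (z x))) (at x)" if "x \<in> ?K" for x using z[OF that] that by simp
  then show thesis by (rule that[of z, OF z0])
qed

end

text \<open>The expansion over \<open>Basis\<close> makes the operator a finite sum of its values,
  so that continuity and differentiability in a parameter, with respect to the operator norm, follow
  from those of the values.\<close>

definition lift_linear :: "('a::euclidean_space \<Rightarrow> 'w::real_normed_vector) \<Rightarrow> 'a \<Rightarrow>\<^sub>L 'w" where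
  "lift_linear f = (\<Sum>k\<in>Basis. blinfun_scaleR_left (f k) o\<^sub>L blinfun_inner_left k)"

lemma lift_linear_apply: "linear f \<Longrightarrow> lift_linear f h = f h"
proof -
  assume f: "linear f"
  have "lift_linear f h = (\<Sum>k\<in>Basis. (h \<bullet> k) *\<^sub>R f k)"
    by (simp add: lift_linear_def blinfun.sum_left)
  also have "\<dots> = f (\<Sum>k\<in>Basis. (h \<bullet> k) *\<^sub>R k)"
    by (simp add: linear_sum[OF f] linear_cmul[OF f])
  finally show ?thesis by (simp add: euclidean_representation)
qed

lemma lift_linear_has_derivative:
  fixes F :: "'a::euclidean_space \<Rightarrow> 'b::real_normed_vector \<Rightarrow> 'w::real_normed_vector"
  assumes "\<And>k. k \<in> Basis \<Longrightarrow> (F k has_derivative F' k) (at x)"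
  shows "((\<lambda>x. lift_linear (\<lambda>k. F k x)) has_derivative (\<lambda>h. lift_linear (\<lambda>k. F' k h))) (at x)"
  unfolding lift_linear_def
  by (intro has_derivative_sum bounded_linear.has_derivative[OF
        bounded_linear_compose[OF bounded_bilinear.bounded_linear_left[OF bounded_bilinear_blinfun_compose]
          bounded_linear_blinfun_scaleR_left]] assms)

lemma lift_linear_continuous:
  fixes F :: "'a::euclidean_space \<Rightarrow> 'b::topological_space \<Rightarrow> 'w::real_normed_vector"
  assumes "\<And>k. k \<in> Basis \<Longrightarrow> continuous_on S (F k)"
  shows "continuous_on S (\<lambda>x. lift_linear (\<lambda>k. F k x))"
  unfolding lift_linear_def by (intro continuous_intros assms)

lemma lift_linear2_apply:
  fixes W :: "'a::euclidean_space \<Rightarrow> 'v::euclidean_space \<Rightarrow> 'w::real_normed_vector"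
  assumes "bilinear W"
  shows "lift_linear (\<lambda>h. lift_linear (W h)) h v = W h v"
proof -
  have l: "linear (W h)" for h using assms by (simp add: bilinear_def)
  have "linear (\<lambda>h. lift_linear (W h))"
    by (rule linearI; rule blinfun_eqI)
      (simp_all add: lift_linear_apply l blinfun.add_left blinfun.scaleR_left bilinear_ladd[OF assms] bilinear_lmul[OF assms])
  then show ?thesis by (simp add: lift_linear_apply l)
qed

text \<open>Local Frobenius theorem for dz = W z: \<open>flat\<close> is the vanishing of the
  curvature of the connection form W. Compactness bounds the form and its derivative on a closed
  ball, and shrinking the radius reaches the range in which the Picard operator contracts.\<close>

lemma frobenius_linear:
  fixes W :: "'a::euclidean_space \<Rightarrow> 'a \<Rightarrow> 'v::euclidean_space \<Rightarrow> 'v"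
  assumes U: "open U" "x0 \<in> U" and bil: "\<And>x. x \<in> U \<Longrightarrow> bilinear (W x)"
    and smooth: "\<And>h v. smooth_on U (\<lambda>x. W x h v)"
    and flat: "\<And>x h k v. x \<in> U \<Longrightarrow>
      fd (\<lambda>x. W x k v) x h + W x k (W x h v) = fd (\<lambda>x. W x h v) x k + W x h (W x k v)"
  obtains r z where "r > 0" "ball x0 r \<subseteq> U" "z x0 = z0"
    "\<And>x. x \<in> ball x0 r \<Longrightarrow> (z has_derivative (\<lambda>h. W x h (z x))) (at x)"
proof -
  define \<omega> where "\<omega> x = lift_linear (\<lambda>i. lift_linear (\<lambda>j. W x i j))" for x
  define P where "P x k = lift_linear (\<lambda>i. lift_linear (\<lambda>j. fd (\<lambda>x. W x i j) x k))" for x k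
  define \<omega>' where "\<omega>' x = lift_linear (P x)" for x
  have \<omega>: "\<omega> x h v = W x h v" if "x \<in> U" for x h v
    unfolding \<omega>_def by (rule lift_linear2_apply[OF bil[OF that]])
  have dP: "(\<omega> has_derivative P x) (at x)" if "x \<in> U" for x
    unfolding \<omega>_def[abs_def] P_def[abs_def]
    by (intro lift_linear_has_derivative smooth_on_has_derivative[OF smooth that])
  have d\<omega>: "(\<omega> has_derivative \<omega>' x) (at x)" if "x \<in> U" for x
    using dP[OF that] unfolding \<omega>'_def
    by (rule has_derivative_eq_rhs) (simp add: fun_eq_iff lift_linear_apply has_derivative_linear[OF dP[OF that]])
  have c\<omega>': "continuous_on U \<omega>'"
    unfolding \<omega>'_def[abs_def] P_def[abs_def]
    by (intro lift_linear_continuous smooth_on_continuous smooth_on_fd smooth)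
  have c\<omega>: "continuous_on U \<omega>"
    using d\<omega> by (auto intro!: continuous_at_imp_continuous_on has_derivative_continuous)
  have \<omega>': "\<omega>' x h k v = fd (\<lambda>x. W x k v) x h" if x: "x \<in> U" for x h k v
  proof -
    have "((\<lambda>x. \<omega> x k v) has_derivative (\<lambda>h. \<omega>' x h k v)) (at x)"
      using bounded_linear.has_derivative[OF blinfun.bounded_linear_left
          bounded_linear.has_derivative[OF blinfun.bounded_linear_left d\<omega>[OF x]]] .
    then have "fd (\<lambda>x. \<omega> x k v) x = (\<lambda>h. \<omega>' x h k v)" by (rule fd_eq)
    moreover have "fd (\<lambda>x. \<omega> x k v) x = fd (\<lambda>x. W x k v) x"
      by (rule fd_cong_open[OF U(1) x]) (simp add: \<omega>)
    ultimately have "(\<lambda>h. \<omega>' x h k v) = fd (\<lambda>x. W x k v) x" by simp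
    then show ?thesis by (rule fun_cong)
  qed
  obtain e where e: "e > 0" "cball x0 e \<subseteq> U" using U open_contains_cball by blast
  have "bounded (\<omega> ` cball x0 e)" "bounded (\<omega>' ` cball x0 e)"
    using c\<omega> c\<omega>' e(2) by (auto intro!: compact_imp_bounded compact_continuous_image intro: continuous_on_subset)
  then obtain C C' where C: "\<And>x. x \<in> cball x0 e \<Longrightarrow> norm (\<omega> x) \<le> C" "\<And>x. x \<in> cball x0 e \<Longrightarrow> norm (\<omega>' x) \<le> C'"
    by (metis bounded_iff imageI)
  have C0: "C \<ge> 0" using order_trans[OF norm_ge_zero C(1)[of x0]] e(1) by simp
  \<comment> \<open>Then r C is at most C / (4 (C + 1)) \<le> 1/4; the summand 1 covers C =
    0.\<close>
  define r where "r = min e (1 / (4 * (C + 1)))"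
  have r: "r > 0" "r \<le> e" using e(1) C0 by (auto simp: r_def)
  have "r * C \<le> 1 / (4 * (C + 1)) * C" using C0 by (intro mult_right_mono) (auto simp: r_def)
  also have "\<dots> \<le> 1 / 4" using C0 by (simp add: field_simps)
  finally have small: "r * C \<le> 1 / 4" .
  have sub: "ball x0 r \<subseteq> cball x0 e" "ball x0 r \<subseteq> U" using r e(2) by auto
  obtain z where z: "z x0 = z0" "\<And>x. x \<in> ball x0 r \<Longrightarrow> (z has_derivative (\<lambda>h. \<omega> x h (z x))) (at x)"
  proof (rule parallel_extension[of r x0 \<omega> \<omega>' C C' z0])
    show "\<omega>' x h k v + \<omega> x k (\<omega> x h v) = \<omega>' x k h v + \<omega> x h (\<omega> x k v)" if "x \<in> ball x0 r" for x h k v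
      using flat[of x k v h] that sub(2) by (auto simp: \<omega> \<omega>')
  qed (use r small sub C d\<omega> in \<open>auto intro: continuous_on_subset[OF c\<omega>']\<close>)
  show thesis
  proof (rule that[of r z, OF r(1) sub(2) z(1)])
    fix x assume x: "x \<in> ball x0 r"
    then have "(\<lambda>h. \<omega> x h (z x)) = (\<lambda>h. W x h (z x))" using \<omega> sub(2) by blast
    then show "(z has_derivative (\<lambda>h. W x h (z x))) (at x)" using z(2)[OF x] by simp
  qed
qed

text \<open>Uniqueness: along each ray from \<open>x0\<close> the section solves a homogeneous
  linear ordinary differential equation with initial value 0. Applied to a difference, it turns
  equality at one point into equality on a ball.\<close>

lemma parallel_zero:
  fixes W :: "'a::euclidean_space \<Rightarrow> 'a \<Rightarrow> 'v::euclidean_space \<Rightarrow> 'v"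
  assumes bil: "\<And>x. x \<in> ball x0 r \<Longrightarrow> bilinear (W x)"
    and smooth: "\<And>h v. smooth_on (ball x0 r) (\<lambda>x. W x h v)"
    and z: "\<And>x. x \<in> ball x0 r \<Longrightarrow> (z has_derivative (\<lambda>h. W x h (z x))) (at x)"
    and z0: "z x0 = 0" and x: "x \<in> ball x0 r"
  shows "z x = 0"
proof -
  define q where "q s = x0 + s *\<^sub>R (x - x0)" for s
  have qK: "q s \<in> ball x0 r" if "s \<in> {0..1}" for s
  proof -
    have "norm (s *\<^sub>R (x - x0)) \<le> norm (x - x0)" using that by (simp add: mult_left_le_one_le)
    also have "\<dots> < r" using x by (simp add: dist_norm norm_minus_commute)
    finally show ?thesis by (simp add: q_def dist_norm)
  qed
  define \<omega> where "\<omega> x = lift_linear (\<lambda>i. lift_linear (\<lambda>j. W x i j))" for x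
  have \<omega>: "\<omega> x h v = W x h v" if "x \<in> ball x0 r" for x h v
    unfolding \<omega>_def by (rule lift_linear2_apply[OF bil[OF that]])
  have "continuous_on (ball x0 r) \<omega>"
    unfolding \<omega>_def[abs_def] by (intro lift_linear_continuous smooth_on_continuous smooth)
  then have "continuous_on {0..1} (\<lambda>s. \<omega> (q s))"
    by (rule continuous_on_compose2) (use qK in \<open>auto simp: q_def intro!: continuous_intros\<close>)
  then have "bounded ((\<lambda>s. \<omega> (q s)) ` {0..1})"
    by (intro compact_imp_bounded compact_continuous_image) auto
  then obtain C where C: "\<And>s. s \<in> {0..1} \<Longrightarrow> norm (\<omega> (q s)) \<le> C"
    by (metis bounded_iff imageI)
  have "z (q 1) = 0"
  proof (rule linear_growth_zero)
    fix s :: real assume s: "s \<in> {0..1}"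
    have dq: "(q has_derivative (\<lambda>h. h *\<^sub>R (x - x0))) (at s within {0..1})"
      unfolding q_def by (auto intro!: derivative_eq_intros)
    have "((z \<circ> q) has_derivative ((\<lambda>h. W (q s) h (z (q s))) \<circ> (\<lambda>h. h *\<^sub>R (x - x0)))) (at s within {0..1})"
      by (intro diff_chain_within dq has_derivative_at_withinI[OF z[OF qK[OF s]]])
    then show "((\<lambda>s. z (q s)) has_vector_derivative \<omega> (q s) (x - x0) (z (q s))) (at s within {0..1})"
      by (simp add: has_vector_derivative_def o_def \<omega>[OF qK[OF s]] bilinear_lmul[OF bil[OF qK[OF s]]])
    show "norm (\<omega> (q s) (x - x0) (z (q s))) \<le> C * norm (x - x0) * norm (z (q s))"
    proof -
      have "norm (\<omega> (q s) (x - x0) (z (q s))) \<le> norm (\<omega> (q s)) * norm (x - x0) * norm (z (q s))"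
        by (meson norm_blinfun order_trans mult_right_mono norm_ge_zero)
      also have "\<dots> \<le> C * norm (x - x0) * norm (z (q s))"
        using C[OF s] by (intro mult_right_mono) auto
      finally show ?thesis .
    qed
  qed (simp add: q_def z0)
  then show ?thesis by (simp add: q_def)
qed

section \<open>Symmetry of second derivatives\<close>

lemma has_real_derivative_line:
  fixes g :: "'a::real_normed_vector \<Rightarrow> real"
  assumes "g differentiable at (p + t *\<^sub>R w)"
  shows "((\<lambda>t. g (p + t *\<^sub>R w)) has_real_derivative fd g (p + t *\<^sub>R w) w) (at t)"
proof -
  have "((\<lambda>t. p + t *\<^sub>R w) has_derivative (\<lambda>h. h *\<^sub>R w)) (at t)"
    by (auto intro!: derivative_eq_intros)
  from diff_chain_at[OF this fd_works[OF assms]]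
  have "((\<lambda>t. g (p + t *\<^sub>R w)) has_derivative (\<lambda>h. fd g (p + t *\<^sub>R w) (h *\<^sub>R w))) (at t)" by (simp add: o_def)
  moreover have "linear (fd g (p + t *\<^sub>R w))" using fd_works[OF assms] by (rule has_derivative_linear)
  ultimately show ?thesis by (simp add: has_field_derivative_def linear_cmul mult_commute_abs)
qed

text \<open>The mean value theorem is applied twice to the second difference over a parallelogram,
  first along u and then along v.\<close>

lemma mixed_difference_MVT:
  fixes f :: "'a::real_normed_vector \<Rightarrow> real"
  assumes S: "\<And>s t. 0 \<le> s \<Longrightarrow> s \<le> h \<Longrightarrow> 0 \<le> t \<Longrightarrow> t \<le> h \<Longrightarrow> x + s *\<^sub>R u + t *\<^sub>R v \<in> S"
    and f: "\<And>y. y \<in> S \<Longrightarrow> f differentiable at y" "\<And>y. y \<in> S \<Longrightarrow> (\<lambda>x. fd f x u) differentiable at y"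
    and h: "h > 0"
  shows "\<exists>s t. 0 < s \<and> s < h \<and> 0 < t \<and> t < h \<and>
    f (x + h *\<^sub>R u + h *\<^sub>R v) - f (x + h *\<^sub>R u) - f (x + h *\<^sub>R v) + f x
      = h * h * fd (\<lambda>x. fd f x u) (x + s *\<^sub>R u + t *\<^sub>R v) v"
proof -
  let ?g = "\<lambda>s. f ((x + h *\<^sub>R v) + s *\<^sub>R u) - f (x + s *\<^sub>R u)"
  have "\<exists>s. 0 < s \<and> s < h \<and> ?g h - ?g 0 = (h - 0) * (fd f ((x + h *\<^sub>R v) + s *\<^sub>R u) u - fd f (x + s *\<^sub>R u) u)"
  proof (rule MVT2[OF h])
    fix s assume s: "0 \<le> s" "s \<le> h"
    show "(?g has_real_derivative fd f ((x + h *\<^sub>R v) + s *\<^sub>R u) u - fd f (x + s *\<^sub>R u) u) (at s)"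
      using f(1)[OF S[of s h]] f(1)[OF S[of s 0]] s h
      by (intro DERIV_diff has_real_derivative_line) (simp_all add: ac_simps)
  qed
  then obtain s where s: "0 < s" "s < h"
    "?g h - ?g 0 = h * (fd f ((x + s *\<^sub>R u) + h *\<^sub>R v) u - fd f ((x + s *\<^sub>R u) + 0 *\<^sub>R v) u)"
    by (auto simp: ac_simps)
  have "\<exists>t. 0 < t \<and> t < h \<and> fd f ((x + s *\<^sub>R u) + h *\<^sub>R v) u - fd f ((x + s *\<^sub>R u) + 0 *\<^sub>R v) u
      = (h - 0) * fd (\<lambda>x. fd f x u) ((x + s *\<^sub>R u) + t *\<^sub>R v) v"
    using f(2) S s(1,2) h by (intro MVT2 has_real_derivative_line) auto
  then obtain t where t: "0 < t" "t < h" "fd f ((x + s *\<^sub>R u) + h *\<^sub>R v) u - fd f ((x + s *\<^sub>R u) + 0 *\<^sub>R v) u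
      = h * fd (\<lambda>x. fd f x u) ((x + s *\<^sub>R u) + t *\<^sub>R v) v" by auto
  have "f (x + h *\<^sub>R u + h *\<^sub>R v) - f (x + h *\<^sub>R u) - f (x + h *\<^sub>R v) + f x = ?g h - ?g 0"
    by (simp add: ac_simps)
  also have "\<dots> = h * (h * fd (\<lambda>x. fd f x u) (x + s *\<^sub>R u + t *\<^sub>R v) v)" by (simp only: s(3) t(3))
  finally show ?thesis using s(1,2) t(1,2) by (auto simp: mult.assoc)
qed

text \<open>The second difference is symmetric in u and v, so it equals h^2 times either mixed
  derivative, each at some point near x. Continuity of both mixed derivatives forces equality at
  x.\<close>

lemma fd_commute:
  fixes f :: "'a::real_normed_vector \<Rightarrow> real"
  assumes S: "open S" "x \<in> S" and f: "smooth_on S f"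
  shows "fd (\<lambda>x. fd f x u) x v = fd (\<lambda>x. fd f x v) x u"
proof (rule ccontr)
  assume ne: "fd (\<lambda>x. fd f x u) x v \<noteq> fd (\<lambda>x. fd f x v) x u"
  let ?a = "\<lambda>y. fd (\<lambda>x. fd f x u) y v" and ?b = "\<lambda>y. fd (\<lambda>x. fd f x v) y u"
  have c: "continuous_on S ?a" "continuous_on S ?b"
    by (intro smooth_on_continuous smooth_on_fd f)+
  define e where "e = \<bar>?a x - ?b x\<bar> / 2"
  have e: "e > 0" using ne by (simp add: e_def)
  obtain d1 where d1: "d1 > 0" "\<And>y. y \<in> S \<Longrightarrow> dist y x < d1 \<Longrightarrow> dist (?a y) (?a x) < e"
    using c(1) S(2) e unfolding continuous_on_iff by blast
  obtain d2 where d2: "d2 > 0" "\<And>y. y \<in> S \<Longrightarrow> dist y x < d2 \<Longrightarrow> dist (?b y) (?b x) < e"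
    using c(2) S(2) e unfolding continuous_on_iff by blast
  obtain d3 where d3: "d3 > 0" "ball x d3 \<subseteq> S" using S open_contains_ball by blast
  define d where "d = min d1 (min d2 d3)"
  \<comment> \<open>The parallelogram with sides h u and h v has to stay within distance d of x; the
    summand 1 keeps \<open>N\<close> positive when u = v = 0.\<close>
  define N where "N = norm u + norm v + 1"
  define h where "h = d / (2 * N)"
  have d: "d > 0" using d1 d2 d3 by (simp add: d_def)
  have n: "N > 0" by (simp add: N_def add_nonneg_pos)
  have h: "h > 0" using d n by (simp add: h_def)
  have near: "dist (x + s *\<^sub>R u + t *\<^sub>R v) x < d" if "0 \<le> s" "s \<le> h" "0 \<le> t" "t \<le> h" for s t
  proof -
    have "dist (x + s *\<^sub>R u + t *\<^sub>R v) x = norm (s *\<^sub>R u + t *\<^sub>R v)" by (simp add: dist_norm add.assoc)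
    also have "\<dots> \<le> s * norm u + t * norm v" using that by (intro norm_triangle_le) simp
    also have "\<dots> \<le> h * norm u + h * norm v" using that by (intro add_mono mult_right_mono) auto
    also have "\<dots> \<le> h * N" using h by (simp add: N_def algebra_simps)
    also have "\<dots> = d / 2" using n by (simp add: h_def)
    also have "\<dots> < d" using d by simp
    finally show ?thesis .
  qed
  have inS: "x + s *\<^sub>R u + t *\<^sub>R v \<in> S" if "0 \<le> s" "s \<le> h" "0 \<le> t" "t \<le> h" for s t
    using near[OF that] d3(2) by (auto simp: d_def dist_commute)
  have diff: "f differentiable at y" "(\<lambda>x. fd f x w) differentiable at y" if "y \<in> S" for y w
    using smooth_on_differentiable[OF f that] smooth_on_differentiable[OF smooth_on_fd[OF f] that] by auto
  obtain s t where st: "0 < s" "s < h" "0 < t" "t < h"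
    "f (x + h *\<^sub>R u + h *\<^sub>R v) - f (x + h *\<^sub>R u) - f (x + h *\<^sub>R v) + f x = h * h * ?a (x + s *\<^sub>R u + t *\<^sub>R v)"
    using mixed_difference_MVT[of h x u v S f, OF inS diff(1) diff(2) h] by blast
  obtain s' t' where st': "0 < s'" "s' < h" "0 < t'" "t' < h"
    "f (x + h *\<^sub>R v + h *\<^sub>R u) - f (x + h *\<^sub>R v) - f (x + h *\<^sub>R u) + f x = h * h * ?b (x + s' *\<^sub>R v + t' *\<^sub>R u)"
  proof -
    have "x + s *\<^sub>R v + t *\<^sub>R u \<in> S" if "0 \<le> s" "s \<le> h" "0 \<le> t" "t \<le> h" for s t
      using inS[of t s] that by (simp add: ac_simps)
    then show thesis
      using mixed_difference_MVT[of h x v u S f, OF _ diff(1) diff(2) h] that by blast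
  qed
  have "h * h * ?a (x + s *\<^sub>R u + t *\<^sub>R v) = h * h * ?b (x + t' *\<^sub>R u + s' *\<^sub>R v)"
  proof -
    have c: "x + h *\<^sub>R v + h *\<^sub>R u = x + h *\<^sub>R u + h *\<^sub>R v" "x + s' *\<^sub>R v + t' *\<^sub>R u = x + t' *\<^sub>R u + s' *\<^sub>R v"
      by (simp_all add: ac_simps)
    show ?thesis using st(5) st'(5) unfolding c by linarith
  qed
  moreover have "h * h \<noteq> 0" using h by simp
  ultimately have eq: "?a (x + s *\<^sub>R u + t *\<^sub>R v) = ?b (x + t' *\<^sub>R u + s' *\<^sub>R v)"
    using mult_left_cancel by blast
  have "dist (?a (x + s *\<^sub>R u + t *\<^sub>R v)) (?a x) < e"
    using near[of s t] st inS[of s t] by (intro d1) (auto simp: d_def)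
  moreover have "dist (?b (x + t' *\<^sub>R u + s' *\<^sub>R v)) (?b x) < e"
    using near[of t' s'] st' inS[of t' s'] by (intro d2) (auto simp: d_def)
  ultimately have "\<bar>?a x - ?b x\<bar> < 2 * e" unfolding eq dist_real_def by linarith
  then show False by (simp add: e_def)
qed

section \<open>Curvature tensors annihilated by a nonnull vector\<close>

lemma UNIV_eq_of_distinct4:
  fixes p q r k :: 4
  assumes "p \<noteq> q" "p \<noteq> r" "p \<noteq> k" "q \<noteq> r" "q \<noteq> k" "r \<noteq> k"
  shows "UNIV = {p, q, r, k}"
proof -
  have "card {p, q, r, k} = CARD(4)" using assms by simp
  then show ?thesis by (metis card_subset_eq finite subset_UNIV)
qed

text \<open>With the index k dead, only three indices are live, as in dimension three. Each
  off-diagonal Ricci component is then a single curvature component up to sign, and the diagonal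
  ones determine the three sectional terms.\<close>

lemma curvature_components_zero:
  fixes q :: "4 \<Rightarrow> 4 \<Rightarrow> 4 \<Rightarrow> 4 \<Rightarrow> real"
  assumes a12: "\<And>a b c d. q a b c d = - q b a c d" and a34: "\<And>a b c d. q a b c d = - q a b d c"
    and pair: "\<And>a b c d. q a b c d = q c d a b"
    and \<sigma>: "\<And>a. \<sigma> a = 1 \<or> \<sigma> a = -1"
    and trace: "\<And>b c. (\<Sum>a\<in>UNIV. \<sigma> a * q a b c a) = 0"
    and kill: "\<And>a b c. q a b c k = 0"
  shows "q a b c d = 0"
proof -
  have z1: "q a a c d = 0" and z2: "q a b c c = 0" for a b c d
    using a12[of a a c d] a34[of a b c c] by linarith+
  have k1: "q k b c d = 0" "q b k c d = 0" "q b c k d = 0" for b c d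
    using kill a12 a34 pair by (metis add.inverse_neutral)+
  have sum4: "\<sigma> p * q p b c p + \<sigma> t * q t b c t + \<sigma> r * q r b c r = 0"
    if "p \<noteq> t" "p \<noteq> r" "p \<noteq> k" "t \<noteq> r" "t \<noteq> k" "r \<noteq> k" for p t r b c
    using trace[of b c] that by (simp add: UNIV_eq_of_distinct4[OF that] kill)
  have off: "q p t r p = 0" if "p \<noteq> t" "p \<noteq> r" "p \<noteq> k" "t \<noteq> r" "t \<noteq> k" "r \<noteq> k" for p t r
    using sum4[OF that, of t r] \<sigma>[of p] by (auto simp: z1 z2)
  have diag: "q p t t p = 0" if "p \<noteq> t" "p \<noteq> k" "t \<noteq> k" for p t
  proof -
    have "\<exists>r. r \<notin> {p, t, k}"
    proof (rule ccontr)
      assume "\<not> ?thesis"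
      then have "UNIV = {p, t, k}" by auto
      then have "CARD(4) = card {p, t, k}" by simp
      also have "\<dots> \<le> 3" by (simp add: card_insert_if)
      finally show False by simp
    qed
    then obtain r where r: "r \<noteq> p" "r \<noteq> t" "r \<noteq> k" by auto
    have s: "q t p p t = q p t t p" "q r t t r = q t r r t" "q r p p r = q p r r p"
      using a12 a34 by (metis minus_minus)+
    \<comment> \<open>The three diagonal Ricci components couple the three sectional terms pairwise.
      For signs \<sigma> the determinant of this system is 2 or -2.\<close>
    have "\<sigma> p * q p t t p + \<sigma> r * q t r r t = 0" "\<sigma> t * q p t t p + \<sigma> r * q p r r p = 0"
      "\<sigma> p * q p r r p + \<sigma> t * q t r r t = 0"
      using sum4[of p t r t t] sum4[of p t r p p] sum4[of p t r r r] that r by (auto simp: z1 z2 s)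
    then show ?thesis using \<sigma>[of p] \<sigma>[of t] \<sigma>[of r] by auto
  qed
  have main: "q a b c a = 0" for a b c
  proof (cases "a = k \<or> b = k \<or> c = k \<or> a = b \<or> a = c")
    case True
    then show ?thesis by (auto simp: k1 kill z1 z2)
  next
    case False
    then show ?thesis using diag off by (cases "b = c") auto
  qed
  \<comment> \<open>Four positions filled from three live indices always repeat one of them; a
    repetition across the two pairs is, up to sign, a component treated in
    \<open>main\<close>.\<close>
  show ?thesis
  proof (cases "a = k \<or> b = k \<or> c = k \<or> d = k \<or> a = b \<or> c = d \<or> a = d \<or> a = c \<or> b = c \<or> b = d")
    case True
    moreover have "q a b a d = 0" "q a b c b = 0" "q a b b d = 0"
      using main a12 a34 by (metis add.inverse_neutral)+
    ultimately show ?thesis by (auto simp: k1 kill z1 z2 main)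
  next
    case False
    then have "UNIV = {a, b, c, k}" using UNIV_eq_of_distinct4[of a b c k] by auto
    then have "d \<in> {a, b, c, k}" by blast
    then show ?thesis using False by auto
  qed
qed

text \<open>The octahedron argument: the Bianchi identities for the four cyclic shifts of (u, v, w,
  z) are combined with the antisymmetries.\<close>

lemma pair_symmetry:
  fixes Q :: "'a \<Rightarrow> 'a \<Rightarrow> 'a \<Rightarrow> 'a \<Rightarrow> real"
  assumes a12: "\<And>u v w z. Q u v w z = - Q v u w z" and a34: "\<And>u v w z. Q u v w z = - Q u v z w"
    and bianchi: "\<And>u v w z. Q u v w z + Q v w u z + Q w u v z = 0"
  shows "Q u v w z = Q w z u v"
  using bianchi[of u v w z] bianchi[of v w z u] bianchi[of w z u v] bianchi[of z u v w]
    a12[of u v w z] a12[of v w u z] a12[of w u v z] a12[of v w z u] a12[of w z v u] a12[of z v w u]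
    a12[of w z u v] a12[of z u w v] a12[of u w z v] a12[of z u v w] a12[of u v z w] a12[of v z u w]
    a34[of u v w z] a34[of v w u z] a34[of w u v z] a34[of v w z u] a34[of w z v u] a34[of z v w u]
    a34[of w z u v] a34[of z u w v] a34[of u w z v] a34[of z u v w] a34[of u v z w] a34[of v z u w]
  by linarith

section \<open>Orthonormal frames of an indefinite form\<close>

lemma inner_matrix_symmetric:
  fixes M :: "real ^ 'n ^ 'n"
  assumes "transpose M = M"
  shows "v \<bullet> (M *v w) = w \<bullet> (M *v v)"
  by (metis assms dot_lmul_matrix inner_commute vector_transpose_matrix)

lemma inner_matrix_axis: "axis a 1 \<bullet> (M *v axis b 1) = (M :: real ^ 'n ^ 'n) $ a $ b"
  by (simp add: matrix_vector_mult_basis column_def inner_axis')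

lemma transpose_conj_entry:
  fixes P M :: "real ^ 'n ^ 'n"
  shows "(transpose P ** M ** P) $ a $ b = column a P \<bullet> (M *v column b P)"
proof -
  have "(transpose P ** M ** P) $ a $ b = axis a 1 \<bullet> ((transpose P ** M ** P) *v axis b 1)"
    by (simp add: inner_matrix_axis)
  also have "\<dots> = axis a 1 \<bullet> (transpose P *v (M *v (P *v axis b 1)))"
    by (simp add: matrix_vector_mul_assoc matrix_mul_assoc)
  also have "\<dots> = (P *v axis a 1) \<bullet> (M *v (P *v axis b 1))"
    by (metis dot_lmul_matrix vector_transpose_matrix transpose_transpose)
  finally show ?thesis by (simp add: matrix_vector_mult_basis)
qed

text \<open>For an indefinite form v - u may be null. The norms of v - u and v + u add up to 4 e,
  however, so at least one of them is nonnull, and the reflection along that vector sends v to u or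
  to -u.\<close>

lemma reflection_exists:
  fixes M :: "real ^ 'n ^ 'n"
  assumes M: "transpose M = M" and uv: "u \<bullet> (M *v u) = e" "v \<bullet> (M *v v) = e" and e: "e \<noteq> 0"
  obtains H s where "\<And>x y. H x \<bullet> (M *v H y) = x \<bullet> (M *v y)" "H v = s *\<^sub>R u" "s = 1 \<or> s = -1"
proof -
  have refl: "\<exists>H. (\<forall>x y. H x \<bullet> (M *v H y) = x \<bullet> (M *v y)) \<and> H v = s *\<^sub>R u"
    if s: "s = 1 \<or> s = -1" and w: "(v - s *\<^sub>R u) \<bullet> (M *v (v - s *\<^sub>R u)) \<noteq> 0" for s :: real
  proof -
    define w where "w = v - s *\<^sub>R u"
    define c where "c = w \<bullet> (M *v w)"
    define H where "H x = x - (2 * (x \<bullet> (M *v w)) / c) *\<^sub>R w" for x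
    have c: "c \<noteq> 0" using w by (simp add: c_def w_def)
    have "H x \<bullet> (M *v H y) = x \<bullet> (M *v y)" for x y
    proof -
      have "H x \<bullet> (M *v H y) = x \<bullet> (M *v y) - (2 * (y \<bullet> (M *v w)) / c) * (x \<bullet> (M *v w))
         - (2 * (x \<bullet> (M *v w)) / c) * (y \<bullet> (M *v w))
         + (2 * (x \<bullet> (M *v w)) / c) * (2 * (y \<bullet> (M *v w)) / c) * c"
        using inner_matrix_symmetric[OF M, of w y]
        by (simp add: H_def c_def matrix_vector_mult_diff_distrib matrix_vector_mult_scaleR algebra_simps)
      also have "\<dots> = x \<bullet> (M *v y)" using c by (simp add: field_simps)
      finally show ?thesis .
    qed
    moreover have "H v = s *\<^sub>R u"
    proof -
      have "s * s = 1" using s by auto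
      then have "(s *\<^sub>R u) \<bullet> (M *v (s *\<^sub>R u)) = e"
        using uv by (simp add: matrix_vector_mult_scaleR flip: mult.assoc)
      then have "c = 2 * (v \<bullet> (M *v w))"
        unfolding c_def w_def using uv inner_matrix_symmetric[OF M, of v "s *\<^sub>R u"]
        by (simp add: matrix_vector_mult_diff_distrib inner_diff_left inner_diff_right)
      then have "2 * (v \<bullet> (M *v w)) / c = 1" using c by simp
      then show ?thesis by (simp add: H_def w_def)
    qed
    ultimately show ?thesis by blast
  qed
  have "(v - 1 *\<^sub>R u) \<bullet> (M *v (v - 1 *\<^sub>R u)) + (v - (-1) *\<^sub>R u) \<bullet> (M *v (v - (-1) *\<^sub>R u)) = 4 * e"
    using uv by (simp add: matrix_vector_mult_diff_distrib matrix_vector_right_distrib inner_diff_left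
        inner_diff_right inner_add_left inner_add_right)
  then have "(v - 1 *\<^sub>R u) \<bullet> (M *v (v - 1 *\<^sub>R u)) \<noteq> 0 \<or> (v - (-1) *\<^sub>R u) \<bullet> (M *v (v - (-1) *\<^sub>R u)) \<noteq> 0"
    using e by auto
  then show thesis using refl[of 1] refl[of "-1"] that by blast
qed

text \<open>A reflection carries a vector of the given orthonormal frame to a multiple of \<open>B\<close>.\<close>

lemma adapted_frame:
  fixes M :: "real ^ 4 ^ 4"
  assumes M: "transpose M = M" and P: "transpose P ** M ** P = minkowski"
    and B: "B \<bullet> (M *v B) \<noteq> 0"
  obtains f :: "4 \<Rightarrow> real ^ 4" and \<sigma> :: "4 \<Rightarrow> real" and k c
  where "\<And>a b. f a \<bullet> (M *v f b) = (if a = b then \<sigma> a else 0)" "\<And>a. \<sigma> a = 1 \<or> \<sigma> a = -1"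
    "f k = c *\<^sub>R B"
proof -
  define \<sigma> :: "4 \<Rightarrow> real" where "\<sigma> a = (if a = 1 then -1 else 1)" for a
  have frame: "column a P \<bullet> (M *v column b P) = (if a = b then \<sigma> a else 0)" for a b
    using arg_cong[OF P, of "\<lambda>X. X $ a $ b"] by (simp add: transpose_conj_entry minkowski_def \<sigma>_def)
  define N where "N = sqrt \<bar>B \<bullet> (M *v B)\<bar>"
  define u where "u = (1 / N) *\<^sub>R B"
  \<comment> \<open>An index whose frame vector has the causal sign of \<open>B\<close>: 1 is
    timelike, 2 is spacelike. Only such a vector can be carried to \<open>u\<close> by an
    isometry.\<close>
  define k :: 4 where "k = (if B \<bullet> (M *v B) > 0 then 2 else 1)"
  have N: "N * N = \<bar>B \<bullet> (M *v B)\<bar>" "N \<noteq> 0" using B by (auto simp: N_def)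
  have "u \<bullet> (M *v u) = (B \<bullet> (M *v B)) / (N * N)" by (simp add: u_def matrix_vector_mult_scaleR)
  then have "u \<bullet> (M *v u) = \<sigma> k" using B by (auto simp: N(1) k_def \<sigma>_def)
  moreover have "column k P \<bullet> (M *v column k P) = \<sigma> k" by (simp add: frame)
  moreover have "\<sigma> k \<noteq> 0" by (simp add: \<sigma>_def)
  ultimately obtain H s where H: "\<And>x y. H x \<bullet> (M *v H y) = x \<bullet> (M *v y)" "H (column k P) = s *\<^sub>R u"
    using reflection_exists[OF M, of u "\<sigma> k" "column k P"] by metis
  show thesis
    by (rule that[of "\<lambda>a. H (column a P)" \<sigma> k "s / N"]) (auto simp: H frame, auto simp: \<sigma>_def u_def)
qed

text \<open>The dual coframe of an orthonormal frame is \<sigma> times the frame lowered by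
  \<open>M\<close>. Orthonormality says that it is a left inverse of the frame matrix; for square
  matrices a left inverse is a right inverse, which is the expansion.\<close>

lemma frame_expansion:
  fixes M :: "real ^ 'n ^ 'n" and f :: "'n \<Rightarrow> real ^ 'n"
  assumes f: "\<And>a b. f a \<bullet> (M *v f b) = (if a = b then \<sigma> a else 0)" and \<sigma>: "\<And>a. \<sigma> a = 1 \<or> \<sigma> a = -1"
  shows "v = (\<Sum>a\<in>UNIV. (\<sigma> a * (f a \<bullet> (M *v v))) *\<^sub>R f a)"
proof -
  define F :: "real ^ 'n ^ 'n" where "F = (\<chi> i a. f a $ i)"
  define K :: "real ^ 'n ^ 'n" where "K = (\<chi> a. \<sigma> a *\<^sub>R (f a v* M))"
  have col: "F *v c = (\<Sum>a\<in>UNIV. (c $ a) *\<^sub>R f a)" for c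
    by (simp add: F_def matrix_vector_mult_def vec_eq_iff mult.commute)
  have Kv: "(K *v x) $ a = \<sigma> a * (f a \<bullet> (M *v x))" for x a
  proof -
    have "(K *v x) $ a = \<sigma> a * ((f a v* M) \<bullet> x)"
      by (simp add: K_def matrix_vector_mult_def inner_vec_def sum_distrib_left mult.assoc)
    then show ?thesis by (simp only: dot_lmul_matrix)
  qed
  have "K ** F = mat 1"
  proof (subst matrix_eq, rule allI)
    fix c
    have "(K *v (F *v c)) $ a = c $ a" for a
    proof -
      have "(K *v (F *v c)) $ a = \<sigma> a * (\<Sum>b\<in>UNIV. c $ b * (f a \<bullet> (M *v f b)))"
        by (simp add: Kv col linear_sum[OF matrix_vector_mul_linear] matrix_vector_mult_scaleR inner_sum_right
            sum_distrib_left mult.left_commute)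
      also have "\<dots> = \<sigma> a * (c $ a * \<sigma> a)" by (simp add: f if_distrib cong: if_cong)
      also have "\<dots> = c $ a" using \<sigma>[of a] by auto
      finally show ?thesis .
    qed
    then show "(K ** F) *v c = mat 1 *v c" by (simp add: vec_eq_iff flip: matrix_vector_mul_assoc)
  qed
  then have "F ** K = mat 1" by (simp add: matrix_left_right_inverse)
  then have "F *v (K *v v) = v" by (simp add: matrix_vector_mul_assoc)
  then show ?thesis by (simp add: col Kv)
qed

text \<open>Basis independence of the trace, with the dual frame expressed by the metric. It moves
  the coordinate contraction that defines Ricci into the adapted frame.\<close>

lemma trace_in_frame:
  fixes M :: "real ^ 'n ^ 'n" and f :: "'n \<Rightarrow> real ^ 'n"
  assumes M: "transpose M = M"
    and f: "\<And>a b. f a \<bullet> (M *v f b) = (if a = b then \<sigma> a else 0)" and \<sigma>: "\<And>a. \<sigma> a = 1 \<or> \<sigma> a = -1"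
    and L: "linear L"
  shows "(\<Sum>i\<in>UNIV. L (axis i 1) $ i) = (\<Sum>a\<in>UNIV. \<sigma> a * (L (f a) \<bullet> (M *v f a)))"
proof -
  have "L (axis i 1) = (\<Sum>a\<in>UNIV. (\<sigma> a * (axis i 1 \<bullet> (M *v f a))) *\<^sub>R L (f a))" for i
  proof -
    have "L (axis i 1) = L (\<Sum>a\<in>UNIV. (\<sigma> a * (f a \<bullet> (M *v axis i 1))) *\<^sub>R f a)"
      using frame_expansion[OF f \<sigma>, of "axis i 1"] by simp
    then show ?thesis
      by (simp add: linear_sum[OF L] linear_cmul[OF L] inner_matrix_symmetric[OF M, of "axis i 1"])
  qed
  then have "(\<Sum>i\<in>UNIV. L (axis i 1) $ i) = (\<Sum>i\<in>UNIV. \<Sum>a\<in>UNIV. \<sigma> a * (M *v f a) $ i * L (f a) $ i)"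
    by (simp add: inner_axis')
  also have "\<dots> = (\<Sum>a\<in>UNIV. \<Sum>i\<in>UNIV. \<sigma> a * (M *v f a) $ i * L (f a) $ i)" by (rule sum.swap)
  also have "\<dots> = (\<Sum>a\<in>UNIV. \<sigma> a * (L (f a) \<bullet> (M *v f a)))"
    by (simp add: inner_vec_def sum_distrib_left ac_simps)
  finally show ?thesis .
qed

text \<open>Contracting in a frame adapted to \<open>B\<close> reduces the claim to the fact that a Ricci-flat
  curvature tensor in dimension three vanishes.\<close>

lemma algebraic_curvature_zero:
  fixes R :: "real ^ 4 \<Rightarrow> real ^ 4 \<Rightarrow> real ^ 4 \<Rightarrow> real ^ 4" and M :: "real ^ 4 ^ 4"
  assumes M: "transpose M = M" and P: "transpose P ** M ** P = minkowski"
    and B: "B \<bullet> (M *v B) \<noteq> 0"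
    and lin: "\<And>v w. linear (\<lambda>u. R u v w)" "\<And>u w. linear (\<lambda>v. R u v w)" "\<And>u v. linear (\<lambda>w. R u v w)"
    and a12: "\<And>u v w. R u v w = - R v u w"
    and a34: "\<And>u v w z. R u v w \<bullet> (M *v z) = - (R u v z \<bullet> (M *v w))"
    and bianchi: "\<And>u v w. R u v w + R v w u + R w u v = 0"
    and ricci: "\<And>v. (\<Sum>i\<in>UNIV. R (axis i 1) v v $ i) = 0"
    and kill: "\<And>u v w. R u v w \<bullet> (M *v B) = 0"
  shows "R u v w = 0"
proof -
  obtain f :: "4 \<Rightarrow> real ^ 4" and \<sigma> :: "4 \<Rightarrow> real" and k c
    where f: "\<And>a b. f a \<bullet> (M *v f b) = (if a = b then \<sigma> a else 0)" and \<sigma>: "\<And>a. \<sigma> a = 1 \<or> \<sigma> a = -1"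
      and fk: "f k = c *\<^sub>R B"
    using adapted_frame[OF M P B] by blast
  define Q where "Q u v w z = R u v w \<bullet> (M *v z)" for u v w z
  have Q12: "Q u v w z = - Q v u w z" for u v w z
    unfolding Q_def by (subst a12) simp
  have Q34: "Q u v w z = - Q u v z w" for u v w z
    unfolding Q_def by (rule a34)
  have Qb: "Q u v w z + Q v w u z + Q w u v z = 0" for u v w z
    unfolding Q_def by (simp add: bianchi flip: inner_add_left)
  have Qp: "Q u v w z = Q w z u v" for u v w z
    by (rule pair_symmetry[of Q, OF Q12 Q34 Qb])
  define T where "T v w = (\<Sum>i\<in>UNIV. R (axis i 1) v w $ i)" for v w
  have T: "T v w = (\<Sum>a\<in>UNIV. \<sigma> a * Q (f a) v w (f a))" for v w
    unfolding T_def Q_def by (rule trace_in_frame[OF M f \<sigma> lin(1)])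
  \<comment> \<open>The hypothesis on Ricci concerns equal arguments only; polarising it requires
    this symmetry, which comes from pair symmetry.\<close>
  have Tsym: "T v w = T w v" for v w
  proof -
    have "Q (f a) v w (f a) = Q (f a) w v (f a)" for a
      using Qp[of "f a" v w "f a"] Q12[of w "f a" "f a" v] Q34[of "f a" w "f a" v] by linarith
    then show ?thesis by (simp add: T)
  qed
  have "T (v + w) (v + w) = T v v + T v w + T w v + T w w" for v w
    by (simp add: T_def linear_add[OF lin(2)] linear_add[OF lin(3)] sum.distrib)
  then have T0: "T v w = 0" for v w
    using ricci[folded T_def] Tsym[of v w] by (smt (verit))
  have q0: "Q (f a) (f b) (f c) (f d) = 0" for a b c d
  proof (rule curvature_components_zero[where q = "\<lambda>a b c d. Q (f a) (f b) (f c) (f d)" and k = k and \<sigma> = \<sigma>])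
    show "(\<Sum>a\<in>UNIV. \<sigma> a * Q (f a) (f b) (f c) (f a)) = 0" for b c using T0[of "f b" "f c"] by (simp add: T)
    show "Q (f a) (f b) (f c) (f k) = 0" for a b c by (simp add: Q_def fk matrix_vector_mult_scaleR kill)
  qed (rule Q12 Q34 Qp \<sigma>)+
  have r0: "R (f a) (f b) (f c) = 0" for a b c
  proof -
    have "f d \<bullet> (M *v R (f a) (f b) (f c)) = 0" for d
      using q0[of a b c d] inner_matrix_symmetric[OF M] by (simp add: Q_def)
    then show ?thesis using frame_expansion[OF f \<sigma>, of "R (f a) (f b) (f c)"] by simp
  qed
  have exp: "\<exists>c. x = (\<Sum>a\<in>UNIV. c a *\<^sub>R f a)" for x
    by (rule exI[of _ "\<lambda>a. \<sigma> a * (f a \<bullet> (M *v x))"]) (rule frame_expansion[OF f \<sigma>])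
  have r1: "R (f a) (f b) x = 0" for a b x
    using exp[of x] by (auto simp: linear_sum[OF lin(3)] linear_cmul[OF lin(3)] r0)
  have r2: "R (f a) y x = 0" for a y x
    using exp[of y] by (auto simp: linear_sum[OF lin(2)] linear_cmul[OF lin(2)] r1)
  show ?thesis
    using exp[of u] by (auto simp: linear_sum[OF lin(1)] linear_cmul[OF lin(1)] r2)
qed

section \<open>Parallel metrics and covectors\<close>

lemma bounded_bilinear_matrix_vector: "bounded_bilinear ((*v) :: real ^ 'n ^ 'm \<Rightarrow> real ^ 'n \<Rightarrow> real ^ 'm)"
  unfolding bilinear_conv_bounded_bilinear[symmetric] bilinear_def
  by (auto intro!: linearI simp: matrix_vector_mult_add_rdistrib matrix_vector_right_distrib
      matrix_vector_mult_scaleR scaleR_matrix_vector_assoc)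

lemma bounded_bilinear_matrix_matrix: "bounded_bilinear ((**) :: real ^ 'n ^ 'm \<Rightarrow> real ^ 'k ^ 'n \<Rightarrow> real ^ 'k ^ 'm)"
  unfolding bilinear_conv_bounded_bilinear[symmetric] bilinear_def
  by (auto intro!: linearI simp: matrix_matrix_mult_def vec_eq_iff sum.distrib algebra_simps sum_distrib_left)

lemma linear_transpose: "linear (transpose :: real ^ 'n ^ 'm \<Rightarrow> real ^ 'm ^ 'n)"
  by (rule linearI) (simp_all add: transpose_def vec_eq_iff)

lemma matrix_works_linear: "linear (f :: real ^ 'n \<Rightarrow> real ^ 'm) \<Longrightarrow> matrix f *v x = f x"
  by (simp add: matrix_works)

text \<open>Bootstrapping: the derivative \<open>W x h (z x)\<close> is as often differentiable as
  \<open>z\<close>, so each order yields the next.\<close>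

lemma parallel_smooth:
  fixes W :: "'a::euclidean_space \<Rightarrow> 'a \<Rightarrow> 'v::euclidean_space \<Rightarrow> 'v"
  assumes S: "open S" and bil: "\<And>x. x \<in> S \<Longrightarrow> bilinear (W x)"
    and smooth: "\<And>h v. smooth_on S (\<lambda>x. W x h v)"
    and z: "\<And>x. x \<in> S \<Longrightarrow> (z has_derivative (\<lambda>h. W x h (z x))) (at x)"
  shows "smooth_on S z"
  unfolding smooth_on_def
proof
  fix n
  show "higher_differentiable_on n S z"
  proof (induction n)
    case 0
    show ?case
      using z by (auto intro!: continuous_at_imp_continuous_on has_derivative_continuous)
  next
    case (Suc n)
    have W: "W x h v = (\<Sum>j\<in>Basis. (v \<bullet> j) *\<^sub>R W x h j)" if "x \<in> S" for x h v
    proof -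
      have l: "linear (W x h)" using bil[OF that] by (simp add: bilinear_def)
      have "W x h (\<Sum>j\<in>Basis. (v \<bullet> j) *\<^sub>R j) = (\<Sum>j\<in>Basis. (v \<bullet> j) *\<^sub>R W x h j)"
        by (simp add: linear_sum[OF l] linear_cmul[OF l])
      then show ?thesis by (simp only: euclidean_representation)
    qed
    have "higher_differentiable_on n S (\<lambda>x. \<Sum>j\<in>Basis. (z x \<bullet> j) *\<^sub>R W x h j)" for h
      by (intro higher_differentiable_on_sum higher_differentiable_on_bilinear[OF bounded_bilinear_scaleR]
          higher_differentiable_on_bilinear[OF bounded_bilinear_inner] S Suc higher_differentiable_on_const)
        (use smooth in \<open>simp add: smooth_on_def\<close>)
    then have "higher_differentiable_on n S (\<lambda>x. W x h (z x))" for h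
      by (subst higher_differentiable_on_cong[OF S W])
    then show ?case using higher_differentiable_on_SucI[OF S z] by blast
  qed
qed

lemma minkowski_square: "minkowski ** minkowski = mat 1"
proof -
  have "(minkowski ** minkowski) $ i $ j = (\<Sum>k\<in>UNIV. if k = i then minkowski $ i $ i * minkowski $ i $ j else 0)" for i j
    unfolding matrix_matrix_mult_def vec_lambda_beta by (rule sum.cong) (simp_all add: minkowski_def)
  then show ?thesis by (simp add: vec_eq_iff mat_def) (simp add: minkowski_def)
qed

lemma det_minkowski: "det minkowski \<noteq> 0"
  using arg_cong[OF minkowski_square, of det] by (auto simp: det_mul)

lemma lorentzian_invertible:
  fixes M P :: "real ^ 4 ^ 4"
  assumes "transpose P ** M ** P = minkowski"
  shows "invertible M"
proof -
  have "det (transpose P) * det M * det P = det minkowski" by (simp only: assms flip: det_mul)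
  then have "det M \<noteq> 0" using det_minkowski by auto
  then show ?thesis by (simp add: invertible_det_nz)
qed

section \<open>Riemann curvature of an affine connection, evaluated on constant vector
  fields\<close>

definition curvature :: "(real ^ 'n \<Rightarrow> real ^ 'n \<Rightarrow> real ^ 'n \<Rightarrow> real ^ 'n) \<Rightarrow> real ^ 'n \<Rightarrow> real ^ 'n \<Rightarrow> real ^ 'n \<Rightarrow> real ^ 'n \<Rightarrow> real ^ 'n" where
  "curvature G x u v w =
     fd (\<lambda>x. G x v w) x u - fd (\<lambda>x. G x u w) x v + G x u (G x v w) - G x v (G x u w)"

context
  fixes G :: "real ^ 'n \<Rightarrow> real ^ 'n \<Rightarrow> real ^ 'n \<Rightarrow> real ^ 'n" and x :: "real ^ 'n"
  assumes bilinear: "\<And>x. bilinear (G x)" and differentiable: "\<And>u v. (\<lambda>x. G x u v) differentiable at x"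
begin

lemma fd_bilinear_linear:
  shows "linear (\<lambda>w. fd (\<lambda>x. G x u w) x h)" "linear (\<lambda>u. fd (\<lambda>x. G x u w) x h)"
    "linear (fd (\<lambda>x. G x u w) x)"
proof -
  note d = fd_works[OF differentiable]
  have l: "linear (G x u)" "linear (\<lambda>u. G x u v)" for x u v using bilinear by (auto simp: bilinear_def)
  show "linear (\<lambda>w. fd (\<lambda>x. G x u w) x h)"
  proof (rule linearI)
    show "fd (\<lambda>x. G x u (v + w)) x h = fd (\<lambda>x. G x u v) x h + fd (\<lambda>x. G x u w) x h" for v w
      using fd_eq[OF has_derivative_add[OF d[of u v] d[of u w]]] by (simp add: linear_add[OF l(1)])
    show "fd (\<lambda>x. G x u (c *\<^sub>R w)) x h = c *\<^sub>R fd (\<lambda>x. G x u w) x h" for c w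
      using fd_eq[OF has_derivative_scaleR_right[OF d[of u w], of c]] by (simp add: linear_cmul[OF l(1)])
  qed
  show "linear (\<lambda>u. fd (\<lambda>x. G x u w) x h)"
  proof (rule linearI)
    show "fd (\<lambda>x. G x (u + v) w) x h = fd (\<lambda>x. G x u w) x h + fd (\<lambda>x. G x v w) x h" for u v
      using fd_eq[OF has_derivative_add[OF d[of u w] d[of v w]]] by (simp add: linear_add[OF l(2)])
    show "fd (\<lambda>x. G x (c *\<^sub>R u) w) x h = c *\<^sub>R fd (\<lambda>x. G x u w) x h" for c u
      using fd_eq[OF has_derivative_scaleR_right[OF d[of u w], of c]] by (simp add: linear_cmul[OF l(2)])
  qed
  show "linear (fd (\<lambda>x. G x u w) x)" using d by (rule has_derivative_linear)
qed

lemma curvature_linear: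
  shows "linear (\<lambda>u. curvature G x u v w)" "linear (\<lambda>v. curvature G x u v w)" "linear (\<lambda>w. curvature G x u v w)"
proof -
  have l: "linear (G x u)" "linear (\<lambda>u. G x u v)" for u v using bilinear by (auto simp: bilinear_def)
  show "linear (\<lambda>u. curvature G x u v w)" "linear (\<lambda>v. curvature G x u v w)" "linear (\<lambda>w. curvature G x u v w)"
    unfolding curvature_def
    by (intro linear_compose_sub linear_compose_add fd_bilinear_linear l
        linear_compose[OF l(2) l(1), unfolded o_def] linear_compose[OF l(1) l(2), unfolded o_def]
        linear_compose[OF l(1) l(1), unfolded o_def])+
qed

end

text \<open>G is the Levi-Civita connection of g, and b is parallel for it. The connection arrives
  as a bare family of bilinear maps; its smoothness in x is derived from that of g in
  \<open>smooth_G\<close>.\<close>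

locale parallel_structure =
  fixes U :: "(real ^ 4) set" and g :: "real ^ 4 \<Rightarrow> real ^ 4 ^ 4" and b :: "real ^ 4 \<Rightarrow> real ^ 4"
    and G :: "real ^ 4 \<Rightarrow> real ^ 4 \<Rightarrow> real ^ 4 \<Rightarrow> real ^ 4"
  assumes U: "open U" and smooth_g: "smooth_on U g" and smooth_b: "smooth_on U b"
    and g_sym: "\<And>x. x \<in> U \<Longrightarrow> transpose (g x) = g x"
    and G_bilinear: "\<And>x. bilinear (G x)" and G_sym: "\<And>x u v. x \<in> U \<Longrightarrow> G x u v = G x v u"
    and g_parallel: "\<And>x h v w. x \<in> U \<Longrightarrow>
      v \<bullet> (fd g x h *v w) = G x h v \<bullet> (g x *v w) + v \<bullet> (g x *v G x h w)"
    and b_parallel: "\<And>x h v. x \<in> U \<Longrightarrow> fd b x h \<bullet> v = b x \<bullet> G x h v"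
    and lorentz: "\<And>x. x \<in> U \<Longrightarrow> \<exists>P. invertible P \<and> transpose P ** g x ** P = minkowski"
    and nonnull: "\<And>x. x \<in> U \<Longrightarrow> b x \<bullet> (matrix_inv (g x) *v b x) \<noteq> 0"
begin

lemma g_invertible: "x \<in> U \<Longrightarrow> invertible (g x)"
  using lorentz lorentzian_invertible by blast

lemma G_linear2: "linear (G x u)" and G_linear1: "linear (\<lambda>u. G x u v)"
  using G_bilinear by (auto simp: bilinear_def)

text \<open>Koszul's formula: three instances of \<open>g_parallel\<close> with permuted arguments
  are combined, and symmetry of G leaves twice the lowered connection. The right-hand side contains
  only g and its derivative.\<close>

lemma christoffel:
  assumes x: "x \<in> U"
  shows "G x u v = matrix_inv (g x) *v (\<chi> k. (v \<bullet> (fd g x u *v axis k 1) + u \<bullet> (fd g x v *v axis k 1)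
    - u \<bullet> (fd g x (axis k 1) *v v)) / 2)" (is "_ = _ *v ?K")
proof -
  note sym = inner_matrix_symmetric[OF g_sym[OF x]]
  have "g x *v G x u v = ?K"
  proof -
    have "(g x *v G x u v) $ k = ?K $ k" for k
      using g_parallel[OF x, of v u "axis k 1"] g_parallel[OF x, of u v "axis k 1"]
        g_parallel[OF x, of u "axis k 1" v] sym[of "G x u v" "axis k 1"] sym[of v "G x u (axis k 1)"]
        sym[of "G x v u" "axis k 1"] sym[of u "G x v (axis k 1)"] sym[of "G x (axis k 1) u" v]
      by (simp add: G_sym[OF x, of _ "axis k 1"] G_sym[OF x, of v u] inner_axis')
    then show ?thesis by (simp add: vec_eq_iff)
  qed
  then have "matrix_inv (g x) *v (g x *v G x u v) = matrix_inv (g x) *v ?K" by simp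
  then show ?thesis by (simp add: matrix_vector_mul_assoc matrix_inv_left g_invertible[OF x])
qed

lemma smooth_G: "smooth_on U (\<lambda>x. G x u v)"
proof -
  have l: "linear (\<lambda>M :: real ^ 4 ^ 4. v \<bullet> (M *v w))" for v w
    by (rule linearI) (simp_all add: matrix_vector_mult_add_rdistrib inner_add_right flip: scaleR_matrix_vector_assoc)
  have c: "smooth_on U (\<lambda>x. v \<bullet> (fd g x h *v w))" for v w h
    by (rule smooth_on_linear_compose[OF l U smooth_on_fd[OF smooth_g]])
  have "smooth_on U (\<lambda>x. \<chi> k. (v \<bullet> (fd g x u *v axis k 1) + u \<bullet> (fd g x v *v axis k 1)
    - u \<bullet> (fd g x (axis k 1) *v v)) / 2)"
    by (subst smooth_on_vec_iff[OF U], simp)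
      (intro allI smooth_on_divide smooth_on_diff smooth_on_add c U smooth_on_const, simp)
  then have "smooth_on U (\<lambda>x. matrix_inv (g x) *v (\<chi> k. (v \<bullet> (fd g x u *v axis k 1) + u \<bullet> (fd g x v *v axis k 1)
    - u \<bullet> (fd g x (axis k 1) *v v)) / 2))"
    by (intro smooth_on_bilinear[OF bounded_bilinear_matrix_vector U] smooth_on_matrix_inv smooth_g U g_invertible)
  then show ?thesis by (subst smooth_on_cong[OF U christoffel])
qed

abbreviation curv :: "real ^ 4 \<Rightarrow> real ^ 4 \<Rightarrow> real ^ 4 \<Rightarrow> real ^ 4 \<Rightarrow> real ^ 4" where
  "curv \<equiv> curvature G"

lemma G_derivative: "x \<in> U \<Longrightarrow> ((\<lambda>x. G x u v) has_derivative fd (\<lambda>x. G x u v) x) (at x)"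
  by (rule smooth_on_has_derivative[OF smooth_G])

lemma curv_linear:
  assumes x: "x \<in> U"
  shows "linear (\<lambda>u. curv x u v w)" "linear (\<lambda>v. curv x u v w)" "linear (\<lambda>w. curv x u v w)"
  by (rule curvature_linear[OF G_bilinear smooth_on_differentiable[OF smooth_G x]])+

lemma curv_antisym: "curv x u v w = - curv x v u w"
  by (simp add: curvature_def)

lemma curv_bianchi:
  assumes x: "x \<in> U"
  shows "curv x u v w + curv x v w u + curv x w u v = 0"
proof -
  have s: "fd (\<lambda>x. G x u v) x = fd (\<lambda>x. G x v u) x" for u v
    by (rule fd_cong_open[OF U x]) (rule G_sym)
  show ?thesis
    unfolding curvature_def using s[of u v] s[of v w] s[of w u] G_sym[OF x, of u v] G_sym[OF x, of v w] G_sym[OF x, of w u]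
    by simp
qed

text \<open>The second derivatives of the function g(w, z), for constant w and z, commute. After two
  uses of \<open>g_parallel\<close> the mixed products of first-order terms cancel by symmetry, and
  what remains is the curvature acting on either argument.\<close>

lemma curv_metric:
  assumes x: "x \<in> U"
  shows "curv x u v w \<bullet> (g x *v z) = - (curv x u v z \<bullet> (g x *v w))"
proof -
  define \<phi> where "\<phi> x = w \<bullet> (g x *v z)" for x
  have l: "linear (\<lambda>M :: real ^ 4 ^ 4. w \<bullet> (M *v z))"
    by (rule linearI) (simp_all add: matrix_vector_mult_add_rdistrib inner_add_right flip: scaleR_matrix_vector_assoc)
  have \<phi>: "smooth_on U \<phi>" unfolding \<phi>_def by (rule smooth_on_linear_compose[OF l U smooth_g])
  have 1: "fd \<phi> y h = G y h w \<bullet> (g y *v z) + w \<bullet> (g y *v G y h z)" if y: "y \<in> U" for y h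
  proof -
    have "(\<phi> has_derivative (\<lambda>h. w \<bullet> (fd g y h *v z))) (at y)"
      unfolding \<phi>_def using linear_linear l
      by (intro bounded_linear.has_derivative[OF _ smooth_on_has_derivative[OF smooth_g y]])
        (simp add: linear_conv_bounded_linear)
    then show ?thesis by (simp add: fd_eq g_parallel[OF y])
  qed
  have 2: "fd (\<lambda>y. fd \<phi> y h) x k = fd (\<lambda>x. G x h w) x k \<bullet> (g x *v z) + w \<bullet> (g x *v fd (\<lambda>x. G x h z) x k)
      + (G x k (G x h w) \<bullet> (g x *v z) + G x h w \<bullet> (g x *v G x k z))
      + (G x k w \<bullet> (g x *v G x h z) + w \<bullet> (g x *v G x k (G x h z)))" for h k
  proof -
    have "fd (\<lambda>y. fd \<phi> y h) x = fd (\<lambda>y. G y h w \<bullet> (g y *v z) + w \<bullet> (g y *v G y h z)) x"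
      by (rule fd_cong_open[OF U x]) (rule 1)
    moreover have "((\<lambda>y. G y h w \<bullet> (g y *v z) + w \<bullet> (g y *v G y h z)) has_derivative
      (\<lambda>k. (G x h w \<bullet> (g x *v 0 + fd g x k *v z) + fd (\<lambda>x. G x h w) x k \<bullet> (g x *v z))
        + (w \<bullet> (g x *v fd (\<lambda>x. G x h z) x k + fd g x k *v G x h z) + 0 \<bullet> (g x *v G x h z)))) (at x)"
      by (intro has_derivative_add has_derivative_inner has_derivative_const
          bounded_bilinear.FDERIV[OF bounded_bilinear_matrix_vector] G_derivative x
          smooth_on_has_derivative[OF smooth_g])
    ultimately show ?thesis
      by (simp add: fd_eq g_parallel[OF x] inner_add_right)
  qed
  have "fd (\<lambda>y. fd \<phi> y v) x u = fd (\<lambda>y. fd \<phi> y u) x v" by (rule fd_commute[OF U x \<phi>])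
  then have "curv x u v w \<bullet> (g x *v z) + w \<bullet> (g x *v curv x u v z) = 0"
    by (simp add: 2 curvature_def inner_diff_left inner_add_left matrix_vector_mult_diff_distrib
        matrix_vector_right_distrib inner_diff_right inner_add_right)
  then show ?thesis using inner_matrix_symmetric[OF g_sym[OF x], of w "curv x u v z"] by simp
qed

text \<open>The argument of \<open>curv_metric\<close>, applied to the function b(w): a parallel
  covector is annihilated by curvature.\<close>

lemma curv_covector:
  assumes x: "x \<in> U"
  shows "b x \<bullet> curv x u v w = 0"
proof -
  define \<phi> where "\<phi> x = b x \<bullet> w" for x
  have \<phi>: "smooth_on U \<phi>" unfolding \<phi>_def by (intro smooth_on_inner U smooth_b smooth_on_const)
  have 1: "fd \<phi> y h = b y \<bullet> G y h w" if y: "y \<in> U" for y h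
  proof -
    have "(\<phi> has_derivative (\<lambda>h. b y \<bullet> 0 + fd b y h \<bullet> w)) (at y)"
      unfolding \<phi>_def by (intro has_derivative_inner has_derivative_const smooth_on_has_derivative[OF smooth_b y])
    then show ?thesis by (simp add: fd_eq b_parallel[OF y])
  qed
  have 2: "fd (\<lambda>y. fd \<phi> y h) x k = b x \<bullet> fd (\<lambda>x. G x h w) x k + b x \<bullet> G x k (G x h w)" for h k
  proof -
    have "fd (\<lambda>y. fd \<phi> y h) x = fd (\<lambda>y. b y \<bullet> G y h w) x"
      by (rule fd_cong_open[OF U x]) (rule 1)
    moreover have "((\<lambda>y. b y \<bullet> G y h w) has_derivative
      (\<lambda>k. b x \<bullet> fd (\<lambda>x. G x h w) x k + fd b x k \<bullet> G x h w)) (at x)"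
      by (intro has_derivative_inner G_derivative x smooth_on_has_derivative[OF smooth_b])
    ultimately show ?thesis by (simp add: fd_eq b_parallel[OF x])
  qed
  have "fd (\<lambda>y. fd \<phi> y v) x u = fd (\<lambda>y. fd \<phi> y u) x v" by (rule fd_commute[OF U x \<phi>])
  then show ?thesis by (simp add: 2 curvature_def inner_diff_right inner_add_right)
qed

lemma curv_zero:
  assumes x: "x \<in> U" and ricci: "\<And>v. (\<Sum>i\<in>UNIV. curv x (axis i 1) v v $ i) = 0"
  shows "curv x u v w = 0"
proof -
  obtain P where P: "transpose P ** g x ** P = minkowski" using lorentz[OF x] by blast
  \<comment> \<open>The vector obtained by raising the index of b; the curvature has no component
    along it, which is the hypothesis of the algebraic lemma.\<close>
  define B where "B = matrix_inv (g x) *v b x"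
  have gB: "g x *v B = b x"
    by (simp add: B_def matrix_vector_mul_assoc matrix_inv_right g_invertible[OF x])
  have "B \<bullet> (g x *v B) \<noteq> 0" using nonnull[OF x] unfolding gB by (simp add: B_def inner_commute)
  then show ?thesis
  proof (rule algebraic_curvature_zero[where R = "curv x", OF g_sym[OF x] P])
    show "curv x u v w \<bullet> (g x *v B) = 0" for u v w
      unfolding gB using curv_covector[OF x] by (simp add: inner_commute)
  qed (rule curv_linear[OF x] curv_antisym curv_metric[OF x] curv_bianchi[OF x] ricci)+
qed

end

section \<open>Local flat coordinates\<close>

lemma matrix_eq_bilinear:
  fixes A B :: "real ^ 'n ^ 'm"
  assumes "\<And>v w. v \<bullet> (A *v w) = v \<bullet> (B *v w)"
  shows "A = B"
  by (rule iffD2[OF matrix_eq], rule allI, rule iffD1[OF vector_eq_ldot]) (simp add: assms)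

lemma inner_transpose: "v \<bullet> (w v* A) = (A *v v) \<bullet> w" for A :: "real ^ 'n ^ 'm"
  by (metis dot_lmul_matrix inner_commute)

text \<open>The inverse function theorem gives a differentiable inverse whose derivative is the
  inverse of E at \<psi>(y). This expresses the derivative of \<psi> through \<psi> itself and a
  smooth map, so its order of differentiability rises by induction.\<close>

lemma local_smooth_inverse:
  fixes \<phi> :: "real ^ 'n \<Rightarrow> real ^ 'n" and E :: "real ^ 'n \<Rightarrow> real ^ 'n ^ 'n"
  assumes S: "open S" "x0 \<in> S" and E: "smooth_on S E"
    and \<phi>: "\<And>x. x \<in> S \<Longrightarrow> (\<phi> has_derivative (\<lambda>h. E x *v h)) (at x)"
    and inv: "\<And>x. x \<in> S \<Longrightarrow> invertible (E x)"
  obtains V X \<psi> where "open V" "x0 \<in> V" "V \<subseteq> S" "open X" "homeomorphism V X \<phi> \<psi>" "smooth_on X \<psi>"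
proof -
  define f' where "f' x = lift_linear (\<lambda>h. E x *v h)" for x
  have f': "blinfun_apply (f' x) = (\<lambda>h. E x *v h)" for x
    by (rule ext) (simp add: f'_def lift_linear_apply)
  define i0 where "i0 = lift_linear (\<lambda>h. matrix_inv (E x0) *v h)"
  have i0: "blinfun_apply i0 = (\<lambda>h. matrix_inv (E x0) *v h)"
    by (rule ext) (simp add: i0_def lift_linear_apply)
  have cE: "continuous_on S (\<lambda>x. E x *v h)" for h
    by (rule smooth_on_continuous[OF smooth_on_bilinear[OF bounded_bilinear_matrix_vector S(1) E smooth_on_const]])
  obtain V X \<psi> \<psi>' where V: "open V" "V \<subseteq> S" "x0 \<in> V" and X: "open X" "\<phi> x0 \<in> X"
    and hom: "homeomorphism V X \<phi> \<psi>" and d\<psi>: "\<And>y. y \<in> X \<Longrightarrow> (\<psi> has_derivative (\<psi>' y)) (at y)"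
    and \<psi>': "\<And>y. y \<in> X \<Longrightarrow> \<psi>' y = Hilbert_Choice.inv (blinfun_apply (f' (\<psi> y)))"
  proof (rule inverse_function_theorem[of S \<phi> f' x0 i0])
    show "(\<phi> has_derivative blinfun_apply (f' x)) (at x)" if "x \<in> S" for x using \<phi>[OF that] by (simp add: f')
    show "continuous_on S f'" unfolding f'_def by (intro lift_linear_continuous cE)
    show "i0 o\<^sub>L f' x0 = id_blinfun"
      by (rule blinfun_eqI) (simp add: i0 f' matrix_vector_mul_assoc matrix_inv_left inv[OF S(2)])
  qed (use S in auto)
  have \<psi>S: "\<psi> y \<in> V" if "y \<in> X" for y using hom that by (auto simp: homeomorphism_def)
  have \<psi>'_eq: "\<psi>' y = (\<lambda>h. matrix_inv (E (\<psi> y)) *v h)" if y: "y \<in> X" for y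
  proof -
    have i: "invertible (E (\<psi> y))" using inv \<psi>S[OF y] V(2) by blast
    show ?thesis
      unfolding \<psi>'[OF y] f'
      by (rule inv_unique_comp) (simp_all add: fun_eq_iff matrix_vector_mul_assoc matrix_inv_left matrix_inv_right i)
  qed
  have "higher_differentiable_on n X \<psi>" for n
  proof (induction n)
    case 0
    show ?case using hom by (simp add: homeomorphism_def)
  next
    case (Suc n)
    have s: "smooth_on V (\<lambda>x. matrix_inv (E x) *v v)" for v
      by (intro smooth_on_bilinear[OF bounded_bilinear_matrix_vector] smooth_on_matrix_inv smooth_on_const
          V smooth_on_subset[OF E V(2)]) (use inv V(2) in auto)
    show ?case
    proof (rule higher_differentiable_on_SucI[OF X(1)])
      show "(\<psi> has_derivative (\<lambda>h. matrix_inv (E (\<psi> y)) *v h)) (at y)" if "y \<in> X" for y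
        using d\<psi>[OF that] by (simp add: \<psi>'_eq[OF that])
      show "higher_differentiable_on n X (\<lambda>y. matrix_inv (E (\<psi> y)) *v v)" for v
        by (rule higher_differentiable_on_compose[OF X(1) V(1) _ _ Suc])
          (use \<psi>S s[of v] in \<open>auto simp: smooth_on_def\<close>)
    qed
  qed
  then have "smooth_on X \<psi>" by (simp add: smooth_on_def)
  then show thesis by (rule that[OF V(1) V(3) V(2) X(1) hom])
qed

context parallel_structure
begin

lemma matrix_G: "matrix (G x h) *v w = G x h w"
  by (rule matrix_works_linear[OF G_linear2])

lemma linear_matrix_G: "linear (\<lambda>h. matrix (G x h))"
  by (rule linearI) (simp_all add: matrix_def vec_eq_iff linear_add[OF G_linear1] linear_cmul[OF G_linear1])

lemma smooth_matrix_G: "smooth_on U (\<lambda>x. matrix (G x h))"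
proof -
  have "smooth_on U (\<lambda>x. G x h (axis j 1) $ i)" for i j
    using iffD1[OF smooth_on_vec_iff[OF U] smooth_G] ..
  then show ?thesis by (simp add: smooth_on_mat_iff[OF U] matrix_def)
qed

text \<open>Coordinates and parallel coframe form one unknown: d\<phi> = E and dE = E G.
  Integrability of the first equation is the symmetry of G, that of the second is the vanishing of
  the curvature.\<close>

lemma flat_frame:
  assumes x0: "x0 \<in> U" and flat: "\<And>x u v w. x \<in> U \<Longrightarrow> curv x u v w = 0"
  obtains r \<phi> and E :: "real ^ 4 \<Rightarrow> real ^ 4 ^ 4" and \<kappa> where "r > 0" "ball x0 r \<subseteq> U" "smooth_on (ball x0 r) \<phi>"
    "smooth_on (ball x0 r) E" "\<And>x. x \<in> ball x0 r \<Longrightarrow> (\<phi> has_derivative (\<lambda>h. E x *v h)) (at x)"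
    "\<And>x. x \<in> ball x0 r \<Longrightarrow> transpose (E x) ** minkowski ** E x = g x"
    "\<And>x. x \<in> ball x0 r \<Longrightarrow> b x = transpose (E x) *v \<kappa>"
proof -
  let ?M = "\<lambda>x h. matrix (G x h)"
  from lorentz[OF x0] obtain P where P: "invertible P" "transpose P ** g x0 ** P = minkowski" by blast
  \<comment> \<open>The columns of \<open>P\<close> are an orthonormal basis at \<open>x0\<close>,
    so its inverse is the initial coframe, and \<open>\<kappa>\<close> lists the components of b in
    that basis.\<close>
  define E0 where "E0 = matrix_inv P"
  define \<kappa> where "\<kappa> = transpose P *v b x0"
  define W :: "real ^ 4 \<Rightarrow> real ^ 4 \<Rightarrow> (real ^ 4) \<times> (real ^ 4 ^ 4) \<Rightarrow> (real ^ 4) \<times> (real ^ 4 ^ 4)"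
    where "W x h z = (snd z *v h, snd z ** ?M x h)" for x h z
  note bb1 = bounded_bilinear_matrix_vector and bb2 = bounded_bilinear_matrix_matrix
  have W_bil: "bilinear (W x)" for x
    unfolding bilinear_def W_def
    by (auto intro!: linearI simp: linear_add[OF linear_matrix_G] linear_cmul[OF linear_matrix_G]
        bounded_bilinear.add_left[OF bb1] bounded_bilinear.add_right[OF bb1] bounded_bilinear.scaleR_left[OF bb1]
        bounded_bilinear.scaleR_right[OF bb1] bounded_bilinear.add_left[OF bb2] bounded_bilinear.add_right[OF bb2]
        bounded_bilinear.scaleR_left[OF bb2] bounded_bilinear.scaleR_right[OF bb2])
  have W_smooth: "smooth_on U (\<lambda>x. W x h z)" for h z
    unfolding W_def by (intro smooth_on_Pair smooth_on_const smooth_on_bilinear[OF bb2] U smooth_matrix_G)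
  have dM: "((\<lambda>x. ?M x k) has_derivative fd (\<lambda>x. ?M x k) x) (at x)" if "x \<in> U" for x k
    by (rule smooth_on_has_derivative[OF smooth_matrix_G that])
  have dMw: "fd (\<lambda>x. ?M x k) x h *v w = fd (\<lambda>x. G x k w) x h" if x: "x \<in> U" for x h k w
  proof -
    have "((\<lambda>x. ?M x k *v w) has_derivative (\<lambda>h. ?M x k *v 0 + fd (\<lambda>x. ?M x k) x h *v w)) (at x)"
      by (intro bounded_bilinear.FDERIV[OF bb1] dM x has_derivative_const)
    then show ?thesis by (simp add: fd_eq matrix_G)
  qed
  have A_sym: "fd (\<lambda>x. ?M x k) x h + ?M x h ** ?M x k = fd (\<lambda>x. ?M x h) x k + ?M x k ** ?M x h"
    if x: "x \<in> U" for x h k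
  proof (subst matrix_eq, rule allI)
    fix w
    have "curv x h k w = 0" by (rule flat[OF x])
    then show "(fd (\<lambda>x. ?M x k) x h + ?M x h ** ?M x k) *v w = (fd (\<lambda>x. ?M x h) x k + ?M x k ** ?M x h) *v w"
      by (simp add: matrix_vector_mult_add_rdistrib dMw[OF x] matrix_G curvature_def flip: matrix_vector_mul_assoc)
        (simp add: algebra_simps)
  qed
  have W_flat: "fd (\<lambda>x. W x k z) x h + W x k (W x h z) = fd (\<lambda>x. W x h z) x k + W x h (W x k z)"
    if x: "x \<in> U" for x h k z
  proof -
    have dW: "fd (\<lambda>x. W x k z) x h = (0, snd z ** fd (\<lambda>x. ?M x k) x h)" for h k
    proof -
      have "((\<lambda>x. W x k z) has_derivative (\<lambda>h. (0, snd z ** fd (\<lambda>x. ?M x k) x h + 0 ** ?M x k))) (at x)"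
        unfolding W_def by (intro has_derivative_Pair has_derivative_const bounded_bilinear.FDERIV[OF bb2] dM x)
      then show ?thesis by (simp add: fd_eq bounded_bilinear.zero_left[OF bb2])
    qed
    have "W x k (W x h z) = (snd z *v G x h k, snd z ** (?M x h ** ?M x k))" for h k
      by (simp add: W_def matrix_mul_assoc matrix_G flip: matrix_vector_mul_assoc)
    then have "fd (\<lambda>x. W x k z) x h + W x k (W x h z)
        = (snd z *v G x h k, snd z ** (fd (\<lambda>x. ?M x k) x h + ?M x h ** ?M x k))" for h k
      by (simp add: dW matrix_add_ldistrib)
    then show ?thesis by (simp add: A_sym[OF x, of k h] G_sym[OF x, of h k])
  qed
  obtain r z where r: "r > 0" "ball x0 r \<subseteq> U" and z0: "z x0 = (0, E0)"
    and z: "\<And>x. x \<in> ball x0 r \<Longrightarrow> (z has_derivative (\<lambda>h. W x h (z x))) (at x)"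
    using frobenius_linear[of U x0 W "(0, E0)"] U x0 W_bil W_smooth W_flat by metis
  define \<phi> where "\<phi> x = fst (z x)" for x
  define E where "E x = snd (z x)" for x
  have sm: "smooth_on (ball x0 r) z"
    by (rule parallel_smooth[OF open_ball W_bil smooth_on_subset[OF W_smooth r(2)] z])
  have s\<phi>: "smooth_on (ball x0 r) \<phi>" and sE: "smooth_on (ball x0 r) E"
    unfolding \<phi>_def E_def by (intro smooth_on_linear_compose[OF _ open_ball sm] linear_fst linear_snd)+
  have d\<phi>: "(\<phi> has_derivative (\<lambda>h. E x *v h)) (at x)" if "x \<in> ball x0 r" for x
    unfolding \<phi>_def using has_derivative_fst[OF z[OF that]] by (simp add: W_def E_def)
  have dE: "(E has_derivative (\<lambda>h. E x ** ?M x h)) (at x)" if "x \<in> ball x0 r" for x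
    unfolding E_def using has_derivative_snd[OF z[OF that]] by (simp add: W_def)
  have dET: "((\<lambda>x. transpose (E x)) has_derivative (\<lambda>h. transpose (E x ** ?M x h))) (at x)" if "x \<in> ball x0 r" for x
    using linear_transpose by (intro bounded_linear.has_derivative[OF _ dE[OF that]]) (simp add: linear_conv_bounded_linear)
  \<comment> \<open>Both terms are parallel, so their difference solves a homogeneous linear
    equation with initial value 0; the covector below is treated alike.\<close>
  have metric: "g x - transpose (E x) ** minkowski ** E x = 0" if "x \<in> ball x0 r" for x
  proof (rule parallel_zero[where W = "\<lambda>x h A. transpose (?M x h) ** A + A ** ?M x h", OF _ _ _ _ that])
    fix x assume xb: "x \<in> ball x0 r"
    then have x: "x \<in> U" using r(2) by blast
    show "bilinear (\<lambda>h A. transpose (?M x h) ** A + A ** ?M x h)"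
      unfolding bilinear_def
      by (auto intro!: linearI simp: linear_add[OF linear_matrix_G] linear_cmul[OF linear_matrix_G]
        linear_add[OF linear_transpose] linear_cmul[OF linear_transpose] bounded_bilinear.add_left[OF bb2]
        bounded_bilinear.add_right[OF bb2] bounded_bilinear.scaleR_left[OF bb2] bounded_bilinear.scaleR_right[OF bb2] algebra_simps)
    have dg: "fd g x h = transpose (?M x h) ** g x + g x ** ?M x h" for h
      by (rule matrix_eq_bilinear)
        (simp add: g_parallel[OF x] matrix_vector_mult_add_rdistrib inner_add_right inner_transpose matrix_G
          flip: matrix_vector_mul_assoc)
    have "((\<lambda>x. g x - transpose (E x) ** minkowski ** E x) has_derivative
      (\<lambda>h. fd g x h - ((transpose (E x) ** minkowski) ** (E x ** ?M x h)
         + (transpose (E x) ** 0 + transpose (E x ** ?M x h) ** minkowski) ** E x))) (at x)"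
      by (intro has_derivative_diff smooth_on_has_derivative[OF smooth_g x] bounded_bilinear.FDERIV[OF bb2]
          dE dET xb has_derivative_const)
    then show "((\<lambda>x. g x - transpose (E x) ** minkowski ** E x) has_derivative
      (\<lambda>h. transpose (?M x h) ** (g x - transpose (E x) ** minkowski ** E x)
         + (g x - transpose (E x) ** minkowski ** E x) ** ?M x h)) (at x)"
      by (rule has_derivative_eq_rhs)
        (simp add: fun_eq_iff dg bounded_bilinear.zero_right[OF bb2] bounded_bilinear.diff_left[OF bb2]
          bounded_bilinear.diff_right[OF bb2] matrix_transpose_mul matrix_mul_assoc)
  next
    fix h A
    show "smooth_on (ball x0 r) (\<lambda>x. transpose (?M x h) ** A + A ** ?M x h)"
      by (intro smooth_on_add smooth_on_bilinear[OF bb2] open_ball smooth_on_const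
          smooth_on_linear_compose[OF linear_transpose] smooth_on_subset[OF smooth_matrix_G r(2)])
  next
    have "transpose E0 ** minkowski ** E0 = g x0"
    proof -
      have "transpose E0 ** minkowski ** E0 = (transpose E0 ** transpose P) ** g x0 ** (P ** E0)"
        by (simp add: P(2)[symmetric] matrix_mul_assoc)
      also have "\<dots> = g x0"
        by (simp add: E0_def matrix_inv_right[OF P(1)] flip: matrix_transpose_mul)
      finally show ?thesis .
    qed
    then show "g x0 - transpose (E x0) ** minkowski ** E x0 = 0" by (simp add: E_def z0)
  qed
  have covector: "b x - transpose (E x) *v \<kappa> = 0" if "x \<in> ball x0 r" for x
  proof (rule parallel_zero[where W = "\<lambda>x h c. transpose (?M x h) *v c", OF _ _ _ _ that])
    fix x assume xb: "x \<in> ball x0 r"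
    then have x: "x \<in> U" using r(2) by blast
    show "bilinear (\<lambda>h c. transpose (?M x h) *v c)"
      unfolding bilinear_def
      by (auto intro!: linearI simp: linear_add[OF linear_matrix_G] linear_cmul[OF linear_matrix_G]
        linear_add[OF linear_transpose] linear_cmul[OF linear_transpose] bounded_bilinear.add_left[OF bb1]
        bounded_bilinear.add_right[OF bb1] bounded_bilinear.scaleR_left[OF bb1] bounded_bilinear.scaleR_right[OF bb1]
        simp del: transpose_matrix_vector)
    have "v \<bullet> fd b x h = v \<bullet> (transpose (?M x h) *v b x)" for h v
      using b_parallel[OF x, of h v] by (simp add: inner_transpose matrix_G inner_commute)
    then have db: "fd b x h = transpose (?M x h) *v b x" for h using vector_eq_ldot by blast
    have "((\<lambda>x. b x - transpose (E x) *v \<kappa>) has_derivative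
      (\<lambda>h. fd b x h - (transpose (E x) *v 0 + transpose (E x ** ?M x h) *v \<kappa>))) (at x)"
      by (intro has_derivative_diff smooth_on_has_derivative[OF smooth_b x] bounded_bilinear.FDERIV[OF bb1]
          dET xb has_derivative_const)
    then show "((\<lambda>x. b x - transpose (E x) *v \<kappa>) has_derivative
      (\<lambda>h. transpose (?M x h) *v (b x - transpose (E x) *v \<kappa>))) (at x)"
      by (rule has_derivative_eq_rhs)
        (simp add: fun_eq_iff db matrix_vector_mult_diff_distrib matrix_transpose_mul matrix_vector_mul_assoc
          del: transpose_matrix_vector)
  next
    fix h c
    show "smooth_on (ball x0 r) (\<lambda>x. transpose (?M x h) *v c)"
      by (intro smooth_on_bilinear[OF bb1] open_ball smooth_on_const
          smooth_on_linear_compose[OF linear_transpose] smooth_on_subset[OF smooth_matrix_G r(2)])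
  next
    have "transpose E0 *v \<kappa> = (transpose E0 ** transpose P) *v b x0"
      by (simp add: \<kappa>_def matrix_vector_mul_assoc del: transpose_matrix_vector)
    also have "\<dots> = b x0" by (simp add: E0_def matrix_inv_right[OF P(1)] flip: matrix_transpose_mul)
    finally show "b x0 - transpose (E x0) *v \<kappa> = 0" by (simp add: E_def z0)
  qed
  show thesis
    by (rule that[of r \<phi> E \<kappa>, OF r s\<phi> sE d\<phi>]) (use metric covector in simp_all)
qed

text \<open>E is invertible because it pulls the Minkowski metric back to the nondegenerate g. Being
  the Jacobian of \<phi>, it makes \<phi> a local isometry onto an open part of Minkowski space that
  carries b to a constant covector.\<close>

lemma flat_chart:
  assumes x0: "x0 \<in> U" and ricci: "\<And>x v. x \<in> U \<Longrightarrow> (\<Sum>i\<in>UNIV. curv x (axis i 1) v v $ i) = 0"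
  obtains V X \<phi> \<psi> \<kappa> where "open V" "x0 \<in> V" "V \<subseteq> U" "open X" "homeomorphism V X \<phi> \<psi>"
    "smooth_on V \<phi>" "smooth_on X \<psi>"
    "\<And>x h k. x \<in> V \<Longrightarrow> fd \<phi> x h \<bullet> (minkowski *v fd \<phi> x k) = h \<bullet> (g x *v k)"
    "\<And>x h. x \<in> V \<Longrightarrow> b x \<bullet> h = \<kappa> \<bullet> fd \<phi> x h"
proof -
  obtain r \<phi> and E :: "real ^ 4 \<Rightarrow> real ^ 4 ^ 4" and \<kappa> where r: "r > 0" "ball x0 r \<subseteq> U" and s\<phi>: "smooth_on (ball x0 r) \<phi>"
    and sE: "smooth_on (ball x0 r) E" and d\<phi>: "\<And>x. x \<in> ball x0 r \<Longrightarrow> (\<phi> has_derivative (\<lambda>h. E x *v h)) (at x)"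
    and gE: "\<And>x. x \<in> ball x0 r \<Longrightarrow> transpose (E x) ** minkowski ** E x = g x"
    and bE: "\<And>x. x \<in> ball x0 r \<Longrightarrow> b x = transpose (E x) *v \<kappa>"
    using flat_frame[OF x0 curv_zero[OF _ ricci]] by metis
  have E_inv: "invertible (E x)" if "x \<in> ball x0 r" for x
  proof -
    have "det (transpose (E x) ** minkowski ** E x) \<noteq> 0"
      using gE[OF that] g_invertible[of x] that r(2) by (auto simp: invertible_det_nz)
    then show ?thesis by (auto simp: invertible_det_nz det_mul)
  qed
  obtain V X \<psi> where V: "open V" "x0 \<in> V" "V \<subseteq> ball x0 r" and X: "open X" "homeomorphism V X \<phi> \<psi>" "smooth_on X \<psi>"
    by (rule local_smooth_inverse[OF open_ball centre_in_ball[THEN iffD2, OF r(1)] sE d\<phi> E_inv])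
  have fd\<phi>: "fd \<phi> x = (\<lambda>h. E x *v h)" if "x \<in> V" for x using fd_eq[OF d\<phi>] V(3) that by blast
  show thesis
  proof (rule that[OF V(1,2) _ X(1,2) smooth_on_subset[OF s\<phi> V(3)] X(3)])
    show "V \<subseteq> U" using V(3) r(2) by blast
    fix x h assume x: "x \<in> V"
    then have xb: "x \<in> ball x0 r" using V(3) by blast
    show "b x \<bullet> h = \<kappa> \<bullet> fd \<phi> x h"
      by (simp add: fd\<phi>[OF x] bE[OF xb] inner_commute[of _ h] inner_transpose) (simp add: inner_commute)
    show "fd \<phi> x h \<bullet> (minkowski *v fd \<phi> x k) = h \<bullet> (g x *v k)" for k
      unfolding fd\<phi>[OF x] gE[OF xb, symmetric]
      by (simp add: inner_transpose flip: matrix_vector_mul_assoc)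
  qed
qed

end

section \<open>Finsler functions in a chart\<close>

lemma fd_linear: "f differentiable at x \<Longrightarrow> linear (fd f x)"
  using fd_works has_derivative_linear by blast

lemma linear_axis_sum:
  fixes v :: "real ^ 'n"
  assumes "linear f"
  shows "f v = (\<Sum>i\<in>UNIV. v $ i *\<^sub>R f (axis i 1))"
proof -
  have "f v = f (\<Sum>i\<in>UNIV. v $ i *\<^sub>R axis i 1)" by (simp add: basis_expansion scalar_mult_eq_scaleR[symmetric])
  then show ?thesis by (simp add: linear_sum[OF assms] linear_cmul[OF assms])
qed

lemma linear_fd_fst: "h differentiable at z \<Longrightarrow> linear (\<lambda>u. fd h z (u, 0))"
  and linear_fd_snd: "h differentiable at z \<Longrightarrow> linear (\<lambda>v. fd h z (0, v))"
  for h :: "'a::real_normed_vector \<times> 'b::real_normed_vector \<Rightarrow> 'c::real_normed_vector"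
proof -
  assume "h differentiable at z"
  then have l: "linear (fd h z)" by (rule fd_linear)
  show "linear (\<lambda>u. fd h z (u, 0))"
    by (rule linearI) (simp_all flip: linear_add[OF l] linear_cmul[OF l])
  show "linear (\<lambda>v. fd h z (0, v))"
    by (rule linearI) (simp_all flip: linear_add[OF l] linear_cmul[OF l])
qed

lemma sum_dx:
  assumes "h differentiable at z"
  shows "(\<Sum>i\<in>UNIV. v $ i * dx i h z) = fd h z (v, 0)"
  using linear_axis_sum[OF linear_fd_fst[OF assms], of v] by (simp add: dx_def)

lemma sum_dy:
  assumes "h differentiable at z"
  shows "(\<Sum>i\<in>UNIV. v $ i * dy i h z) = fd h z (0, v)"
  using linear_axis_sum[OF linear_fd_snd[OF assms], of v] by (simp add: dy_def)

lemma line_in_open: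
  fixes x :: "'a::real_normed_vector"
  assumes "open S" "x \<in> S"
  obtains e where "e > 0" "\<And>t. \<bar>t\<bar> < e \<Longrightarrow> x + t *\<^sub>R v \<in> S"
proof -
  have "open ((\<lambda>t. x + t *\<^sub>R v) -` S)"
    by (intro open_vimage assms continuous_intros)
  moreover have "0 \<in> (\<lambda>t. x + t *\<^sub>R v) -` S" using assms by simp
  ultimately obtain e where "e > 0" "ball 0 e \<subseteq> (\<lambda>t. x + t *\<^sub>R v) -` S" using open_contains_ball by blast
  then show thesis using that[of e] by (auto simp: dist_norm subset_iff)
qed

text \<open>Serves where \<open>h\<close> is known explicitly along a single line, typically as a
  polynomial in the fibre variable; differentiability at z then fixes the derivative in that
  direction.\<close>

lemma fd_eq_line_derivative:
  fixes h :: "'a::real_normed_vector \<Rightarrow> real"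
  assumes S: "open S" "z \<in> S" and d: "h differentiable at z"
    and eq: "\<And>t. z + t *\<^sub>R w \<in> S \<Longrightarrow> h (z + t *\<^sub>R w) = \<phi> t" and \<phi>: "(\<phi> has_real_derivative c) (at 0)"
  shows "fd h z w = c"
proof -
  obtain e where e: "e > 0" "\<And>t. \<bar>t\<bar> < e \<Longrightarrow> z + t *\<^sub>R w \<in> S" using line_in_open[OF S, of w] by blast
  have "((\<lambda>t. h (z + t *\<^sub>R w)) has_real_derivative fd h z w) (at 0)"
    using has_real_derivative_line[of h z 0 w] d by simp
  moreover have "((\<lambda>t. h (z + t *\<^sub>R w)) has_real_derivative c) (at 0)"
    by (rule has_field_derivative_transform_within_open[OF \<phi>, of "ball 0 e"])
      (use e eq in \<open>auto simp: dist_real_def\<close>)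
  ultimately show ?thesis by (rule DERIV_unique)
qed

lemma linear_zero_on_open:
  fixes L :: "'a::real_normed_vector \<Rightarrow> 'b::real_vector"
  assumes "linear L" "open S" "x \<in> S" "\<And>y. y \<in> S \<Longrightarrow> L y = 0"
  shows "L v = 0"
proof -
  obtain e where e: "e > 0" "\<And>t. \<bar>t\<bar> < e \<Longrightarrow> x + t *\<^sub>R v \<in> S" using line_in_open[OF assms(2,3), of v] by blast
  have "L (x + (e / 2) *\<^sub>R v) = 0" using e by (intro assms(4)) auto
  then show ?thesis using assms(4)[OF assms(3)] e(1) by (simp add: linear_add[OF assms(1)] linear_cmul[OF assms(1)])
qed

section \<open>Positively homogeneous functions on conic sets\<close>

definition cone :: "('a \<times> 'b::real_vector) set \<Rightarrow> bool" where
  "cone \<Omega> \<longleftrightarrow> (\<forall>x y r. (x, y) \<in> \<Omega> \<and> r > 0 \<longrightarrow> (x, r *\<^sub>R y) \<in> \<Omega>)"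

definition homog :: "('a \<times> 'b::real_vector) set \<Rightarrow> nat \<Rightarrow> ('a \<times> 'b \<Rightarrow> real) \<Rightarrow> bool" where
  "homog \<Omega> p h \<longleftrightarrow> (\<forall>x y r. (x, y) \<in> \<Omega> \<and> r > 0 \<longrightarrow> h (x, r *\<^sub>R y) = r ^ p * h (x, y))"

context
  fixes \<Omega> :: "('a::real_normed_vector \<times> 'b::real_normed_vector) set"
  assumes \<Omega>: "open \<Omega>" "cone \<Omega>"
begin

lemma homog_fd:
  assumes h: "homog \<Omega> p h" "\<And>z. z \<in> \<Omega> \<Longrightarrow> h differentiable at z" and z: "(x, y) \<in> \<Omega>" and r: "r > 0"
  shows "fd h (x, r *\<^sub>R y) (u, r *\<^sub>R v) = r ^ p * fd h (x, y) (u, v)"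
proof -
  define S where "S = (\<lambda>z :: 'a \<times> 'b. (fst z, r *\<^sub>R snd z))"
  have S: "(S has_derivative S) (at (x, y))"
    unfolding S_def by (auto intro!: derivative_eq_intros)
  have d: "h differentiable at (S (x, y))" using h(2) \<Omega>(2) z r by (auto simp: S_def cone_def)
  have "((\<lambda>z. h (S z)) has_derivative (\<lambda>w. fd h (S (x, y)) (S w))) (at (x, y))"
    using diff_chain_at[OF S fd_works[OF d]] by (simp add: o_def)
  then have "fd (\<lambda>z. h (S z)) (x, y) = (\<lambda>w. fd h (S (x, y)) (S w))" by (rule fd_eq)
  moreover have "fd (\<lambda>z. h (S z)) (x, y) = fd (\<lambda>z. r ^ p * h z) (x, y)"
    by (rule fd_cong_open[OF \<Omega>(1) z]) (use h(1) r in \<open>auto simp: S_def homog_def\<close>)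
  moreover have "fd (\<lambda>z. r ^ p * h z) (x, y) = (\<lambda>w. r ^ p * fd h (x, y) w)"
    by (intro fd_eq has_derivative_mult_right fd_works h(2) z)
  ultimately have "fd h (S (x, y)) (S (u, v)) = r ^ p * fd h (x, y) (u, v)" by metis
  then show ?thesis by (simp add: S_def)
qed

lemma homog_fd_fst:
  assumes "homog \<Omega> p h" "\<And>z. z \<in> \<Omega> \<Longrightarrow> h differentiable at z"
  shows "homog \<Omega> p (\<lambda>z. fd h z (u, 0))"
  unfolding homog_def using homog_fd[OF assms, of _ _ _ u 0] by auto

lemma homog_fd_snd:
  assumes "homog \<Omega> (Suc p) h" "\<And>z. z \<in> \<Omega> \<Longrightarrow> h differentiable at z"
  shows "homog \<Omega> p (\<lambda>z. fd h z (0, v))"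
  unfolding homog_def
proof (intro allI impI, elim conjE)
  fix x y and r :: real assume z: "(x, y) \<in> \<Omega>" "r > 0"
  then have "(x, r *\<^sub>R y) \<in> \<Omega>" using \<Omega>(2) by (auto simp: cone_def)
  then have "fd h (x, r *\<^sub>R y) (0, r *\<^sub>R v) = r * fd h (x, r *\<^sub>R y) (0, v)"
    using linear_cmul[OF linear_fd_snd[OF assms(2)]] by simp
  then show "fd h (x, r *\<^sub>R y) (0, v) = r ^ p * fd h (x, y) (0, v)"
    using homog_fd[OF assms z, of 0 v] z by simp
qed

lemma euler:
  assumes h: "homog \<Omega> p h" "\<And>z. z \<in> \<Omega> \<Longrightarrow> h differentiable at z" and z: "(x, y) \<in> \<Omega>"
  shows "fd h (x, y) (0, y) = real p * h (x, y)"
proof -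
  have "((\<lambda>t. h ((x, y) + t *\<^sub>R (0, y))) has_real_derivative fd h (x, y) (0, y)) (at 0)"
    using has_real_derivative_line[of h "(x, y)" 0 "(0, y)"] h(2)[OF z] by simp
  moreover have "((\<lambda>t. h ((x, y) + t *\<^sub>R (0, y))) has_real_derivative real p * h (x, y)) (at 0)"
  proof (rule has_field_derivative_transform_within_open[of "\<lambda>t. (1 + t) ^ p * h (x, y)" _ 0 "{-1<..}"])
    show "((\<lambda>t. (1 + t) ^ p * h (x, y)) has_real_derivative real p * h (x, y)) (at 0)"
      by (auto intro!: derivative_eq_intros)
    fix t :: real assume "t \<in> {-1<..}"
    then have "h (x, (1 + t) *\<^sub>R y) = (1 + t) ^ p * h (x, y)" using h(1) z by (auto simp: homog_def)
    then show "(1 + t) ^ p * h (x, y) = h ((x, y) + t *\<^sub>R (0, y))" by (simp add: scaleR_add_left)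
  qed auto
  ultimately show ?thesis by (rule DERIV_unique)
qed

end

section \<open>The geodesic spray of a Finsler function in coordinates\<close>

locale finsler_chart =
  fixes f :: "(real ^ 'n) \<times> (real ^ 'n) \<Rightarrow> real" and \<Omega> :: "((real ^ 'n) \<times> (real ^ 'n)) set"
  assumes open_\<Omega>: "open \<Omega>" and cone_\<Omega>: "cone \<Omega>" and smooth_f: "smooth_on \<Omega> f"
    and homog_f: "homog \<Omega> 1 f" and nondegenerate: "\<And>z. z \<in> \<Omega> \<Longrightarrow> invertible (fundamental_tensor f z)"
begin

definition L :: "(real ^ 'n) \<times> (real ^ 'n) \<Rightarrow> real" where "L z = (f z)\<^sup>2"

text \<open>The expression differentiated in the definition of the nonlinear connection. In this
  normalisation geodesics satisfy x'' + spray / 2 = 0, so a bilinear connection G corresponds to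
  spray = 2 G(y, y).\<close>

definition spray :: "'n \<Rightarrow> (real ^ 'n) \<times> (real ^ 'n) \<Rightarrow> real" where
  "spray j w = (\<Sum>k\<in>UNIV. matrix_inv (fundamental_tensor f w) $ j $ k *
     ((\<Sum>l\<in>UNIV. snd w $ l * dx l (dy k L) w) - dx k L w))"

lemma nonlinear_connection_spray: "nonlinear_connection f j i z = dy i (spray j) z / 4"
  unfolding nonlinear_connection_def spray_def[abs_def] L_def[abs_def] by simp

lemma smooth_L: "smooth_on \<Omega> L"
  unfolding L_def[abs_def] power2_eq_square by (intro smooth_on_mult open_\<Omega> smooth_f)

lemma differentiable_L: "z \<in> \<Omega> \<Longrightarrow> L differentiable at z"
  by (rule smooth_on_differentiable[OF smooth_L])

lemma differentiable_fd_L: "z \<in> \<Omega> \<Longrightarrow> (\<lambda>z. fd L z w) differentiable at z"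
  by (rule smooth_on_differentiable[OF smooth_on_fd[OF smooth_L]])

lemma homog_L: "homog \<Omega> 2 L"
  using homog_f by (simp add: homog_def L_def power_mult_distrib)

lemma fundamental_tensor_L:
  assumes z: "z \<in> \<Omega>"
  shows "fundamental_tensor f z $ i $ j = fd (\<lambda>w. fd L w (0, axis j 1)) z (0, axis i 1) / 2"
proof -
  have half: "fd (\<lambda>w. h w / 2) z v = fd h z v / 2" if "h differentiable at z"
    for h :: "(real ^ 'n) \<times> (real ^ 'n) \<Rightarrow> real" and z v
  proof -
    have "((\<lambda>w. (1 / 2) * h w) has_derivative (\<lambda>v. (1 / 2) * fd h z v)) (at z)"
      by (intro has_derivative_mult_right fd_works that)
    then show ?thesis by (simp add: fd_eq)
  qed
  have "fd (dy j (\<lambda>w. (f w)\<^sup>2 / 2)) z = fd (\<lambda>w. fd L w (0, axis j 1) / 2) z"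
  proof (rule fd_cong_open[OF open_\<Omega> z])
    fix w assume "w \<in> \<Omega>"
    then show "dy j (\<lambda>w. (f w)\<^sup>2 / 2) w = fd L w (0, axis j 1) / 2"
      using half[OF differentiable_L] by (simp add: dy_def L_def[abs_def])
  qed
  then show ?thesis
    using half[OF differentiable_fd_L[OF z]] by (simp add: fundamental_tensor_def dy_def[of i])
qed

lemma smooth_fundamental_tensor: "smooth_on \<Omega> (fundamental_tensor f)"
proof -
  have "smooth_on \<Omega> (\<lambda>z. fundamental_tensor f z $ i $ j)" for i j
  proof -
    have "smooth_on \<Omega> (\<lambda>z. fd (\<lambda>w. fd L w (0, axis j 1)) z (0, axis i 1) / 2)"
      by (intro smooth_on_divide open_\<Omega> smooth_on_fd smooth_L smooth_on_const) simp
    then show ?thesis by (subst smooth_on_cong[OF open_\<Omega> fundamental_tensor_L])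
  qed
  then show ?thesis by (simp add: smooth_on_mat_iff[OF open_\<Omega>])
qed

lemma smooth_snd_nth: "smooth_on \<Omega> (\<lambda>w. snd w $ l)"
  using iffD1[OF smooth_on_vec_iff[OF open_\<Omega>] smooth_on_snd] ..

lemma smooth_spray: "smooth_on \<Omega> (spray j)"
proof -
  have "smooth_on \<Omega> (\<lambda>w. matrix_inv (fundamental_tensor f w) $ j $ k)" for k
    using iffD1[OF smooth_on_mat_iff[OF open_\<Omega>] smooth_on_matrix_inv[OF open_\<Omega> smooth_fundamental_tensor nondegenerate]]
    by simp
  then show ?thesis
    unfolding spray_def[abs_def] dx_def dy_def
    by (intro smooth_on_sum smooth_on_mult smooth_on_diff open_\<Omega> smooth_snd_nth smooth_on_fd smooth_L)
qed

lemma homog_spray: "homog \<Omega> 2 (spray j)"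
proof -
  note fst = homog_fd_fst[OF open_\<Omega> cone_\<Omega>] and snd = homog_fd_snd[OF open_\<Omega> cone_\<Omega>]
  have 1: "homog \<Omega> 1 (\<lambda>z. fd L z (0, v))" for v
    by (rule snd[OF _ differentiable_L]) (use homog_L in \<open>simp_all add: numeral_2_eq_2\<close>)
  have 2: "homog \<Omega> 0 (\<lambda>z. fd (\<lambda>z. fd L z (0, v)) z (0, w))" for v w
    by (rule snd[OF _ differentiable_fd_L]) (use 1 in simp_all)
  have 3: "homog \<Omega> 1 (\<lambda>z. fd (\<lambda>z. fd L z (0, v)) z (u, 0))" for v u
    by (rule fst[OF 1 differentiable_fd_L])
  have 4: "homog \<Omega> 2 (\<lambda>z. fd L z (u, 0))" for u
    by (rule fst[OF homog_L differentiable_L])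
  show ?thesis
    unfolding homog_def
  proof (intro allI impI, elim conjE)
    fix x y and r :: real assume z: "(x, y) \<in> \<Omega>" "r > 0"
    then have z': "(x, r *\<^sub>R y) \<in> \<Omega>" using cone_\<Omega> by (auto simp: cone_def)
    have F: "fundamental_tensor f (x, r *\<^sub>R y) = fundamental_tensor f (x, y)"
      using 2 z by (simp add: vec_eq_iff fundamental_tensor_L[OF z'] fundamental_tensor_L[OF z(1)] homog_def)
    have H: "(\<Sum>l\<in>UNIV. (r *\<^sub>R y) $ l * dx l (dy k L) (x, r *\<^sub>R y)) - dx k L (x, r *\<^sub>R y)
        = r ^ 2 * ((\<Sum>l\<in>UNIV. y $ l * dx l (dy k L) (x, y)) - dx k L (x, y))" for k
    proof -
      have "dx l (dy k L) (x, r *\<^sub>R y) = r * dx l (dy k L) (x, y)" for l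
        using 3 z by (simp add: dx_def dy_def[abs_def] homog_def)
      moreover have "dx k L (x, r *\<^sub>R y) = r ^ 2 * dx k L (x, y)"
        using 4 z by (simp add: dx_def homog_def)
      ultimately show ?thesis
        by (simp add: sum_distrib_left right_diff_distrib power2_eq_square ac_simps)
    qed
    show "spray j (x, r *\<^sub>R y) = r ^ 2 * spray j (x, y)"
      unfolding spray_def snd_conv F H by (simp add: sum_distrib_left mult.left_commute)
  qed
qed

lemma fundamental_tensor_spray:
  assumes z: "(x, y) \<in> \<Omega>"
  shows "(\<Sum>j\<in>UNIV. fundamental_tensor f (x, y) $ k $ j * spray j (x, y))
    = fd (\<lambda>z. fd L z (0, axis k 1)) (x, y) (y, 0) - fd L (x, y) (axis k 1, 0)"
proof -
  define K where "K = (\<chi> k. (\<Sum>l\<in>UNIV. y $ l * dx l (dy k L) (x, y)) - dx k L (x, y))"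
  have "(\<chi> j. spray j (x, y)) = matrix_inv (fundamental_tensor f (x, y)) *v K"
    by (simp add: spray_def K_def matrix_vector_mult_def)
  then have "fundamental_tensor f (x, y) *v (\<chi> j. spray j (x, y)) = K"
    by (simp add: matrix_vector_mul_assoc matrix_inv_right nondegenerate[OF z])
  then have "(fundamental_tensor f (x, y) *v (\<chi> j. spray j (x, y))) $ k = K $ k" by simp
  moreover have "(\<Sum>l\<in>UNIV. y $ l * dx l (dy k L) (x, y)) = fd (\<lambda>z. fd L z (0, axis k 1)) (x, y) (y, 0)"
    using sum_dx[OF differentiable_fd_L[OF z], of y "(0, axis k 1)"] by (simp add: dy_def[abs_def])
  ultimately show ?thesis by (simp add: K_def matrix_vector_mult_def dx_def)
qed

text \<open>The geodesic equation in Euler--Lagrange form, with acceleration \<open>- c\<close>.\<close>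

definition spray_eq :: "real ^ 'n \<Rightarrow> (real ^ 'n) \<times> (real ^ 'n) \<Rightarrow> bool" where
  "spray_eq c z \<longleftrightarrow> (\<forall>v. fd (\<lambda>z. fd L z (0, v)) z (snd z, 0) - fd L z (v, 0) = fd (\<lambda>z. fd L z (0, v)) z (0, c))"

lemma linear_fd_fd_L:
  assumes z: "z \<in> \<Omega>"
  shows "linear (\<lambda>v. fd (\<lambda>z. fd L z (0, v)) z w)"
proof (rule linearI)
  show "fd (\<lambda>z. fd L z (0, v + v')) z w = fd (\<lambda>z. fd L z (0, v)) z w + fd (\<lambda>z. fd L z (0, v')) z w" for v v'
  proof -
    have "fd (\<lambda>z. fd L z (0, v + v')) z = fd (\<lambda>z. fd L z (0, v) + fd L z (0, v')) z"
      by (rule fd_cong_open[OF open_\<Omega> z]) (rule linear_add[OF linear_fd_snd[OF differentiable_L]])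
    also have "\<dots> = (\<lambda>w. fd (\<lambda>z. fd L z (0, v)) z w + fd (\<lambda>z. fd L z (0, v')) z w)"
      by (intro fd_eq has_derivative_add fd_works differentiable_fd_L z)
    finally show ?thesis by simp
  qed
  show "fd (\<lambda>z. fd L z (0, c *\<^sub>R v)) z w = c *\<^sub>R fd (\<lambda>z. fd L z (0, v)) z w" for c v
  proof -
    have "fd (\<lambda>z. fd L z (0, c *\<^sub>R v)) z = fd (\<lambda>z. c *\<^sub>R fd L z (0, v)) z"
      by (rule fd_cong_open[OF open_\<Omega> z]) (rule linear_cmul[OF linear_fd_snd[OF differentiable_L]])
    also have "\<dots> = (\<lambda>w. c *\<^sub>R fd (\<lambda>z. fd L z (0, v)) z w)"
      by (intro fd_eq has_derivative_scaleR_right fd_works differentiable_fd_L z)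
    finally show ?thesis by simp
  qed
qed

text \<open>Tested on coordinate vectors, the Euler-Lagrange equation reads g (spray - 2 c) = 0 with
  g the fundamental tensor, which is invertible. The factor 2 arises because g is half the fibre
  Hessian of \<open>L\<close>.\<close>

lemma spray_eq_iff:
  assumes z: "z \<in> \<Omega>"
  shows "spray_eq c z \<longleftrightarrow> (\<forall>j. spray j z = 2 * c $ j)"
proof -
  obtain x y where xy: "z = (x, y)" by (cases z)
  let ?E = "\<lambda>v. fd (\<lambda>z. fd L z (0, v)) z (y, 0) - fd L z (v, 0) - fd (\<lambda>z. fd L z (0, v)) z (0, c)"
  let ?F = "fundamental_tensor f z"
  let ?d = "(\<chi> j. spray j z) - 2 *\<^sub>R c"
  have lin: "linear ?E"
    by (intro linear_compose_sub linear_fd_fd_L[OF z] linear_fd_fst differentiable_L z)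
  have E: "?E (axis k 1) = (?F *v ?d) $ k" for k
  proof -
    have "fd (\<lambda>z. fd L z (0, axis k 1)) z (0, c) = (\<Sum>j\<in>UNIV. c $ j * fd (\<lambda>z. fd L z (0, axis k 1)) z (0, axis j 1))"
      using linear_axis_sum[OF linear_fd_snd[OF differentiable_fd_L[OF z]], of "(0, axis k 1)" c] by simp
    also have "\<dots> = (\<Sum>j\<in>UNIV. c $ j * (2 * ?F $ k $ j))"
      using fd_commute[OF open_\<Omega> z smooth_L] by (simp add: fundamental_tensor_L[OF z])
    finally have 1: "fd (\<lambda>z. fd L z (0, axis k 1)) z (0, c) = (?F *v (2 *\<^sub>R c)) $ k"
      by (simp add: matrix_vector_mult_def ac_simps)
    have "(?F *v (\<chi> j. spray j z)) $ k = fd (\<lambda>z. fd L z (0, axis k 1)) z (y, 0) - fd L z (axis k 1, 0)"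
      using fundamental_tensor_spray[of x y k] z unfolding xy by (simp add: matrix_vector_mult_def)
    then show ?thesis using 1 by (simp add: matrix_vector_mult_diff_distrib)
  qed
  have "spray_eq c z \<longleftrightarrow> (\<forall>v. ?E v = 0)"
    by (simp add: spray_eq_def xy)
  also have "\<dots> \<longleftrightarrow> (\<forall>k. ?E (axis k 1) = 0)"
  proof
    assume a: "\<forall>k. ?E (axis k 1) = 0"
    show "\<forall>v. ?E v = 0"
    proof
      fix v show "?E v = 0" by (subst linear_axis_sum[OF lin]) (simp only: a, simp)
    qed
  qed blast
  also have "\<dots> \<longleftrightarrow> ?F *v ?d = 0"
    unfolding E by (simp add: vec_eq_iff)
  also have "\<dots> \<longleftrightarrow> ?d = 0"
  proof
    assume "?F *v ?d = 0"
    then have "matrix_inv ?F *v (?F *v ?d) = 0" by simp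
    then show "?d = 0" by (simp only: matrix_vector_mul_assoc matrix_inv_left[OF nondegenerate[OF z]] matrix_vector_mul_lid)
  qed simp
  also have "\<dots> \<longleftrightarrow> (\<forall>j. spray j z = 2 * c $ j)" by (simp add: vec_eq_iff)
  finally show ?thesis .
qed

section \<open>Bilinear connections and the invariance of F^2\<close>

context
  fixes G :: "real ^ 'n \<Rightarrow> real ^ 'n \<Rightarrow> real ^ 'n \<Rightarrow> real ^ 'n"
  assumes G: "\<And>x. bilinear (G x)"
begin

lemma quadratic_derivative:
  "((\<lambda>t. G x (y + t *\<^sub>R v) (y + t *\<^sub>R v) $ k) has_real_derivative (G x v y + G x y v) $ k) (at 0)"
proof -
  have "G x (y + t *\<^sub>R v) (y + t *\<^sub>R v) $ k = G x y y $ k + t * (G x v y + G x y v) $ k + t * t * G x v v $ k" for t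
    by (simp add: bilinear_ladd[OF G] bilinear_radd[OF G] bilinear_lmul[OF G] bilinear_rmul[OF G] algebra_simps)
  then show ?thesis by (auto intro!: derivative_eq_intros)
qed

lemma spray_derivative:
  assumes z: "(x, y) \<in> \<Omega>" and s: "\<And>y. (x, y) \<in> \<Omega> \<Longrightarrow> spray k (x, y) = 2 * G x y y $ k"
  shows "fd (spray k) (x, y) (0, v) = 2 * (G x v y + G x y v) $ k"
proof (rule fd_eq_line_derivative[OF open_\<Omega> z])
  show "spray k differentiable at (x, y)" by (rule smooth_on_differentiable[OF smooth_spray z])
  show "((\<lambda>t. 2 * G x (y + t *\<^sub>R v) (y + t *\<^sub>R v) $ k) has_real_derivative 2 * (G x v y + G x y v) $ k) (at 0)"
    by (rule DERIV_cmult[OF quadratic_derivative])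
qed (use s in auto)

text \<open>The fibre derivative of the spray along v is 4 G(v, y), so Euler's theorem in degree 2
  gives spray = 2 G(y, y). Differentiating this once more gives 4 G(v, y) = 2 G(v, y) + 2 G(y, v),
  hence symmetry for y in an open set, and by linearity for all arguments.\<close>

lemma connection_imp_spray:
  assumes N: "\<And>x y k i. (x, y) \<in> \<Omega> \<Longrightarrow> nonlinear_connection f k i (x, y) = G x (axis i 1) y $ k"
    and z: "(x, y) \<in> \<Omega>"
  shows "spray k (x, y) = 2 * G x y y $ k" "G x u v = G x v u"
proof -
  have d: "spray k differentiable at (x, y)" if "(x, y) \<in> \<Omega>" for k y by (rule smooth_on_differentiable[OF smooth_spray that])
  have lG: "linear (\<lambda>u. G x u y $ k)" for y k
    by (rule linearI) (simp_all add: bilinear_ladd[OF G] bilinear_lmul[OF G])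
  have ds: "fd (spray k) (x, y) (0, v) = 4 * G x v y $ k" if "(x, y) \<in> \<Omega>" for k v y
  proof -
    have "fd (spray k) (x, y) (0, v) = (\<Sum>i\<in>UNIV. v $ i * dy i (spray k) (x, y))"
      by (rule sum_dy[OF d[OF that], symmetric])
    also have "\<dots> = 4 * (\<Sum>i\<in>UNIV. v $ i * G x (axis i 1) y $ k)"
      using N[OF that] by (simp add: nonlinear_connection_spray sum_distrib_left field_simps)
    also have "\<dots> = 4 * G x v y $ k" using linear_axis_sum[OF lG, of v y k] by simp
    finally show ?thesis .
  qed
  have s: "spray k (x, y) = 2 * G x y y $ k" if "(x, y) \<in> \<Omega>" for k y
    using euler[OF open_\<Omega> cone_\<Omega> homog_spray smooth_on_differentiable[OF smooth_spray] that, of k] ds[OF that, of k y]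
    by simp
  then show "spray k (x, y) = 2 * G x y y $ k" using z by blast
  have sym: "G x v y - G x y v = 0" if "(x, y) \<in> \<Omega>" for v y
    using spray_derivative[OF that s] ds[OF that] by (simp add: vec_eq_iff)
  have "G x v u - G x u v = 0"
  proof (rule linear_zero_on_open[where L = "\<lambda>w. G x v w - G x w v" and S = "(\<lambda>w. (x, w)) -` \<Omega>" and x = y and v = u])
    show "linear (\<lambda>w. G x v w - G x w v)"
      using G[of x] by (intro linear_compose_sub) (auto simp: bilinear_def)
    show "open ((\<lambda>w. (x, w)) -` \<Omega>)" by (intro open_vimage open_\<Omega> continuous_intros)
  qed (use z sym in auto)
  then show "G x u v = G x v u" by simp
qed

lemma spray_imp_connection:
  assumes sym: "\<And>u v. G x u v = G x v u"
    and s: "\<And>y k. (x, y) \<in> \<Omega> \<Longrightarrow> spray k (x, y) = 2 * G x y y $ k" and z: "(x, y) \<in> \<Omega>"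
  shows "nonlinear_connection f k i (x, y) = G x (axis i 1) y $ k"
  using spray_derivative[OF z s, of k "axis i 1"] sym[of y "axis i 1"]
  by (simp add: nonlinear_connection_spray dy_def)

text \<open>The identity \<open>e\<close> is differentiated in y along v. Along the line y + t v
  both sides are polynomials in t whose coefficients are derivatives of \<open>L\<close> in fixed
  directions, and the resulting mixed derivatives are interchanged at the end.\<close>

lemma contracted_derivative:
  assumes sym: "\<And>u v. G x u v = G x v u" and z: "(x, y) \<in> \<Omega>"
    and e: "\<And>y. (x, y) \<in> \<Omega> \<Longrightarrow> fd L (x, y) (y, 0) = fd L (x, y) (0, G x y y)"
  shows "fd (\<lambda>z. fd L z (0, v)) (x, y) (y, 0) + fd L (x, y) (v, 0)
    = fd (\<lambda>z. fd L z (0, v)) (x, y) (0, G x y y) + 2 * fd L (x, y) (0, G x v y)"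
proof -
  let ?p = "\<lambda>t. (x, y) + t *\<^sub>R (0, v)"
  obtain d where d: "d > 0" "\<And>t. \<bar>t\<bar> < d \<Longrightarrow> ?p t \<in> \<Omega>" using line_in_open[OF open_\<Omega> z, of "(0, v)"] by blast
  have D: "((\<lambda>t. fd L (?p t) w) has_real_derivative fd (\<lambda>z. fd L z w) (x, y) (0, v)) (at 0)" for w
    using has_real_derivative_line[of "\<lambda>z. fd L z w" "(x, y)" 0 "(0, v)"] differentiable_fd_L[OF z] by simp
  have l: "((\<lambda>t. fd L (?p t) (y, 0) + t * fd L (?p t) (v, 0)) has_real_derivative
      fd (\<lambda>z. fd L z (y, 0)) (x, y) (0, v) + fd L (x, y) (v, 0)) (at 0)"
    by (rule derivative_eq_intros D refl)+ simp
  have r: "((\<lambda>t. fd L (?p t) (0, G x y y) + t * (2 * fd L (?p t) (0, G x v y)) + t * t * fd L (?p t) (0, G x v v)) has_real_derivative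
      fd (\<lambda>z. fd L z (0, G x y y)) (x, y) (0, v) + 2 * fd L (x, y) (0, G x v y)) (at 0)"
    by (rule derivative_eq_intros D refl)+ simp
  have eq: "fd L (?p t) (y, 0) + t * fd L (?p t) (v, 0)
      = fd L (?p t) (0, G x y y) + t * (2 * fd L (?p t) (0, G x v y)) + t * t * fd L (?p t) (0, G x v v)"
    if "\<bar>t\<bar> < d" for t
  proof -
    have p: "(x, y + t *\<^sub>R v) \<in> \<Omega>" using d(2)[OF that] by simp
    note l1 = linear_fd_fst[OF differentiable_L[OF p]] and l2 = linear_fd_snd[OF differentiable_L[OF p]]
    have q: "G x (y + t *\<^sub>R v) (y + t *\<^sub>R v) = G x y y + (t *\<^sub>R G x v y + t *\<^sub>R G x v y) + (t * t) *\<^sub>R G x v v"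
      using sym[of y v] by (simp add: bilinear_ladd[OF G] bilinear_radd[OF G] bilinear_lmul[OF G] bilinear_rmul[OF G]
          algebra_simps)
    have a: "fd L (x, y + t *\<^sub>R v) (y + t *\<^sub>R v, 0) = fd L (x, y + t *\<^sub>R v) (y, 0) + t * fd L (x, y + t *\<^sub>R v) (v, 0)"
      by (simp add: linear_add[OF l1] linear_cmul[OF l1])
    have b: "fd L (x, y + t *\<^sub>R v) (0, G x y y + (t *\<^sub>R G x v y + t *\<^sub>R G x v y) + (t * t) *\<^sub>R G x v v)
      = fd L (x, y + t *\<^sub>R v) (0, G x y y) + (t * fd L (x, y + t *\<^sub>R v) (0, G x v y) + t * fd L (x, y + t *\<^sub>R v) (0, G x v y))
        + t * t * fd L (x, y + t *\<^sub>R v) (0, G x v v)"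
      by (simp only: linear_add[OF l2] linear_cmul[OF l2] real_scaleR_def)
    show ?thesis using e[OF p] unfolding q a b by simp
  qed
  have "((\<lambda>t. fd L (?p t) (0, G x y y) + t * (2 * fd L (?p t) (0, G x v y)) + t * t * fd L (?p t) (0, G x v v)) has_real_derivative
      fd (\<lambda>z. fd L z (y, 0)) (x, y) (0, v) + fd L (x, y) (v, 0)) (at 0)"
    by (rule has_field_derivative_transform_within_open[OF l, of "ball 0 d"])
      (use d(1) eq in \<open>simp_all add: dist_real_def\<close>)
  then have "fd (\<lambda>z. fd L z (y, 0)) (x, y) (0, v) + fd L (x, y) (v, 0)
    = fd (\<lambda>z. fd L z (0, G x y y)) (x, y) (0, v) + 2 * fd L (x, y) (0, G x v y)"
    using r by (rule DERIV_unique)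
  then show ?thesis
    using fd_commute[OF open_\<Omega> z smooth_L, of "(y, 0)" "(0, v)"] fd_commute[OF open_\<Omega> z smooth_L, of "(0, G x y y)" "(0, v)"]
    by simp
qed

text \<open>Putting v = y into the Euler-Lagrange equation and using homogeneity gives the
  invariance of \<open>L\<close> along y. Its derivative along v, minus the Euler-Lagrange equation
  for v, is twice the claimed identity.\<close>

lemma spray_imp_invariant:
  assumes sym: "\<And>u v. G x u v = G x v u"
    and s: "\<And>y k. (x, y) \<in> \<Omega> \<Longrightarrow> spray k (x, y) = 2 * G x y y $ k" and z: "(x, y) \<in> \<Omega>"
  shows "fd L (x, y) (v, 0) = fd L (x, y) (0, G x v y)"
proof -
  have E1: "fd (\<lambda>z. fd L z (0, v)) (x, y) (y, 0) - fd L (x, y) (v, 0) = fd (\<lambda>z. fd L z (0, v)) (x, y) (0, G x y y)"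
    if "(x, y) \<in> \<Omega>" for y v
    using spray_eq_iff[OF that, of "G x y y"] s[OF that] by (simp add: spray_eq_def)
  have E2: "fd L (x, y) (y, 0) = fd L (x, y) (0, G x y y)" if z: "(x, y) \<in> \<Omega>" for y
  proof -
    have "fd (\<lambda>z. fd L z (0, y)) (x, y) (y, 0) = fd (\<lambda>z. fd L z (y, 0)) (x, y) (0, y)"
      by (rule fd_commute[OF open_\<Omega> z smooth_L])
    also have "\<dots> = real 2 * fd L (x, y) (y, 0)"
      by (rule euler[OF open_\<Omega> cone_\<Omega> homog_fd_fst[OF open_\<Omega> cone_\<Omega> homog_L differentiable_L] differentiable_fd_L z])
    finally have 1: "fd (\<lambda>z. fd L z (0, y)) (x, y) (y, 0) = 2 * fd L (x, y) (y, 0)" by simp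
    have h: "homog \<Omega> (Suc 1) L" using homog_L by (simp add: numeral_2_eq_2)
    have "fd (\<lambda>z. fd L z (0, y)) (x, y) (0, G x y y) = fd (\<lambda>z. fd L z (0, G x y y)) (x, y) (0, y)"
      by (rule fd_commute[OF open_\<Omega> z smooth_L])
    also have "\<dots> = real 1 * fd L (x, y) (0, G x y y)"
      by (rule euler[OF open_\<Omega> cone_\<Omega> homog_fd_snd[OF open_\<Omega> cone_\<Omega> h differentiable_L] differentiable_fd_L z])
    finally show ?thesis using E1[OF z, of y] 1 by simp
  qed
  show ?thesis using contracted_derivative[OF sym z E2, of v] E1[OF z, of v] by simp
qed

text \<open>Invariance contracted with y and differentiated along v becomes the Euler-Lagrange
  equation with acceleration -G(y, y); nondegeneracy then identifies the spray.\<close>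

lemma invariant_imp_spray:
  assumes sym: "\<And>u v. G x u v = G x v u"
    and inv: "\<And>y v. (x, y) \<in> \<Omega> \<Longrightarrow> fd L (x, y) (v, 0) = fd L (x, y) (0, G x v y)" and z: "(x, y) \<in> \<Omega>"
  shows "spray k (x, y) = 2 * G x y y $ k"
proof -
  have "fd (\<lambda>z. fd L z (0, v)) (x, y) (y, 0) + fd L (x, y) (v, 0)
    = fd (\<lambda>z. fd L z (0, v)) (x, y) (0, G x y y) + 2 * fd L (x, y) (0, G x v y)" for v
    by (rule contracted_derivative[OF sym z inv])
  then have "spray_eq (G x y y) (x, y)" using inv[OF z] by (simp add: spray_eq_def)
  then show ?thesis using spray_eq_iff[OF z] by blast
qed

end

end

section \<open>Ricci curvature of a Berwald connection\<close>

text \<open>Differentiability of G in x is given for fixed arguments; expanding in the components of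
  y yields joint differentiability.\<close>

lemma connection_derivative:
  fixes G :: "real ^ 'n \<Rightarrow> real ^ 'n \<Rightarrow> real ^ 'n \<Rightarrow> real ^ 'n"
  assumes G: "\<And>x. bilinear (G x)" and d: "\<And>u v. (\<lambda>x. G x u v) differentiable at x"
  shows "((\<lambda>z. G (fst z) w (snd z) $ k) has_derivative
    (\<lambda>h. fd (\<lambda>x. G x w y) x (fst h) $ k + G x w (snd h) $ k)) (at (x, y))"
proof -
  have l: "linear (G x w)" for x using G by (simp add: bilinear_def)
  have lk: "linear (\<lambda>v. G x w v $ k)" for x
    by (rule linearI) (simp_all add: linear_add[OF l] linear_cmul[OF l])
  have e: "G x w v $ k = (\<Sum>i\<in>UNIV. v $ i * G x w (axis i 1) $ k)" for x v
    using linear_axis_sum[OF lk[of x], of v] by simp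
  have dk: "((\<lambda>z. G (fst z) w (axis i 1) $ k) has_derivative (\<lambda>h. fd (\<lambda>x. G x w (axis i 1)) x (fst h) $ k)) (at (x, y))" for i
  proof -
    have 1: "(fst has_derivative fst) (at (x, y))" by (rule has_derivative_fst[OF has_derivative_ident])
    have 2: "((\<lambda>x. G x w (axis i 1)) has_derivative fd (\<lambda>x. G x w (axis i 1)) x) (at (fst (x, y)))"
      by (simp add: fd_works d)
    show ?thesis
      using bounded_linear.has_derivative[OF bounded_linear_vec_nth diff_chain_at[OF 1 2]] by (simp add: o_def)
  qed
  have ds: "((\<lambda>z. snd z $ i) has_derivative (\<lambda>h. snd h $ i)) (at (x, y))" for i
    by (rule bounded_linear.has_derivative[OF bounded_linear_vec_nth has_derivative_snd[OF has_derivative_ident]])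
  have D: "((\<lambda>z. \<Sum>i\<in>UNIV. snd z $ i * G (fst z) w (axis i 1) $ k) has_derivative
    (\<lambda>h. \<Sum>i\<in>UNIV. snd (x, y) $ i * fd (\<lambda>x. G x w (axis i 1)) x (fst h) $ k + snd h $ i * G (fst (x, y)) w (axis i 1) $ k)) (at (x, y))"
    by (intro has_derivative_sum has_derivative_mult ds dk)
  have E: "fd (\<lambda>x. G x w y) x u $ k = (\<Sum>i\<in>UNIV. y $ i * fd (\<lambda>x. G x w (axis i 1)) x u $ k)" for u
    using arg_cong[OF linear_axis_sum[OF fd_bilinear_linear(1)[where G = G, OF G d], of w y u], of "\<lambda>v. v $ k"] by simp
  have "(\<lambda>z. G (fst z) w (snd z) $ k) = (\<lambda>z. \<Sum>i\<in>UNIV. snd z $ i * G (fst z) w (axis i 1) $ k)"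
    by (rule ext) (rule e)
  then show ?thesis
    by (rule ssubst) (rule has_derivative_eq_rhs[OF D], rule ext, simp add: sum.distrib flip: e E)
qed

text \<open>As N is linear in y, applying \<delta> to it produces exactly the derivative and the
  product term of the affine curvature. Hence the Finslerian R is that curvature evaluated on y, and
  Ric is a quadratic form in y.\<close>

lemma Ric_curvature:
  fixes G :: "real ^ 'n \<Rightarrow> real ^ 'n \<Rightarrow> real ^ 'n \<Rightarrow> real ^ 'n"
  assumes \<Omega>: "open \<Omega>" "(x, y) \<in> \<Omega>"
    and N: "\<And>x y k i. (x, y) \<in> \<Omega> \<Longrightarrow> nonlinear_connection f k i (x, y) = G x (axis i 1) y $ k"
    and G: "\<And>x. bilinear (G x)" and d: "\<And>u v. (\<lambda>x. G x u v) differentiable at x"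
  shows "Ric f (x, y) = (\<Sum>i\<in>UNIV. curvature G x (axis i 1) y y $ i)"
proof -
  have fdN: "fd (nonlinear_connection f k j) (x, y) (u, v) = fd (\<lambda>x. G x (axis j 1) y) x u $ k + G x (axis j 1) v $ k"
    for k j u v
  proof -
    have "fd (nonlinear_connection f k j) (x, y) = fd (\<lambda>z. G (fst z) (axis j 1) (snd z) $ k) (x, y)"
      by (rule fd_cong_open[OF \<Omega>]) (use N in force)
    then show ?thesis using fd_eq[OF connection_derivative[where G = G, OF G d]] by simp
  qed
  have l: "linear (G x w)" for x w using G by (simp add: bilinear_def)
  have z0: "fd (\<lambda>x. G x w y) x 0 = 0" for w
    by (rule linear_0[OF has_derivative_linear[OF fd_works[OF d]]])
  have delta: "delta f i (nonlinear_connection f k j) (x, y)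
      = (fd (\<lambda>x. G x (axis j 1) y) x (axis i 1) - G x (axis j 1) (G x (axis i 1) y)) $ k" for i j k
  proof -
    have lk: "linear (\<lambda>v. G x (axis j 1) v $ k)"
      by (rule linearI) (simp_all add: linear_add[OF l] linear_cmul[OF l])
    show ?thesis
      using linear_axis_sum[OF lk, of "G x (axis i 1) y"]
      by (simp add: delta_def dx_def dy_def fdN N[OF \<Omega>(2)] z0 linear_0[OF l])
  qed
  have "connection_curvature f k i j (x, y) = curvature G x (axis i 1) (axis j 1) y $ k" for k i j
    by (simp add: connection_curvature_def delta curvature_def)
  then have "Ric f (x, y) = (\<Sum>i\<in>UNIV. \<Sum>j\<in>UNIV. y $ j * curvature G x (axis i 1) (axis j 1) y $ i)"
    by (simp add: Ric_def mult.commute)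
  moreover have "curvature G x u y w $ i = (\<Sum>j\<in>UNIV. y $ j * curvature G x u (axis j 1) w $ i)" for u w i
    using arg_cong[OF linear_axis_sum[OF curvature_linear(2)[where G = G, OF G d], of u y w], of "\<lambda>v. v $ i"] by simp
  ultimately show ?thesis by simp
qed

lemma smooth_curvature:
  fixes G :: "real ^ 'n \<Rightarrow> real ^ 'n \<Rightarrow> real ^ 'n \<Rightarrow> real ^ 'n"
  assumes U: "open U" and G: "\<And>x. bilinear (G x)" and s: "\<And>u v. smooth_on U (\<lambda>x. G x u v)"
  shows "smooth_on U (\<lambda>x. curvature G x u v w)"
proof -
  have GG: "smooth_on U (\<lambda>x. G x u (\<gamma> x))" if "smooth_on U \<gamma>" for u \<gamma>
  proof -
    have "G x u (\<gamma> x) = (\<Sum>i\<in>UNIV. \<gamma> x $ i *\<^sub>R G x u (axis i 1))" for x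
      using G[of x] by (intro linear_axis_sum) (simp add: bilinear_def)
    moreover have "smooth_on U (\<lambda>x. \<Sum>i\<in>UNIV. \<gamma> x $ i *\<^sub>R G x u (axis i 1))"
      using that by (intro smooth_on_sum smooth_on_scaleR U s) (simp add: smooth_on_vec_iff[OF U])
    ultimately show ?thesis by simp
  qed
  show ?thesis
    unfolding curvature_def by (intro smooth_on_add smooth_on_diff U smooth_on_fd s GG)
qed

lemma bilinear_axis_sum:
  fixes B :: "real ^ 'n \<Rightarrow> real ^ 'm \<Rightarrow> real"
  assumes "bilinear B"
  shows "B v w = (\<Sum>i\<in>UNIV. \<Sum>k\<in>UNIV. v $ i * (w $ k * B (axis i 1) (axis k 1)))"
proof -
  have "linear (\<lambda>v. B v w)" "\<And>v. linear (B v)" using assms by (auto simp: bilinear_def)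
  then show ?thesis
    using linear_axis_sum[of "\<lambda>v. B v w" v] linear_axis_sum[of "B _" w] by (simp add: sum_distrib_left)
qed

text \<open>The Finsler-Ricci tensor is defined as a fibre Hessian. For a quadratic form the Hessian
  does not involve y and is the symmetrised coefficient form, so its vanishing on the cone reaches
  all arguments.\<close>

lemma quadratic_form_hessian:
  fixes \<rho> :: "real ^ 'n \<Rightarrow> real ^ 'n \<Rightarrow> real ^ 'n \<Rightarrow> real"
  assumes \<Omega>: "open \<Omega>" "(x, y) \<in> \<Omega>" and U: "open U" "fst ` \<Omega> \<subseteq> U"
    and R: "\<And>x y. (x, y) \<in> \<Omega> \<Longrightarrow> R (x, y) = \<rho> x y y"
    and bil: "\<And>x. x \<in> U \<Longrightarrow> bilinear (\<rho> x)" and smooth: "\<And>v w. smooth_on U (\<lambda>x. \<rho> x v w)"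
  shows "dy i (dy j R) (x, y) = \<rho> x (axis i 1) (axis j 1) + \<rho> x (axis j 1) (axis i 1)"
proof -
  have smooth': "smooth_on \<Omega> (\<lambda>z. \<rho> (fst z) v w)" for v w
    by (rule smooth_on_compose[OF \<Omega>(1) U(1) _ smooth smooth_on_fst]) (use U in auto)
  have nth: "smooth_on \<Omega> (\<lambda>z. snd z $ l)" for l
    using iffD1[OF smooth_on_vec_iff[OF \<Omega>(1)] smooth_on_snd] ..
  have exp: "\<rho> x v w = (\<Sum>i\<in>UNIV. \<Sum>k\<in>UNIV. v $ i * (w $ k * \<rho> x (axis i 1) (axis k 1)))" if x: "x \<in> U" for x v w
    by (rule bilinear_axis_sum[OF bil[OF x]])
  have "smooth_on \<Omega> (\<lambda>z. \<Sum>i\<in>UNIV. \<Sum>k\<in>UNIV. snd z $ i * (snd z $ k * \<rho> (fst z) (axis i 1) (axis k 1)))"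
    by (intro smooth_on_sum smooth_on_mult \<Omega>(1) nth smooth')
  moreover have "R z = (\<Sum>i\<in>UNIV. \<Sum>k\<in>UNIV. snd z $ i * (snd z $ k * \<rho> (fst z) (axis i 1) (axis k 1)))" if "z \<in> \<Omega>" for z
    using R[of "fst z" "snd z"] exp[of "fst z" "snd z" "snd z"] that U(2) by auto
  ultimately have sR: "smooth_on \<Omega> R" by (subst smooth_on_cong[OF \<Omega>(1)])
  have l: "\<rho> x (y + t *\<^sub>R v) (y + t *\<^sub>R v) = \<rho> x y y + t * (\<rho> x v y + \<rho> x y v) + t * t * \<rho> x v v"
    and l2: "\<rho> x v (y + t *\<^sub>R w) + \<rho> x (y + t *\<^sub>R w) v = \<rho> x v y + \<rho> x y v + t * (\<rho> x v w + \<rho> x w v)"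
    if "x \<in> U" for x y v w t
    using bil[OF that]
    by (simp_all add: bilinear_ladd bilinear_radd bilinear_lmul bilinear_rmul algebra_simps)
  have 1: "dy j R (x, y) = \<rho> x (axis j 1) y + \<rho> x y (axis j 1)" if z: "(x, y) \<in> \<Omega>" for x y
    unfolding dy_def
  proof (rule fd_eq_line_derivative[OF \<Omega>(1) z smooth_on_differentiable[OF sR z]])
    have x: "x \<in> U" using U(2) z by force
    show "R ((x, y) + t *\<^sub>R (0, axis j 1)) = \<rho> x y y + t * (\<rho> x (axis j 1) y + \<rho> x y (axis j 1)) + t * t * \<rho> x (axis j 1) (axis j 1)"
      if "(x, y) + t *\<^sub>R (0, axis j 1) \<in> \<Omega>" for t
      using that R by (simp add: l[OF x])
    show "((\<lambda>t. \<rho> x y y + t * (\<rho> x (axis j 1) y + \<rho> x y (axis j 1)) + t * t * \<rho> x (axis j 1) (axis j 1))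
      has_real_derivative \<rho> x (axis j 1) y + \<rho> x y (axis j 1)) (at 0)"
      by (auto intro!: derivative_eq_intros)
  qed
  show ?thesis
    unfolding dy_def[of i]
  proof (rule fd_eq_line_derivative[OF \<Omega>])
    have x: "x \<in> U" using U(2) \<Omega>(2) by force
    show "dy j R differentiable at (x, y)"
      unfolding dy_def[abs_def] by (rule smooth_on_differentiable[OF smooth_on_fd[OF sR] \<Omega>(2)])
    show "dy j R ((x, y) + t *\<^sub>R (0, axis i 1)) = \<rho> x (axis j 1) y + \<rho> x y (axis j 1) + t * (\<rho> x (axis j 1) (axis i 1) + \<rho> x (axis i 1) (axis j 1))"
      if "(x, y) + t *\<^sub>R (0, axis i 1) \<in> \<Omega>" for t
      using that 1 by (simp add: l2[OF x])
    show "((\<lambda>t. \<rho> x (axis j 1) y + \<rho> x y (axis j 1) + t * (\<rho> x (axis j 1) (axis i 1) + \<rho> x (axis i 1) (axis j 1)))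
      has_real_derivative \<rho> x (axis i 1) (axis j 1) + \<rho> x (axis j 1) (axis i 1)) (at 0)"
      by (auto intro!: derivative_eq_intros)
  qed
qed

text \<open>On the line from y0 to y the difference of the sides is a polynomial in the parameter.
  It vanishes on an interval around 0, so it is zero, in particular at parameter 1.\<close>

lemma cubic_identity_extends:
  fixes \<beta> c :: "'a::real_normed_vector \<Rightarrow> real" and A q :: "'a \<Rightarrow> 'a \<Rightarrow> real"
  assumes "linear \<beta>" "linear c" "bilinear A" "bilinear q" and S: "open S" "y0 \<in> S"
    and id: "\<And>y. y \<in> S \<Longrightarrow> p * \<beta> y * A y y = r * q y y * c y"
  shows "p * \<beta> y * A y y = r * q y y * c y"
proof -
  define v where "v = y - y0"
  define P where "P = smult p ([:\<beta> y0, \<beta> v:] * [:A y0 y0, A y0 v + A v y0, A v v:])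
    - smult r ([:q y0 y0, q y0 v + q v y0, q v v:] * [:c y0, c v:])"
  have P: "poly P t = p * \<beta> (y0 + t *\<^sub>R v) * A (y0 + t *\<^sub>R v) (y0 + t *\<^sub>R v)
      - r * q (y0 + t *\<^sub>R v) (y0 + t *\<^sub>R v) * c (y0 + t *\<^sub>R v)" for t
  proof -
    have e: "\<beta> (y0 + t *\<^sub>R v) = poly [:\<beta> y0, \<beta> v:] t" "c (y0 + t *\<^sub>R v) = poly [:c y0, c v:] t"
      "A (y0 + t *\<^sub>R v) (y0 + t *\<^sub>R v) = poly [:A y0 y0, A y0 v + A v y0, A v v:] t"
      "q (y0 + t *\<^sub>R v) (y0 + t *\<^sub>R v) = poly [:q y0 y0, q y0 v + q v y0, q v v:] t"
      using assms(1-4) by (simp_all add: linear_add linear_cmul bilinear_ladd bilinear_radd bilinear_lmul bilinear_rmul algebra_simps)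
    show ?thesis unfolding e P_def by (simp only: poly_diff poly_smult poly_mult mult.assoc)
  qed
  obtain e where e: "e > 0" "\<And>t. \<bar>t\<bar> < e \<Longrightarrow> y0 + t *\<^sub>R v \<in> S" using line_in_open[OF S, of v] by blast
  have "{-e<..<e} \<subseteq> {t. poly P t = 0}"
    using e(2) id by (auto simp: P abs_less_iff)
  moreover have "infinite {-e<..<e}" using e(1) by (simp add: infinite_Ioo)
  ultimately have "P = 0" using poly_roots_finite[of P] finite_subset by blast
  then have "poly P 1 = 0" by simp
  then show ?thesis by (simp only: P) (simp add: v_def)
qed

lemma cubic_coefficients_zero:
  assumes "\<And>t::real. c0 + c1 * t + c2 * (t * t) + c3 * (t * t * t) = 0"
  shows "c0 = 0 \<and> c1 = 0 \<and> c2 = 0 \<and> c3 = 0"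
  using assms[of 0] assms[of 1] assms[of "-1"] assms[of 2] by simp

text \<open>A nondegenerate quadratic form with \<open>\<beta>\<close> nonnull is not divisible by \<open>\<beta>\<close>, so the linear form
  \<open>c\<close> has to be.\<close>

lemma cubic_identity_factor:
  fixes \<beta> c :: "'a::real_vector \<Rightarrow> real" and A q :: "'a \<Rightarrow> 'a \<Rightarrow> real"
  assumes l: "linear \<beta>" "linear c" "bilinear A" "bilinear q"
    and sym: "\<And>v w. A v w = A w v" "\<And>v w. q v w = q w v"
    and B: "\<And>v. q v B = \<beta> v" "\<beta> B \<noteq> 0" and nondeg: "\<And>v. (\<And>w. q v w = 0) \<Longrightarrow> v = 0"
    and pr: "p \<noteq> 0" "r \<noteq> 0"
    and id: "\<And>y. p * \<beta> y * A y y = r * q y y * c y"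
  obtains \<mu> where "\<And>v. c v = p * \<mu> * \<beta> v" "\<And>v w. A v w = r * \<mu> * q v w"
proof -
  define s where "s = \<beta> B"
  \<comment> \<open>The value that the conclusion \<open>c v = p * \<mu> * \<beta> v\<close> forces
    at v = \<open>B\<close>.\<close>
  define \<mu> where "\<mu> = c B / (p * s)"
  have s: "s \<noteq> 0" using B by (simp add: s_def)
  have cB: "c B = p * \<mu> * s" using pr s by (simp add: \<mu>_def)
  note la = linear_add[OF l(1)] linear_add[OF l(2)] linear_cmul[OF l(1)] linear_cmul[OF l(2)]
    bilinear_ladd[OF l(3)] bilinear_radd[OF l(3)] bilinear_lmul[OF l(3)] bilinear_rmul[OF l(3)]
    bilinear_ladd[OF l(4)] bilinear_radd[OF l(4)] bilinear_lmul[OF l(4)] bilinear_rmul[OF l(4)]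
  \<comment> \<open>Coefficients in t of the identity at v + t B. For v in the kernel of \<beta> the
    cross term q(v, B) vanishes and \<beta> becomes s t, which leaves four separate
    equations.\<close>
  have coeffs: "q v v * c v = 0 \<and> p * s * A v v = r * q v v * c B \<and> 2 * p * s * A v B = r * s * c v \<and> p * A B B = r * c B"
    if v: "\<beta> v = 0" for v
  proof -
    have "r * q v v * c v + (r * q v v * c B - p * s * A v v) * t
        + (r * s * c v - 2 * p * s * A v B) * (t * t) + (r * s * c B - p * s * A B B) * (t * t * t) = 0" for t
      using id[of "v + t *\<^sub>R B"] by (simp add: la v B(1) sym(1)[of B v] sym(2)[of B v] algebra_simps flip: s_def)
    from cubic_coefficients_zero[OF this] show ?thesis using pr s by simp
  qed
  \<comment> \<open>On the kernel of \<beta> the product q(v, v) c(v) vanishes identically. If c(v)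
    were nonzero, polarising would make v orthogonal to the whole kernel; being orthogonal to B as
    well, v would lie in the radical of q.\<close>
  have c0: "c v = 0" if v: "\<beta> v = 0" for v
  proof (rule ccontr)
    assume cv: "c v \<noteq> 0"
    have "q v w = 0" if w: "\<beta> w = 0" for w
    proof -
      have "q v v * c v + (2 * q v w * c v + q v v * c w) * t + (q w w * c v + 2 * q v w * c w) * (t * t) + (q w w * c w) * (t * t * t) = 0" for t
      proof -
        have "\<beta> (v + t *\<^sub>R w) = 0" using v w by (simp add: la)
        then have "q (v + t *\<^sub>R w) (v + t *\<^sub>R w) * c (v + t *\<^sub>R w) = 0" using coeffs by blast
        then show ?thesis by (simp add: la sym(2)[of w v] algebra_simps)
      qed
      from cubic_coefficients_zero[OF this] have "q v v * c v = 0" "2 * q v w * c v + q v v * c w = 0" by auto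
      then show ?thesis using cv by auto
    qed
    then have "q v (u - (\<beta> u / s) *\<^sub>R B) = 0" for u
      using s by (simp add: linear_diff[OF l(1)] la s_def)
    then have "q v u = 0" for u by (simp add: bilinear_rsub[OF l(4)] la B(1) v)
    then have "v = 0" by (rule nondeg)
    then show False using cv linear_0[OF l(2)] by simp
  qed
  have split: "y = (y - (\<beta> y / s) *\<^sub>R B) + (\<beta> y / s) *\<^sub>R B" "\<beta> (y - (\<beta> y / s) *\<^sub>R B) = 0" for y
    using s by (simp_all add: linear_diff[OF l(1)] la s_def)
  have A0: "A v v = r * \<mu> * q v v" "A v B = 0" "A B B = r * \<mu> * s" if v: "\<beta> v = 0" for v
    using coeffs[OF v] c0[OF v] pr s cB by (auto simp: field_simps)
  show thesis
  proof
    show cv: "c v = p * \<mu> * \<beta> v" for v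
    proof -
      have "c v = c (v - (\<beta> v / s) *\<^sub>R B) + (\<beta> v / s) * c B"
        using arg_cong[OF split(1)[of v], of c] by (simp only: la real_scaleR_def)
      then show ?thesis using c0[OF split(2)] cB s by simp
    qed
    have diag: "A v v = r * \<mu> * q v v" for v
    proof -
      define u where "u = v - (\<beta> v / s) *\<^sub>R B"
      define t where "t = \<beta> v / s"
      have u: "\<beta> u = 0" "v = u + t *\<^sub>R B" using split[of v] by (simp_all add: u_def t_def)
      show ?thesis
        using A0[OF u(1)] u(1) by (simp add: u(2) la B(1) sym(1)[of B u] sym(2)[of B u] flip: s_def) (simp add: algebra_simps)
    qed
    show "A v w = r * \<mu> * q v w" for v w
    proof -
      have "A (v + w) (v + w) = A v v + 2 * A v w + A w w" "q (v + w) (v + w) = q v v + 2 * q v w + q w w"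
        by (simp_all add: la sym(1)[of w v] sym(2)[of w v])
      then show ?thesis using diag[of "v + w"] diag[of v] diag[of w] by (simp add: algebra_simps)
    qed
  qed
qed

section \<open>Derivatives and scaling of the powers in a Kropina function\<close>

lemma abs_powr_derivative:
  assumes "t \<noteq> 0"
  shows "((\<lambda>t. \<bar>t\<bar> powr p) has_real_derivative p * \<bar>t\<bar> powr p / t) (at t)"
proof (cases "t > 0")
  case True
  have "((\<lambda>t. t powr p) has_real_derivative p * \<bar>t\<bar> powr p / t) (at t)"
    using True by (auto intro!: derivative_eq_intros simp: powr_diff)
  then show ?thesis
    by (rule has_field_derivative_transform_within_open[of _ _ _ "{0<..}"]) (use True in auto)
next
  case False
  then have "t < 0" using assms by simp
  then have "((\<lambda>t. (- t) powr p) has_real_derivative p * \<bar>t\<bar> powr p / t) (at t)"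
    by (auto intro!: derivative_eq_intros simp: powr_diff field_simps)
  then show ?thesis
    by (rule has_field_derivative_transform_within_open[of _ _ _ "{..<0}"]) (use \<open>t < 0\<close> in auto)
qed

lemma fd_abs_powr:
  fixes h :: "'a::real_normed_vector \<Rightarrow> real"
  assumes "h z \<noteq> 0" "h differentiable at z"
  shows "((\<lambda>z. \<bar>h z\<bar> powr p) has_derivative (\<lambda>w. p * \<bar>h z\<bar> powr p / h z * fd h z w)) (at z)"
  using diff_chain_at[OF fd_works[OF assms(2)] abs_powr_derivative[OF assms(1), of p, unfolded has_field_derivative_def]]
  by (simp add: o_def)

text \<open>A negative base occurs with integer exponents only, and there squaring removes the
  sign.\<close>

lemma real_power_square:
  assumes "t \<noteq> 0" "t > 0 \<or> m \<in> \<int>"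
  shows "(real_power t (- m))\<^sup>2 = \<bar>t\<bar> powr (- 2 * m)"
proof (cases "t > 0")
  case True
  then show ?thesis by (simp add: real_power_eq_powr power2_eq_square flip: powr_add)
next
  case False
  then obtain k where k: "m = of_int k" using assms by (auto elim: Ints_cases)
  have "real_power t (- m) = t powi (- k)" using k by (simp add: real_power_def)
  then have "(real_power t (- m))\<^sup>2 = \<bar>t\<bar> powi (- k) * \<bar>t\<bar> powi (- k)"
    by (metis power_int_abs abs_mult_self_eq power2_eq_square)
  also have "\<bar>t\<bar> powi (- k) = \<bar>t\<bar> powr (- m)" using assms(1) k powr_real_of_int'[of "\<bar>t\<bar>" "- k"] by simp
  finally show ?thesis by (simp flip: powr_add)
qed

lemma real_power_scale:
  assumes "k > 0" "t \<noteq> 0" "t > 0 \<or> m \<in> \<int>"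
  shows "real_power (k * t) (- m) = k powr (- m) * real_power t (- m)"
proof (cases "m \<in> \<int>")
  case True
  then obtain j where "m = of_int j" by (auto elim: Ints_cases)
  then show ?thesis using assms(1) powr_real_of_int'[of k "-j"] by (simp add: real_power_def power_int_mult_distrib)
next
  case False
  then show ?thesis using assms by (simp add: real_power_def powr_mult)
qed

section \<open>Kropina functions of Berwald type\<close>

text \<open>G packages the Berwald coefficients, of which no smoothness in x is known at this stage.
  Since \<Omega> projects onto U, every base point carries an admissible direction; this is what
  transfers identities from the fibres to the base.\<close>

locale kropina_chart = finsler_chart f \<Omega>
  for f :: "(real ^ 4) \<times> (real ^ 4) \<Rightarrow> real" and \<Omega> +
  fixes U :: "(real ^ 4) set" and a :: "real ^ 4 \<Rightarrow> real ^ 4 ^ 4" and b :: "real ^ 4 \<Rightarrow> real ^ 4" and m :: real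
    and G :: "real ^ 4 \<Rightarrow> real ^ 4 \<Rightarrow> real ^ 4 \<Rightarrow> real ^ 4"
  assumes U: "open U" "fst ` \<Omega> = U" and smooth_a: "smooth_on U a" and smooth_b: "smooth_on U b"
    and a_sym: "\<And>x. x \<in> U \<Longrightarrow> transpose (a x) = a x"
    and a_lorentz: "\<And>x. x \<in> U \<Longrightarrow> \<exists>P. invertible P \<and> transpose P ** a x ** P = minkowski"
    and nonnull: "\<And>x. x \<in> U \<Longrightarrow> b x \<bullet> (matrix_inv (a x) *v b x) \<noteq> 0"
    and m: "m \<noteq> 0"
    and kropina: "\<And>x y. (x, y) \<in> \<Omega> \<Longrightarrow> kropina_domain m (y \<bullet> (a x *v y)) (b x \<bullet> y) \<and>
      f (x, y) = sqrt \<bar>y \<bullet> (a x *v y)\<bar> powr (1 + m) * real_power (b x \<bullet> y) (- m)"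
    and G: "\<And>x. bilinear (G x)"
    and N: "\<And>x y k i. (x, y) \<in> \<Omega> \<Longrightarrow> nonlinear_connection f k i (x, y) = G x (axis i 1) y $ k"
begin

abbreviation q :: "(real ^ 4) \<times> (real ^ 4) \<Rightarrow> real" where "q z \<equiv> snd z \<bullet> (a (fst z) *v snd z)"
abbreviation \<beta> :: "(real ^ 4) \<times> (real ^ 4) \<Rightarrow> real" where "\<beta> z \<equiv> b (fst z) \<bullet> snd z"

lemma fst_in: "(x, y) \<in> \<Omega> \<Longrightarrow> x \<in> U"
  using U(2) by force

lemma G_spray: "(x, y) \<in> \<Omega> \<Longrightarrow> spray k (x, y) = 2 * G x y y $ k"
  by (rule connection_imp_spray(1)[of G, OF G]) (auto intro: N)

lemma G_sym: "x \<in> U \<Longrightarrow> G x u v = G x v u"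
proof -
  assume "x \<in> U"
  then obtain y where y: "(x, y) \<in> \<Omega>" using U(2) by auto
  show ?thesis by (rule connection_imp_spray(2)[of G, OF G _ y]) (rule N)
qed

lemma a_invertible: "x \<in> U \<Longrightarrow> invertible (a x)"
  using a_lorentz lorentzian_invertible by blast

lemma domain: "z \<in> \<Omega> \<Longrightarrow> q z \<noteq> 0" "z \<in> \<Omega> \<Longrightarrow> \<beta> z \<noteq> 0" "z \<in> \<Omega> \<Longrightarrow> \<beta> z > 0 \<or> m \<in> \<int>"
  using kropina[of "fst z" "snd z"] by (auto simp: kropina_domain_def)

text \<open>Squaring replaces \<open>real_power\<close> by a power of |\<beta>|, so that one
  differentiation rule serves both signs of \<beta>.\<close>

lemma L_kropina:
  assumes z: "z \<in> \<Omega>"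
  shows "L z = \<bar>q z\<bar> powr (1 + m) * \<bar>\<beta> z\<bar> powr (- 2 * m)"
proof -
  have "f z = sqrt \<bar>q z\<bar> powr (1 + m) * real_power (\<beta> z) (- m)"
    using kropina[of "fst z" "snd z"] z by simp
  moreover have "(sqrt \<bar>q z\<bar> powr (1 + m))\<^sup>2 = \<bar>q z\<bar> powr (1 + m)"
    by (simp add: powr_half_sqrt[symmetric] powr_powr power2_eq_square flip: powr_add)
  ultimately show ?thesis
    using real_power_square[OF domain(2)[OF z] domain(3)[OF z]] by (simp add: L_def power_mult_distrib)
qed

lemma compose_fst:
  assumes "(\<phi> has_derivative \<phi>') (at x)"
  shows "((\<lambda>z. \<phi> (fst z)) has_derivative (\<lambda>h. \<phi>' (fst h))) (at (x, y))"
proof -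
  have 1: "(fst has_derivative fst) (at (x, y))" by (rule has_derivative_fst[OF has_derivative_ident])
  have 2: "(\<phi> has_derivative \<phi>') (at (fst (x, y)))" using assms by simp
  show ?thesis using diff_chain_at[OF 1 2] by (simp add: o_def)
qed

lemma q_derivative:
  assumes x: "x \<in> U"
  shows "(q has_derivative (\<lambda>h. 2 * (snd h \<bullet> (a x *v y)) + y \<bullet> (fd a x (fst h) *v y))) (at (x, y))"
proof -
  have s: "(snd has_derivative snd) (at (x, y))" by (rule has_derivative_snd[OF has_derivative_ident])
  have "(q has_derivative (\<lambda>h. snd (x, y) \<bullet> (a (fst (x, y)) *v snd h + fd a x (fst h) *v snd (x, y)) + snd h \<bullet> (a (fst (x, y)) *v snd (x, y)))) (at (x, y))"
    by (intro has_derivative_inner bounded_bilinear.FDERIV[OF bounded_bilinear_matrix_vector] s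
        compose_fst smooth_on_has_derivative[OF smooth_a x])
  then show ?thesis
    by (rule has_derivative_eq_rhs)
      (simp add: fun_eq_iff inner_add_right inner_matrix_symmetric[OF a_sym[OF x], of y])
qed

lemma \<beta>_derivative:
  assumes x: "x \<in> U"
  shows "(\<beta> has_derivative (\<lambda>h. b x \<bullet> snd h + fd b x (fst h) \<bullet> y)) (at (x, y))"
proof -
  have s: "(snd has_derivative snd) (at (x, y))" by (rule has_derivative_snd[OF has_derivative_ident])
  have "(\<beta> has_derivative (\<lambda>h. b (fst (x, y)) \<bullet> snd h + fd b x (fst h) \<bullet> snd (x, y))) (at (x, y))"
    by (intro has_derivative_inner s compose_fst smooth_on_has_derivative[OF smooth_b x])
  then show ?thesis by simp
qed

text \<open>Logarithmic differentiation: after division by \<open>L\<close> only the quotients dq /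
  q and d\<beta> / \<beta> remain, which is what makes invariance a polynomial condition in
  y.\<close>

lemma fd_L_kropina:
  assumes z: "(x, y) \<in> \<Omega>"
  shows "fd L (x, y) w = L (x, y) * ((1 + m) * fd q (x, y) w / q (x, y) - 2 * m * fd \<beta> (x, y) w / \<beta> (x, y))"
proof -
  have x: "x \<in> U" by (rule fst_in[OF z])
  have dq: "q differentiable at (x, y)" and d\<beta>: "\<beta> differentiable at (x, y)"
    using q_derivative[OF x] \<beta>_derivative[OF x] unfolding differentiable_def by blast+
  have "fd L (x, y) = fd (\<lambda>z. \<bar>q z\<bar> powr (1 + m) * \<bar>\<beta> z\<bar> powr (- 2 * m)) (x, y)"
    by (rule fd_cong_open[OF open_\<Omega> z]) (rule L_kropina)
  also have "\<dots> = (\<lambda>w. \<bar>q (x, y)\<bar> powr (1 + m) * ((- 2 * m) * \<bar>\<beta> (x, y)\<bar> powr (- 2 * m) / \<beta> (x, y) * fd \<beta> (x, y) w)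
      + ((1 + m) * \<bar>q (x, y)\<bar> powr (1 + m) / q (x, y) * fd q (x, y) w) * \<bar>\<beta> (x, y)\<bar> powr (- 2 * m))"
    by (intro fd_eq has_derivative_mult fd_abs_powr domain(1,2)[OF z] dq d\<beta>)
  finally show ?thesis
    unfolding L_kropina[OF z] by (simp add: algebra_simps)
qed

lemma L_nonzero: "z \<in> \<Omega> \<Longrightarrow> L z \<noteq> 0"
  using domain by (simp add: L_kropina)

text \<open>For \<open>m = -1\<close> the fundamental tensor would be \<open>b\<^sub>i b\<^sub>j\<close>, which is singular.\<close>

lemma m_neq_minus_one: "1 + m \<noteq> 0" if \<Omega>: "\<Omega> \<noteq> {}"
proof
  assume m1: "1 + m = 0"
  obtain x y where z: "(x, y) \<in> \<Omega>" using \<Omega> by auto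
  have x: "x \<in> U" by (rule fst_in[OF z])
  have L: "L w = \<beta> w * \<beta> w" if "w \<in> \<Omega>" for w
    using L_kropina[OF that] domain[OF that] m1 by (simp add: eq_neg_iff_add_eq_0[symmetric] powr_numeral power2_eq_square add.commute)
  have 1: "fd L (x, y) (0, v) = 2 * (b x \<bullet> y) * (b x \<bullet> v)" if z: "(x, y) \<in> \<Omega>" for y v
  proof -
    have "fd L (x, y) = fd (\<lambda>w. \<beta> w * \<beta> w) (x, y)" by (rule fd_cong_open[OF open_\<Omega> z]) (rule L)
    also have "\<dots> = (\<lambda>h. \<beta> (x, y) * (b x \<bullet> snd h + fd b x (fst h) \<bullet> y) + (b x \<bullet> snd h + fd b x (fst h) \<bullet> y) * \<beta> (x, y))"
      by (intro fd_eq has_derivative_mult \<beta>_derivative x)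
    finally show ?thesis
      using linear_0[OF has_derivative_linear[OF smooth_on_has_derivative[OF smooth_b x]]] by simp
  qed
  have 2: "fd (\<lambda>z. fd L z (0, v)) (x, y) (0, u) = 2 * (b x \<bullet> u) * (b x \<bullet> v)" for u v
  proof (rule fd_eq_line_derivative[OF open_\<Omega> z differentiable_fd_L[OF z]])
    show "fd L ((x, y) + t *\<^sub>R (0, u)) (0, v) = 2 * (b x \<bullet> y + t * (b x \<bullet> u)) * (b x \<bullet> v)"
      if "(x, y) + t *\<^sub>R (0, u) \<in> \<Omega>" for t
      using 1 that by (simp add: inner_add_right)
    show "((\<lambda>t. 2 * (b x \<bullet> y + t * (b x \<bullet> u)) * (b x \<bullet> v)) has_real_derivative 2 * (b x \<bullet> u) * (b x \<bullet> v)) (at 0)"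
      by (auto intro!: derivative_eq_intros)
  qed
  \<comment> \<open>A nonzero vector in the kernel of b exists already within the first two
    coordinates; it witnesses the degeneracy.\<close>
  obtain v where v: "v \<noteq> 0" "b x \<bullet> v = 0"
  proof (cases "b x $ 1 = 0")
    case True
    then show ?thesis using that[of "axis 1 1"] by (simp add: inner_axis)
  next
    case False
    let ?v = "b x $ 2 *\<^sub>R axis 1 1 - b x $ 1 *\<^sub>R axis 2 1 :: real ^ 4"
    have "?v $ 2 \<noteq> 0" using False by (simp add: axis_def)
    then have "?v \<noteq> 0" by (metis zero_index)
    moreover have "b x \<bullet> ?v = 0" by (simp add: inner_diff_right inner_axis)
    ultimately show ?thesis using that by blast
  qed
  have "(fundamental_tensor f (x, y) *v v) $ i = 0" for i
  proof -
    have "(fundamental_tensor f (x, y) *v v) $ i = (\<Sum>j\<in>UNIV. (b x \<bullet> axis i 1) * (b x $ j * v $ j))"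
      by (simp add: matrix_vector_mult_def fundamental_tensor_L[OF z] 2 inner_axis mult.assoc)
    also have "\<dots> = (b x \<bullet> axis i 1) * (b x \<bullet> v)" by (simp add: inner_vec_def[of "b x" v] sum_distrib_left)
    finally show ?thesis by (simp add: v)
  qed
  then have "matrix_inv (fundamental_tensor f (x, y)) *v (fundamental_tensor f (x, y) *v v) = 0"
    by (simp add: vec_eq_iff matrix_vector_mult_def)
  then show False
    using v(1) by (simp add: matrix_vector_mul_assoc matrix_inv_left[OF nondegenerate[OF z]])
qed

text \<open>Invariance of \<open>L\<close>, multiplied by q and \<beta>, is a cubic identity in y
  between the covariant derivatives of a and b along h. The factor \<mu> depends on x and h: it is
  the component along h of the recurrence 1-form.\<close>

lemma recurrent:
  assumes x: "x \<in> U"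
  obtains \<mu> where "\<And>v. fd b x h \<bullet> v - b x \<bullet> G x h v = (1 + m) * \<mu> * (b x \<bullet> v)"
    "\<And>v w. v \<bullet> (fd a x h *v w) - G x h v \<bullet> (a x *v w) - v \<bullet> (a x *v G x h w) = 2 * m * \<mu> * (v \<bullet> (a x *v w))"
proof -
  obtain y0 where y0: "(x, y0) \<in> \<Omega>" using x U(2) by auto
  \<comment> \<open>For the connection G, \<open>A\<close> is the covariant derivative of a along h
    and \<open>c\<close> that of b.\<close>
  define A where "A v w = v \<bullet> (fd a x h *v w) - G x h v \<bullet> (a x *v w) - v \<bullet> (a x *v G x h w)" for v w
  define Q where "Q v w = v \<bullet> (a x *v w)" for v w
  define c where "c v = fd b x h \<bullet> v - b x \<bullet> G x h v" for v
  have lG: "linear (G x h)" using G by (simp add: bilinear_def)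
  note sym = inner_matrix_symmetric[OF a_sym[OF x]]
  have a'_sym: "transpose (fd a x h) = fd a x h"
  proof -
    have bl: "bounded_linear (transpose :: real ^ 4 ^ 4 \<Rightarrow> real ^ 4 ^ 4)"
      using linear_transpose by (simp add: linear_conv_bounded_linear)
    have "fd (\<lambda>x. transpose (a x)) x = fd a x" by (rule fd_cong_open[OF U(1) x]) (rule a_sym)
    then show ?thesis
      using fd_eq[OF bounded_linear.has_derivative[OF bl smooth_on_has_derivative[OF smooth_a x]]] by metis
  qed
  have bil: "bilinear A" "bilinear Q"
    unfolding bilinear_def A_def Q_def
    by (auto intro!: linearI simp: linear_add[OF lG] linear_cmul[OF lG] matrix_vector_right_distrib
        matrix_vector_mult_scaleR inner_add_left inner_add_right algebra_simps)
  have lin: "linear (\<lambda>v. b x \<bullet> v)" "linear c"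
    by (auto intro!: linearI simp: c_def linear_add[OF lG] linear_cmul[OF lG] inner_add_right algebra_simps)
  have id: "(1 + m) * (b x \<bullet> y) * A y y = 2 * m * Q y y * c y" if "y \<in> (\<lambda>y. (x, y)) -` \<Omega>" for y
  proof -
    have z: "(x, y) \<in> \<Omega>" using that by simp
    have fq: "fd q (x, y) w = 2 * (snd w \<bullet> (a x *v y)) + y \<bullet> (fd a x (fst w) *v y)"
      and f\<beta>: "fd \<beta> (x, y) w = b x \<bullet> snd w + fd b x (fst w) \<bullet> y" for w
      by (simp_all only: fd_eq[OF q_derivative[OF x]] fd_eq[OF \<beta>_derivative[OF x]])
    have 0: "fd a x 0 = 0" "fd b x 0 = 0"
      using linear_0[OF has_derivative_linear[OF smooth_on_has_derivative[OF smooth_a x]]]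
        linear_0[OF has_derivative_linear[OF smooth_on_has_derivative[OF smooth_b x]]] by auto
    have "fd L (x, y) (h, 0) = fd L (x, y) (0, G x h y)"
      by (rule spray_imp_invariant[of G, OF G G_sym[OF x] G_spray z])
    then have "(1 + m) * fd q (x, y) (h, 0) / q (x, y) - 2 * m * fd \<beta> (x, y) (h, 0) / \<beta> (x, y)
      = (1 + m) * fd q (x, y) (0, G x h y) / q (x, y) - 2 * m * fd \<beta> (x, y) (0, G x h y) / \<beta> (x, y)"
      unfolding fd_L_kropina[OF z] using L_nonzero[OF z] mult_left_cancel by blast
    then have "(1 + m) * (fd q (x, y) (h, 0) - fd q (x, y) (0, G x h y)) * \<beta> (x, y)
        = 2 * m * (fd \<beta> (x, y) (h, 0) - fd \<beta> (x, y) (0, G x h y)) * q (x, y)"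
      using domain(1,2)[OF z] by (simp add: field_simps)
    moreover have "fd q (x, y) (h, 0) - fd q (x, y) (0, G x h y) = A y y"
      unfolding fq by (simp add: A_def 0 sym[of y "G x h y"])
    moreover have "fd \<beta> (x, y) (h, 0) - fd \<beta> (x, y) (0, G x h y) = c y"
      unfolding f\<beta> by (simp add: c_def 0)
    ultimately show ?thesis by (simp add: Q_def ac_simps)
  qed
  have id': "(1 + m) * (b x \<bullet> y) * A y y = 2 * m * Q y y * c y" for y
    by (rule cubic_identity_extends[where S = "(\<lambda>y. (x, y)) -` \<Omega>" and ?y0.0 = y0, OF lin bil])
      (use y0 id open_\<Omega> in \<open>auto intro!: open_vimage continuous_intros\<close>)
  define B where "B = matrix_inv (a x) *v b x"
  have aB: "a x *v B = b x"
    by (simp add: B_def matrix_vector_mul_assoc matrix_inv_right a_invertible[OF x])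
  obtain \<mu> where \<mu>: "\<And>v. c v = (1 + m) * \<mu> * (b x \<bullet> v)" "\<And>v w. A v w = 2 * m * \<mu> * Q v w"
  proof (rule cubic_identity_factor[OF lin bil _ _ _ _ _ _ _ id', of B])
    show "A v w = A w v" for v w
      using sym[of v "G x h w"] sym[of "G x h v" w] inner_matrix_symmetric[OF a'_sym, of v w] by (simp add: A_def)
    show "Q v w = Q w v" for v w by (simp add: Q_def sym)
    show "Q v B = b x \<bullet> v" for v by (simp add: Q_def aB inner_commute)
    show "b x \<bullet> B \<noteq> 0" using nonnull[OF x] by (simp add: B_def)
    show "v = 0" if "\<And>w. Q v w = 0" for v
    proof -
      have "w \<bullet> (a x *v v) = 0" for w using that[of w] sym[of v w] by (simp add: Q_def)
      then have "a x *v v = 0" by (metis inner_eq_zero_iff)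
      then have "matrix_inv (a x) *v (a x *v v) = 0" by simp
      then show ?thesis by (simp add: matrix_vector_mul_assoc matrix_inv_left a_invertible[OF x])
    qed
    show "1 + m \<noteq> 0" using m_neq_minus_one y0 by blast
    show "2 * m \<noteq> 0" using m by simp
  qed blast
  show thesis by (rule that[of \<mu>, OF \<mu>[unfolded A_def Q_def c_def]])
qed

section \<open>Rescaling by powers of the norm of b\<close>

definition s :: "real ^ 4 \<Rightarrow> real" where "s x = b x \<bullet> (matrix_inv (a x) *v b x)"

lemma s_nonzero: "x \<in> U \<Longrightarrow> s x \<noteq> 0"
  using nonnull by (simp add: s_def)

lemma smooth_raised: "smooth_on U (\<lambda>x. matrix_inv (a x) *v b x)"
  by (intro smooth_on_bilinear[OF bounded_bilinear_matrix_vector] smooth_on_matrix_inv U smooth_a smooth_b a_invertible)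

lemma smooth_s: "smooth_on U s"
  unfolding s_def[abs_def] by (intro smooth_on_inner U smooth_b smooth_raised)

text \<open>The two factors b contribute 2 (1 + m) \<mu> and the inverse metric -2 m \<mu>, in total
  2 \<mu>. The derivative of the raised covector B is obtained by differentiating a B = b instead of
  the matrix inverse.\<close>

lemma s_derivative:
  assumes x: "x \<in> U"
    and rb: "\<And>v. fd b x h \<bullet> v - b x \<bullet> G x h v = (1 + m) * \<mu> * (b x \<bullet> v)"
    and ra: "\<And>v w. v \<bullet> (fd a x h *v w) - G x h v \<bullet> (a x *v w) - v \<bullet> (a x *v G x h w) = 2 * m * \<mu> * (v \<bullet> (a x *v w))"
  shows "fd s x h = 2 * \<mu> * s x"
proof -
  define B where "B x = matrix_inv (a x) *v b x" for x
  have aB: "a x *v B x = b x" if "x \<in> U" for x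
    by (simp add: B_def matrix_vector_mul_assoc matrix_inv_right a_invertible[OF that])
  have sB: "s x = b x \<bullet> B x" by (simp add: s_def B_def)
  note asym = inner_matrix_symmetric[OF a_sym[OF x]]
  have dB: "(B has_derivative fd B x) (at x)"
    unfolding B_def by (rule smooth_on_has_derivative[OF smooth_raised x])
  have "fd (\<lambda>x. a x *v B x) x = fd b x" by (rule fd_cong_open[OF U(1) x]) (rule aB)
  moreover have "fd (\<lambda>x. a x *v B x) x = (\<lambda>h. a x *v fd B x h + fd a x h *v B x)"
    by (intro fd_eq bounded_bilinear.FDERIV[OF bounded_bilinear_matrix_vector] dB smooth_on_has_derivative[OF smooth_a x])
  ultimately have "fd b x = (\<lambda>h. a x *v fd B x h + fd a x h *v B x)" by (rule trans[OF sym])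
  from fun_cong[OF this, of h] have 1: "a x *v fd B x h = fd b x h - fd a x h *v B x" by simp
  have "fd s x h = b x \<bullet> fd B x h + fd b x h \<bullet> B x"
  proof -
    have "s = (\<lambda>x. b x \<bullet> B x)" by (simp add: s_def B_def fun_eq_iff)
    then show ?thesis
      using fd_eq[OF has_derivative_inner[OF smooth_on_has_derivative[OF smooth_b x] dB]] by simp
  qed
  also have "b x \<bullet> fd B x h = B x \<bullet> (a x *v fd B x h)"
    using asym[of "B x" "fd B x h"] by (simp add: aB[OF x] inner_commute)
  also have "\<dots> = fd b x h \<bullet> B x - B x \<bullet> (fd a x h *v B x)"
    by (simp add: 1 inner_diff_right inner_commute)
  finally have "fd s x h = 2 * (fd b x h \<bullet> B x) - B x \<bullet> (fd a x h *v B x)" by simp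
  moreover have "fd b x h \<bullet> B x = b x \<bullet> G x h (B x) + (1 + m) * \<mu> * s x"
    using rb[of "B x"] by (simp add: s_def B_def)
  moreover have "B x \<bullet> (fd a x h *v B x) = 2 * (b x \<bullet> G x h (B x)) + 2 * m * \<mu> * s x"
    using ra[of "B x" "B x"] asym[of "B x" "G x h (B x)"] by (simp add: aB[OF x] inner_commute sB)
  ultimately show ?thesis by (simp add: algebra_simps)
qed

text \<open>Both rescalings are by powers of \<open>|b|\<^sup>2\<close>, chosen so that the rescaled fields are parallel for
  the affine connection of \<open>F\<close> while \<open>F\<close> itself is unchanged.\<close>

definition g :: "real ^ 4 \<Rightarrow> real ^ 4 ^ 4" where "g x = \<bar>s x\<bar> powr (- m) *\<^sub>R a x"

definition \<kappa> :: "real ^ 4 \<Rightarrow> real ^ 4" where "\<kappa> x = \<bar>s x\<bar> powr (- (1 + m) / 2) *\<^sub>R b x"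

lemma s_powr_derivative:
  assumes "x \<in> U"
  shows "((\<lambda>x. \<bar>s x\<bar> powr p) has_derivative (\<lambda>h. p * \<bar>s x\<bar> powr p / s x * fd s x h)) (at x)"
  by (intro fd_abs_powr s_nonzero smooth_on_differentiable[OF smooth_s] assms)

text \<open>Since ds = 2 \<mu> s, the factor |s|^p changes at the rate 2 p \<mu>. This cancels the
  rates 2 m \<mu> of a and (1 + m) \<mu> of b for the exponents -m and -(1 + m)/2.\<close>

lemma parallel_structure_g: "parallel_structure U g \<kappa> G"
proof
  show "open U" by (rule U)
  show "smooth_on U g" "smooth_on U \<kappa>"
    unfolding g_def[abs_def] \<kappa>_def[abs_def]
    by (intro smooth_on_scaleR smooth_on_abs_powr smooth_s s_nonzero smooth_a smooth_b U; assumption)+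
  show "bilinear (G x)" for x by (rule G)
next
  fix x assume x: "x \<in> U"
  show "transpose (g x) = g x" by (simp add: g_def transpose_scalar a_sym[OF x])
  show "G x u v = G x v u" for u v by (rule G_sym[OF x])
  have s0: "\<bar>s x\<bar> > 0" using s_nonzero[OF x] by simp
  show "v \<bullet> (fd g x h *v w) = G x h v \<bullet> (g x *v w) + v \<bullet> (g x *v G x h w)" for h v w
  proof -
    obtain \<mu> where rb: "\<And>v. fd b x h \<bullet> v - b x \<bullet> G x h v = (1 + m) * \<mu> * (b x \<bullet> v)"
      and ra: "\<And>v w. v \<bullet> (fd a x h *v w) - G x h v \<bullet> (a x *v w) - v \<bullet> (a x *v G x h w) = 2 * m * \<mu> * (v \<bullet> (a x *v w))"
      using recurrent[OF x] by blast
    have "fd g x = (\<lambda>h. \<bar>s x\<bar> powr (- m) *\<^sub>R fd a x h + (- m * \<bar>s x\<bar> powr (- m) / s x * fd s x h) *\<^sub>R a x)"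
      unfolding g_def[abs_def]
      by (intro fd_eq has_derivative_scaleR s_powr_derivative x smooth_on_has_derivative[OF smooth_a x])
    then have "fd g x h = \<bar>s x\<bar> powr (- m) *\<^sub>R (fd a x h - (2 * m * \<mu>) *\<^sub>R a x)"
      using s_nonzero[OF x] by (simp add: s_derivative[OF x rb ra] scaleR_diff_right mult.assoc)
    then have "v \<bullet> (fd g x h *v w) = \<bar>s x\<bar> powr (- m) * (v \<bullet> (fd a x h *v w) - 2 * m * \<mu> * (v \<bullet> (a x *v w)))"
      by (simp add: matrix_vector_mult_diff_rdistrib inner_diff_right flip: scaleR_matrix_vector_assoc)
    also have "\<dots> = \<bar>s x\<bar> powr (- m) * (G x h v \<bullet> (a x *v w) + v \<bullet> (a x *v G x h w))"
      using ra[of v w] by simp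
    finally show ?thesis by (simp add: g_def distrib_left flip: scaleR_matrix_vector_assoc)
  qed
  show "fd \<kappa> x h \<bullet> v = \<kappa> x \<bullet> G x h v" for h v
  proof -
    obtain \<mu> where rb: "\<And>v. fd b x h \<bullet> v - b x \<bullet> G x h v = (1 + m) * \<mu> * (b x \<bullet> v)"
      and ra: "\<And>v w. v \<bullet> (fd a x h *v w) - G x h v \<bullet> (a x *v w) - v \<bullet> (a x *v G x h w) = 2 * m * \<mu> * (v \<bullet> (a x *v w))"
      using recurrent[OF x] by blast
    have "fd \<kappa> x = (\<lambda>h. \<bar>s x\<bar> powr (- (1 + m) / 2) *\<^sub>R fd b x h
        + (- (1 + m) / 2 * \<bar>s x\<bar> powr (- (1 + m) / 2) / s x * fd s x h) *\<^sub>R b x)"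
      unfolding \<kappa>_def[abs_def]
      by (intro fd_eq has_derivative_scaleR s_powr_derivative x smooth_on_has_derivative[OF smooth_b x])
    then have "fd \<kappa> x h = \<bar>s x\<bar> powr (- (1 + m) / 2) *\<^sub>R (fd b x h - ((1 + m) * \<mu>) *\<^sub>R b x)"
      using s_nonzero[OF x] by (simp add: s_derivative[OF x rb ra] scaleR_diff_right) (simp add: algebra_simps)
    then have "fd \<kappa> x h \<bullet> v = \<bar>s x\<bar> powr (- (1 + m) / 2) * (fd b x h \<bullet> v - (1 + m) * \<mu> * (b x \<bullet> v))"
      by (simp add: inner_diff_left)
    also have "\<dots> = \<bar>s x\<bar> powr (- (1 + m) / 2) * (b x \<bullet> G x h v)" using rb[of v] by simp
    finally show ?thesis by (simp add: \<kappa>_def)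
  qed
  show "\<exists>P. invertible P \<and> transpose P ** g x ** P = minkowski"
  proof -
    obtain P where P: "invertible P" "transpose P ** a x ** P = minkowski" using a_lorentz[OF x] by blast
    \<comment> \<open>Vectors have to be stretched by |s|^(m/2) to compensate the factor |s|^(-m) of
      the metric.\<close>
    define k where "k = \<bar>s x\<bar> powr (m / 2)"
    have k: "k > 0" "k * (k * \<bar>s x\<bar> powr (- m)) = 1" using s0 by (simp_all add: k_def flip: powr_add)
    have "transpose (k *\<^sub>R P) ** g x ** (k *\<^sub>R P) = (k * (k * \<bar>s x\<bar> powr (- m))) *\<^sub>R (transpose P ** a x ** P)"
      by (simp add: g_def transpose_scalar bounded_bilinear.scaleR_left[OF bounded_bilinear_matrix_matrix]
          bounded_bilinear.scaleR_right[OF bounded_bilinear_matrix_matrix] ac_simps)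
    then have "transpose (k *\<^sub>R P) ** g x ** (k *\<^sub>R P) = minkowski" by (simp only: k(2) P(2) scaleR_one)
    moreover have "invertible (k *\<^sub>R P)" using k(1) P(1) by (intro scalar_invertible) auto
    ultimately show ?thesis by blast
  qed
  show "\<kappa> x \<bullet> (matrix_inv (g x) *v \<kappa> x) \<noteq> 0"
  proof -
    \<comment> \<open>The vector with g B = \<open>\<kappa> x\<close>, written out so that
      \<open>matrix_inv (g x)\<close> can be evaluated by cancellation.\<close>
    define B where "B = (\<bar>s x\<bar> powr m * \<bar>s x\<bar> powr (- (1 + m) / 2)) *\<^sub>R (matrix_inv (a x) *v b x)"
    have "\<bar>s x\<bar> powr (- m) * \<bar>s x\<bar> powr m = 1" using s0 by (simp flip: powr_add)
    moreover have "a x *v (matrix_inv (a x) *v b x) = b x"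
      by (simp add: matrix_vector_mul_assoc matrix_inv_right a_invertible[OF x])
    then have "g x *v B = (\<bar>s x\<bar> powr (- m) * \<bar>s x\<bar> powr m) *\<^sub>R \<kappa> x"
      unfolding g_def B_def \<kappa>_def
      by (simp only: matrix_vector_mult_scaleR scaleR_matrix_vector_assoc[symmetric] scaleR_scaleR) (simp add: ac_simps)
    ultimately have gB: "g x *v B = \<kappa> x" by simp
    have "invertible (g x)" 
      unfolding g_def using s0 a_invertible[OF x] by (intro scalar_invertible) auto
    then have "matrix_inv (g x) *v \<kappa> x = B"
      by (simp add: matrix_vector_mul_assoc matrix_inv_left flip: gB)
    then show ?thesis using s0 s_nonzero[OF x] by (simp add: B_def \<kappa>_def flip: s_def)
  qed
qed

text \<open>The metric contributes the power -m (1 + m)/2 of |s| and the covector its negative, so F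
  is unchanged. Both scale factors are positive, so the admissible domain is unchanged too.\<close>

lemma kropina_rescaled:
  assumes z: "(x, y) \<in> \<Omega>"
  shows "kropina_domain m (y \<bullet> (g x *v y)) (\<kappa> x \<bullet> y)"
    "f (x, y) = \<bar>y \<bullet> (g x *v y)\<bar> powr ((1 + m) / 2) * real_power (\<kappa> x \<bullet> y) (- m)"
proof -
  have s0: "\<bar>s x\<bar> > 0" using s_nonzero[OF fst_in[OF z]] by simp
  define k where "k = \<bar>s x\<bar> powr (- (1 + m) / 2)"
  have k: "k > 0" using s0 by (simp add: k_def)
  have q: "y \<bullet> (g x *v y) = \<bar>s x\<bar> powr (- m) * (y \<bullet> (a x *v y))"
    by (simp add: g_def flip: scaleR_matrix_vector_assoc)
  have \<kappa>: "\<kappa> x \<bullet> y = k * (b x \<bullet> y)" by (simp add: \<kappa>_def k_def)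
  note dom = domain[OF z, simplified]
  show "kropina_domain m (y \<bullet> (g x *v y)) (\<kappa> x \<bullet> y)"
    using dom s0 k by (auto simp: kropina_domain_def q \<kappa> zero_less_mult_iff)
  have "\<bar>y \<bullet> (g x *v y)\<bar> powr ((1 + m) / 2) * real_power (\<kappa> x \<bullet> y) (- m)
     = (\<bar>s x\<bar> powr (- m)) powr ((1 + m) / 2) * \<bar>y \<bullet> (a x *v y)\<bar> powr ((1 + m) / 2) * (k powr (- m) * real_power (b x \<bullet> y) (- m))"
    using dom k by (simp add: q \<kappa> real_power_scale abs_mult powr_mult)
  also have "\<dots> = ((\<bar>s x\<bar> powr (- m)) powr ((1 + m) / 2) * k powr (- m)) * (\<bar>y \<bullet> (a x *v y)\<bar> powr ((1 + m) / 2) * real_power (b x \<bullet> y) (- m))"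
    by simp
  also have "(\<bar>s x\<bar> powr (- m)) powr ((1 + m) / 2) * k powr (- m) = 1"
    using s0 by (simp add: k_def powr_powr flip: powr_add) (simp add: field_simps)
  also have "\<bar>y \<bullet> (a x *v y)\<bar> powr ((1 + m) / 2) = sqrt \<bar>y \<bullet> (a x *v y)\<bar> powr (1 + m)"
    by (simp add: powr_half_sqrt[symmetric] powr_powr)
  finally show "f (x, y) = \<bar>y \<bullet> (g x *v y)\<bar> powr ((1 + m) / 2) * real_power (\<kappa> x \<bullet> y) (- m)"
    using kropina[OF z] by simp
qed

text \<open>Ricci-flatness speaks of directions in the cone; through the Hessian of the quadratic
  form it annihilates the symmetrised Ricci form of the affine connection, hence Ricci on every
  v.\<close>

lemma ricci_flat_curvature:
  assumes flat: "\<And>z i j. z \<in> \<Omega> \<Longrightarrow> finsler_ricci_tensor f i j z = 0" and x: "x \<in> U"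
  shows "(\<Sum>i\<in>UNIV. curvature G x (axis i 1) v v $ i) = 0"
proof -
  interpret P: parallel_structure U g \<kappa> G by (rule parallel_structure_g)
  obtain y where z: "(x, y) \<in> \<Omega>" using x U(2) by auto
  define \<rho> where "\<rho> x v w = (\<Sum>i\<in>UNIV. curvature G x (axis i 1) v w $ i)" for x v w
  have bil: "bilinear (\<rho> x)" if "x \<in> U" for x
    unfolding bilinear_def \<rho>_def
    by (auto intro!: linearI simp: linear_add[OF P.curv_linear(2)[OF that]] linear_add[OF P.curv_linear(3)[OF that]]
        linear_cmul[OF P.curv_linear(2)[OF that]] linear_cmul[OF P.curv_linear(3)[OF that]] sum.distrib sum_distrib_left)
  have smooth: "smooth_on U (\<lambda>x. \<rho> x v w)" for v w
    unfolding \<rho>_def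
    using smooth_curvature[OF U(1) G P.smooth_G] by (intro smooth_on_sum U) (simp add: smooth_on_vec_iff[OF U(1)])
  have R: "Ric f (x, y) = \<rho> x y y" if "(x, y) \<in> \<Omega>" for x y
    unfolding \<rho>_def
    by (rule Ric_curvature[where G = G, OF open_\<Omega> that _ G])
      (use N smooth_on_differentiable[OF P.smooth_G fst_in[OF that]] in auto)
  have "\<rho> x (axis i 1) (axis j 1) + \<rho> x (axis j 1) (axis i 1) = 0" for i j
    using quadratic_form_hessian[of \<Omega> x y U "Ric f" \<rho> i j] flat[OF z, of i j] open_\<Omega> z U R bil smooth
    by (simp add: finsler_ricci_tensor_def)
  moreover have "\<rho> x v v = (\<Sum>i\<in>UNIV. \<Sum>j\<in>UNIV. v $ i * (v $ j * \<rho> x (axis i 1) (axis j 1)))"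
    by (rule bilinear_axis_sum[OF bil[OF x]])
  ultimately have "\<rho> x v v + \<rho> x v v = 0"
  proof -
    assume a: "\<And>i j. \<rho> x (axis i 1) (axis j 1) + \<rho> x (axis j 1) (axis i 1) = 0"
    assume e: "\<rho> x v v = (\<Sum>i\<in>UNIV. \<Sum>j\<in>UNIV. v $ i * (v $ j * \<rho> x (axis i 1) (axis j 1)))"
    also have "\<dots> = (\<Sum>j\<in>UNIV. \<Sum>i\<in>UNIV. v $ i * (v $ j * \<rho> x (axis i 1) (axis j 1)))" by (rule sum.swap)
    finally have "\<rho> x v v + \<rho> x v v = (\<Sum>i\<in>UNIV. \<Sum>j\<in>UNIV. v $ i * (v $ j * (\<rho> x (axis i 1) (axis j 1) + \<rho> x (axis j 1) (axis i 1))))"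
      using e by (simp add: sum.distrib distrib_left mult.left_commute)
    then show ?thesis by (simp add: a)
  qed
  then show ?thesis by (simp add: \<rho>_def)
qed

end

section \<open>Finsler functions independent of the base point\<close>

lemma fd_commute_vec:
  fixes f :: "'a::real_normed_vector \<Rightarrow> 'b::euclidean_space"
  assumes S: "open S" "x \<in> S" and f: "smooth_on S f"
  shows "fd (\<lambda>x. fd f x u) x v = fd (\<lambda>x. fd f x v) x u"
proof (rule euclidean_eqI)
  fix k :: 'b assume "k \<in> Basis"
  have fk: "smooth_on S (\<lambda>x. f x \<bullet> k)" by (intro smooth_on_inner S f smooth_on_const)
  have 1: "fd (\<lambda>x. h x \<bullet> k) y w = fd h y w \<bullet> k" if "h differentiable at y" for h :: "'a \<Rightarrow> 'b" and y w
    using fd_eq[OF has_derivative_inner_left[OF fd_works[OF that], of k]] by simp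
  have 2: "fd (\<lambda>x. fd (\<lambda>x. f x \<bullet> k) x u) x v = fd (\<lambda>x. fd f x u) x v \<bullet> k" for u v
  proof -
    have "fd (\<lambda>x. fd (\<lambda>x. f x \<bullet> k) x u) x = fd (\<lambda>x. fd f x u \<bullet> k) x"
      by (rule fd_cong_open[OF S]) (rule 1[OF smooth_on_differentiable[OF f]])
    then show ?thesis using 1[OF smooth_on_differentiable[OF smooth_on_fd[OF f] S(2)]] by simp
  qed
  show "fd (\<lambda>x. fd f x u) x v \<bullet> k = fd (\<lambda>x. fd f x v) x u \<bullet> k"
    using fd_commute[OF S fk, of u v] by (simp add: 2)
qed

text \<open>A Finsler function that is independent of \<open>x\<close> in the coordinates \<open>\<tau>\<close>: its connection is the
  flat one with Christoffel symbols $(D\tau)^{-1} D^2\tau$.\<close>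

context
  fixes S :: "(real ^ 'n) set" and \<tau> :: "real ^ 'n \<Rightarrow> real ^ 'n"
  assumes S: "open S" and \<tau>: "smooth_on S \<tau>" and inv: "\<And>x. x \<in> S \<Longrightarrow> invertible (matrix (fd \<tau> x))"
begin

definition jac :: "real ^ 'n \<Rightarrow> real ^ 'n ^ 'n" where "jac x = matrix (fd \<tau> x)"

text \<open>The value 0 outside S makes bilinearity and symmetry hold at every x.\<close>

definition flat_conn :: "real ^ 'n \<Rightarrow> real ^ 'n \<Rightarrow> real ^ 'n \<Rightarrow> real ^ 'n" where
  "flat_conn x u v = (if x \<in> S then matrix_inv (jac x) *v (fd jac x u *v v) else 0)"

lemma jac_apply: "x \<in> S \<Longrightarrow> jac x *v v = fd \<tau> x v"
  unfolding jac_def by (rule matrix_works_linear[OF fd_linear[OF smooth_on_differentiable[OF \<tau>]]])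

lemma smooth_jac: "smooth_on S jac"
proof -
  have "smooth_on S (\<lambda>x. fd \<tau> x (axis j 1) $ i)" for i j
    using iffD1[OF smooth_on_vec_iff[OF S] smooth_on_fd[OF \<tau>]] ..
  then show ?thesis by (simp add: smooth_on_mat_iff[OF S] jac_def matrix_def)
qed

lemma jac_inverse: "x \<in> S \<Longrightarrow> jac x *v (matrix_inv (jac x) *v v) = v" "x \<in> S \<Longrightarrow> matrix_inv (jac x) *v (jac x *v v) = v"
  using inv by (simp_all add: matrix_vector_mul_assoc matrix_inv_right matrix_inv_left jac_def)

lemma jac_derivative: "x \<in> S \<Longrightarrow> fd jac x u *v v = fd (\<lambda>x. fd \<tau> x v) x u"
proof -
  assume x: "x \<in> S"
  have "fd (\<lambda>x. fd \<tau> x v) x = fd (\<lambda>x. jac x *v v) x"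
    by (rule fd_cong_open[OF S x]) (rule jac_apply[symmetric])
  also have "\<dots> = (\<lambda>u. jac x *v 0 + fd jac x u *v v)"
    by (intro fd_eq bounded_bilinear.FDERIV[OF bounded_bilinear_matrix_vector] has_derivative_const
        smooth_on_has_derivative[OF smooth_jac x])
  finally show ?thesis by simp
qed

lemma flat_conn_bilinear: "bilinear (flat_conn x)"
proof (cases "x \<in> S")
  case True
  have l: "linear (fd jac x)" by (rule fd_linear[OF smooth_on_differentiable[OF smooth_jac True]])
  show ?thesis
    unfolding bilinear_def flat_conn_def
    by (auto intro!: linearI simp: True linear_add[OF l] linear_cmul[OF l] matrix_vector_right_distrib
        matrix_vector_mult_add_rdistrib matrix_vector_mult_scaleR simp flip: scaleR_matrix_vector_assoc)
next
  case False
  then show ?thesis by (auto intro!: linearI simp: bilinear_def flat_conn_def)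
qed

lemma flat_conn_sym: "flat_conn x u v = flat_conn x v u"
  using fd_commute_vec[OF S _ \<tau>] by (simp add: flat_conn_def jac_derivative)

lemma jac_flat_conn: "x \<in> S \<Longrightarrow> jac x *v flat_conn x u v = fd jac x u *v v"
  by (simp add: flat_conn_def jac_inverse)

lemma smooth_flat_conn: "smooth_on S (\<lambda>x. flat_conn x u v)"
proof -
  have "smooth_on S (\<lambda>x. matrix_inv (jac x) *v (fd jac x u *v v))"
    using inv by (intro smooth_on_bilinear[OF bounded_bilinear_matrix_vector] smooth_on_matrix_inv S smooth_jac
        smooth_on_fd smooth_on_const) (simp add: jac_def)
  then show ?thesis by (subst smooth_on_cong[OF S]) (auto simp: flat_conn_def)
qed

text \<open>Differentiating jac G(v, w) = D^2 \<tau>(v, w) along u shows that jac applied to the u,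
  v part of the curvature is the third derivative of \<tau>, which is symmetric in u and v;
  antisymmetrising gives 0.\<close>

lemma curvature_flat_conn:
  assumes x: "x \<in> S"
  shows "curvature flat_conn x u v w = 0"
proof -
  have e: "jac x *v (fd (\<lambda>x. flat_conn x v w) x u + flat_conn x u (flat_conn x v w)) = fd (\<lambda>x. fd jac x v) x u *v w" for u v
  proof -
    have "fd (\<lambda>x. jac x *v flat_conn x v w) x = fd (\<lambda>x. fd jac x v *v w) x"
      by (rule fd_cong_open[OF S x]) (rule jac_flat_conn)
    moreover have "fd (\<lambda>x. jac x *v flat_conn x v w) x
        = (\<lambda>u. jac x *v fd (\<lambda>x. flat_conn x v w) x u + fd jac x u *v flat_conn x v w)"
      by (intro fd_eq bounded_bilinear.FDERIV[OF bounded_bilinear_matrix_vector]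
          smooth_on_has_derivative[OF smooth_jac x] smooth_on_has_derivative[OF smooth_flat_conn x])
    moreover have "fd (\<lambda>x. fd jac x v *v w) x = (\<lambda>u. fd jac x v *v 0 + fd (\<lambda>x. fd jac x v) x u *v w)"
      by (intro fd_eq bounded_bilinear.FDERIV[OF bounded_bilinear_matrix_vector] has_derivative_const
          smooth_on_has_derivative[OF smooth_on_fd[OF smooth_jac] x])
    ultimately have "jac x *v fd (\<lambda>x. flat_conn x v w) x u + fd jac x u *v flat_conn x v w = fd (\<lambda>x. fd jac x v) x u *v w"
      by (simp add: fun_eq_iff)
    then show ?thesis by (simp add: matrix_vector_right_distrib jac_flat_conn[OF x])
  qed
  have c: "curvature flat_conn x u v w = (fd (\<lambda>x. flat_conn x v w) x u + flat_conn x u (flat_conn x v w))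
      - (fd (\<lambda>x. flat_conn x u w) x v + flat_conn x v (flat_conn x u w))"
    by (simp add: curvature_def)
  have "jac x *v curvature flat_conn x u v w = 0"
    unfolding c by (simp only: matrix_vector_mult_diff_distrib e) (simp add: fd_commute_vec[OF S x smooth_jac, of u v])
  then have "matrix_inv (jac x) *v (jac x *v curvature flat_conn x u v w) = 0" by simp
  then show ?thesis by (simp only: jac_inverse(2)[OF x])
qed

text \<open>By the chain rule the x-derivative of F^2 along u acts on the new fibre coordinate
  through D^2 \<tau>(u, y), because the new base coordinate does not matter (\<open>const\<close>).
  The same displacement is produced by moving y along \<open>flat_conn x u y\<close>; so F^2 is
  invariant and this flat connection is the one of F.\<close>

lemma pullback_ricci_flat:
  fixes f f' :: "(real ^ 'n) \<times> (real ^ 'n) \<Rightarrow> real"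
  assumes fin: "finsler_chart f \<Omega>" and \<Omega>: "fst ` \<Omega> \<subseteq> S"
    and img: "\<And>x y. (x, y) \<in> \<Omega> \<Longrightarrow> (\<tau> x, fd \<tau> x y) \<in> \<Omega>'"
    and f: "\<And>x y. (x, y) \<in> \<Omega> \<Longrightarrow> f (x, y) = f' (\<tau> x, fd \<tau> x y)"
    and f': "\<And>z. z \<in> \<Omega>' \<Longrightarrow> (\<lambda>z. (f' z)\<^sup>2) differentiable at z"
    and const: "\<And>z u. z \<in> \<Omega>' \<Longrightarrow> fd (\<lambda>z. (f' z)\<^sup>2) z (u, 0) = 0"
    and z: "z \<in> \<Omega>"
  shows "finsler_ricci_tensor f i j z = 0"
proof -
  interpret finsler_chart f \<Omega> by (rule fin)
  have inS: "x \<in> S" if "(x, y) \<in> \<Omega>" for x y using \<Omega> that by force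
  define \<Phi> where "\<Phi> z = (\<tau> (fst z), jac (fst z) *v snd z)" for z
  have L: "L z = (f' (\<Phi> z))\<^sup>2" if "z \<in> \<Omega>" for z
    using f[of "fst z" "snd z"] inS[of "fst z" "snd z"] that by (simp add: L_def \<Phi>_def jac_apply)
  have dL: "fd L (x, y) (u, v) = fd (\<lambda>z. (f' z)\<^sup>2) (\<Phi> (x, y)) (0, fd jac x u *v y + jac x *v v)"
    if z: "(x, y) \<in> \<Omega>" for x y u v
  proof -
    have x: "x \<in> S" by (rule inS[OF z])
    have \<Phi>z: "\<Phi> (x, y) \<in> \<Omega>'" using img[OF z] by (simp add: \<Phi>_def jac_apply[OF x])
    have s: "(snd has_derivative snd) (at (x, y))" and 1: "(fst has_derivative fst) (at (x, y))"
      by (rule has_derivative_snd[OF has_derivative_ident] has_derivative_fst[OF has_derivative_ident])+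
    have c: "((\<lambda>z. \<phi> (fst z)) has_derivative (\<lambda>h. fd \<phi> x (fst h))) (at (x, y))" if "smooth_on S \<phi>"
      for \<phi> :: "real ^ 'n \<Rightarrow> 'b::real_normed_vector"
    proof -
      have "(\<phi> has_derivative fd \<phi> x) (at (fst (x, y)))" using smooth_on_has_derivative[OF that x] by simp
      from diff_chain_at[OF 1 this] show ?thesis by (simp add: o_def)
    qed
    have "(\<Phi> has_derivative (\<lambda>h. (fd \<tau> x (fst h), jac (fst (x, y)) *v snd h + fd jac x (fst h) *v snd (x, y)))) (at (x, y))"
      unfolding \<Phi>_def
      by (intro has_derivative_Pair bounded_bilinear.FDERIV[OF bounded_bilinear_matrix_vector] s c \<tau> smooth_jac)
    from diff_chain_at[OF this fd_works[OF f'[OF \<Phi>z]]]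
    have "((\<lambda>z. (f' (\<Phi> z))\<^sup>2) has_derivative (\<lambda>h. fd (\<lambda>z. (f' z)\<^sup>2) (\<Phi> (x, y)) (fd \<tau> x (fst h), jac x *v snd h + fd jac x (fst h) *v y))) (at (x, y))"
      by (simp add: o_def)
    then have "fd (\<lambda>z. (f' (\<Phi> z))\<^sup>2) (x, y) = (\<lambda>h. fd (\<lambda>z. (f' z)\<^sup>2) (\<Phi> (x, y)) (fd \<tau> x (fst h), jac x *v snd h + fd jac x (fst h) *v y))"
      by (rule fd_eq)
    moreover have "fd L (x, y) = fd (\<lambda>z. (f' (\<Phi> z))\<^sup>2) (x, y)"
      by (rule fd_cong_open[OF open_\<Omega> z]) (rule L)
    ultimately have "fd L (x, y) (u, v) = fd (\<lambda>z. (f' z)\<^sup>2) (\<Phi> (x, y)) ((fd \<tau> x u, 0) + (0, fd jac x u *v y + jac x *v v))"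
      by (simp add: add.commute)
    also have "\<dots> = fd (\<lambda>z. (f' z)\<^sup>2) (\<Phi> (x, y)) (0, fd jac x u *v y + jac x *v v)"
      by (simp only: linear_add[OF fd_linear[OF f'[OF \<Phi>z]]] const[OF \<Phi>z] add_0)
    finally show ?thesis .
  qed
  have inv: "fd L (x, y) (v, 0) = fd L (x, y) (0, flat_conn x v y)" if z: "(x, y) \<in> \<Omega>" for x y v
  proof -
    have "linear (fd jac x)" by (rule fd_linear[OF smooth_on_differentiable[OF smooth_jac inS[OF z]]])
    then show ?thesis by (simp add: dL[OF z] jac_flat_conn[OF inS[OF z]] linear_0)
  qed
  have sp: "spray k (x, y) = 2 * flat_conn x y y $ k" if "(x, y) \<in> \<Omega>" for x y k
    by (rule invariant_imp_spray[of flat_conn, OF flat_conn_bilinear flat_conn_sym inv that])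
  have N: "nonlinear_connection f k i (x, y) = flat_conn x (axis i 1) y $ k" if "(x, y) \<in> \<Omega>" for x y k i
    by (rule spray_imp_connection[of flat_conn, OF flat_conn_bilinear flat_conn_sym sp that])
  have Ric: "Ric f z = 0" if z: "z \<in> \<Omega>" for z
  proof -
    obtain x y where xy: "z = (x, y)" by (cases z)
    have x: "x \<in> S" using inS z xy by blast
    have "Ric f (x, y) = (\<Sum>i\<in>UNIV. curvature flat_conn x (axis i 1) y y $ i)"
      by (rule Ric_curvature[where G = flat_conn, OF open_\<Omega> z[unfolded xy] _ flat_conn_bilinear])
        (use N smooth_on_differentiable[OF smooth_flat_conn x] in auto)
    then show ?thesis by (simp add: xy curvature_flat_conn[OF x])
  qed
  have dy0: "dy i h z = 0" if "\<And>w. w \<in> \<Omega> \<Longrightarrow> h w = 0" "z \<in> \<Omega>" for i h z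
  proof -
    have "fd h z = fd (\<lambda>w. 0) z" by (rule fd_cong_open[OF open_\<Omega> that(2)]) (rule that(1))
    then show ?thesis by (simp add: dy_def frechet_derivative_const)
  qed
  show ?thesis
    unfolding finsler_ricci_tensor_def by (simp add: dy0[OF dy0[OF Ric] z])
qed

end

section \<open>Charts and the tangent bundle\<close>

lemma homeomorphism_imp_homeomorphic_map:
  assumes "homeomorphism V X \<phi> \<psi>"
  shows "homeomorphic_map (top_of_set V) (top_of_set X) \<phi>"
proof -
  have "homeomorphic_maps (top_of_set V) (top_of_set X) \<phi> \<psi>"
    using assms by (auto simp: homeomorphic_maps_def homeomorphism_def continuous_map_in_subtopology image_subset_iff_funcset[symmetric])
  then show ?thesis using homeomorphic_map_maps by blast
qed

context
  fixes T :: "'p topology" and c :: "('p, 'n::finite) chart"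
  assumes c: "is_chart T c"
begin

lemma chart_topspace: "topspace (subtopology T (chart_dom c)) = chart_dom c"
  using c openin_subset[of T "chart_dom c"] by (auto simp: is_chart_def)

lemma chart_inj: "inj_on (chart_map c) (chart_dom c)"
  using c homeomorphic_imp_injective_map chart_topspace unfolding is_chart_def by metis

lemma chart_inv_map: "p \<in> chart_dom c \<Longrightarrow> chart_inv c (chart_map c p) = p"
  unfolding chart_inv_def using chart_inj by simp

lemma chart_map_in: "p \<in> chart_dom c \<Longrightarrow> chart_map c p \<in> chart_image c"
  by (simp add: chart_image_def)

lemma chart_inv_in: "x \<in> chart_image c \<Longrightarrow> chart_inv c x \<in> chart_dom c"
  unfolding chart_inv_def chart_image_def by (rule inv_into_into)

lemma chart_map_inv: "x \<in> chart_image c \<Longrightarrow> chart_map c (chart_inv c x) = x"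
  unfolding chart_inv_def chart_image_def by (rule f_inv_into_f)

lemma chart_openin_iff:
  assumes W: "W \<subseteq> chart_dom c"
  shows "open (chart_map c ` W) \<longleftrightarrow> openin T W"
proof -
  have hom: "homeomorphic_map (subtopology T (chart_dom c)) (top_of_set (chart_image c)) (chart_map c)"
    and o: "openin T (chart_dom c)" "open (chart_image c)" using c by (auto simp: is_chart_def)
  have sub: "chart_map c ` W \<subseteq> chart_image c" using W by (auto simp: chart_image_def)
  have "openin (top_of_set (chart_image c)) (chart_map c ` W) \<longleftrightarrow> openin (subtopology T (chart_dom c)) W"
    by (rule homeomorphic_map_openness[OF hom]) (simp only: chart_topspace W)
  then show ?thesis
    using openin_open_eq[OF o(2)] openin_open_subtopology[OF o(1)] W sub by blast
qed

end

section \<open>Tangent vectors and Finsler functions under changes of chart\<close>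

locale manifold =
  fixes T :: "'p topology" and \<A> :: "('p, 'n::finite) chart set"
  assumes manifold: "smooth_manifold T \<A>"
begin

lemma is_chart: "c \<in> \<A> \<Longrightarrow> is_chart T c"
  and compatible: "c \<in> \<A> \<Longrightarrow> d \<in> \<A> \<Longrightarrow> smooth_compatible c d"
  and charts_cover: "(\<Union>c\<in>\<A>. chart_dom c) = topspace T"
  and maximal: "is_chart T c \<Longrightarrow> (\<And>d. d \<in> \<A> \<Longrightarrow> smooth_compatible c d) \<Longrightarrow> c \<in> \<A>"
  using manifold unfolding smooth_manifold_def by blast+

abbreviation overlap :: "('p, 'n) chart \<Rightarrow> ('p, 'n) chart \<Rightarrow> (real ^ 'n) set" where
  "overlap c d \<equiv> chart_map c ` (chart_dom c \<inter> chart_dom d)"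

lemma open_overlap: "c \<in> \<A> \<Longrightarrow> d \<in> \<A> \<Longrightarrow> open (overlap c d)"
proof -
  assume cd: "c \<in> \<A>" "d \<in> \<A>"
  have "openin T (chart_dom c \<inter> chart_dom d)"
    using is_chart[OF cd(1)] is_chart[OF cd(2)] by (auto simp: is_chart_def)
  then show ?thesis using chart_openin_iff[OF is_chart[OF cd(1)], of "chart_dom c \<inter> chart_dom d"] by simp
qed

lemma smooth_transition: "c \<in> \<A> \<Longrightarrow> d \<in> \<A> \<Longrightarrow> smooth_on (overlap c d) (transition c d)"
  using compatible by (simp add: smooth_compatible_def)

lemma transition_map: "c \<in> \<A> \<Longrightarrow> p \<in> chart_dom c \<Longrightarrow> transition c d (chart_map c p) = chart_map d p"
  by (simp add: transition_def chart_inv_map[OF is_chart])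

lemma transition_derivative:
  assumes "c \<in> \<A>" "d \<in> \<A>" "p \<in> chart_dom c" "p \<in> chart_dom d"
  shows "(transition c d has_derivative fd (transition c d) (chart_map c p)) (at (chart_map c p))"
  using smooth_on_has_derivative[OF smooth_transition[OF assms(1,2)]] assms(3,4) by blast

lemma transition_chain:
  assumes cde: "c \<in> \<A>" "d \<in> \<A>" "e \<in> \<A>" and p: "p \<in> chart_dom c" "p \<in> chart_dom d" "p \<in> chart_dom e"
  shows "fd (transition d e) (chart_map d p) (fd (transition c d) (chart_map c p) y) = fd (transition c e) (chart_map c p) y"
proof -
  let ?x = "chart_map c p"
  have 2: "(transition d e has_derivative fd (transition d e) (chart_map d p)) (at (transition c d ?x))"
    using transition_derivative[OF cde(2,3) p(2,3)] by (simp add: transition_map cde p)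
  have "fd (transition d e \<circ> transition c d) ?x = fd (transition d e) (chart_map d p) \<circ> fd (transition c d) ?x"
    by (rule fd_eq[OF diff_chain_at[OF transition_derivative[OF cde(1,2) p(1,2)] 2]])
  moreover have "fd (transition d e \<circ> transition c d) ?x = fd (transition c e) ?x"
  proof (rule fd_cong_open[OF open_overlap[OF cde(1,2)]])
    show "?x \<in> overlap c d" using p by blast
    show "(transition d e \<circ> transition c d) x = transition c e x" if "x \<in> overlap c d" for x
      using that by (auto simp: transition_map cde)
  qed
  ultimately show ?thesis by (metis comp_apply)
qed

lemma transition_self:
  assumes "c \<in> \<A>" "p \<in> chart_dom c"
  shows "fd (transition c c) (chart_map c p) y = y"
proof -
  have "fd (transition c c) (chart_map c p) = fd (\<lambda>x. x) (chart_map c p)"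
    by (rule fd_cong_open[OF open_overlap[OF assms(1,1)]]) (use assms in \<open>auto simp: transition_map\<close>)
  then show ?thesis by (simp add: fd_eq[OF has_derivative_ident])
qed

lemma coord_tvec_change:
  assumes cd: "c \<in> \<A>" "d \<in> \<A>" and p: "p \<in> chart_dom c" "p \<in> chart_dom d"
  shows "coord_tvec \<A> c p y = coord_tvec \<A> d p (fd (transition c d) (chart_map c p) y)"
  using transition_chain[OF cd _ p] by (auto simp: coord_tvec_def fun_eq_iff)

lemma TM_point_map: "c \<in> \<A> \<Longrightarrow> p \<in> chart_dom c \<Longrightarrow> TM_point \<A> c (chart_map c p, y) = (p, coord_tvec \<A> c p y)"
  by (simp add: TM_point_def chart_inv_map[OF is_chart])

lemma TM_point_change:
  assumes cd: "c \<in> \<A>" "d \<in> \<A>" and x: "x \<in> overlap c d"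
  shows "TM_point \<A> c (x, y) = TM_point \<A> d (transition c d x, fd (transition c d) x y)"
  using x coord_tvec_change[OF cd] by (auto simp: TM_point_map transition_map cd)

lemma coord_tvec_scale:
  assumes "c \<in> \<A>" "p \<in> chart_dom c"
  shows "coord_tvec \<A> c p (r *\<^sub>R y) = tvec_scale r (coord_tvec \<A> c p y)"
proof
  fix d
  show "coord_tvec \<A> c p (r *\<^sub>R y) d = tvec_scale r (coord_tvec \<A> c p y) d"
  proof (cases "d \<in> \<A> \<and> p \<in> chart_dom d")
    case True
    then have "linear (fd (transition c d) (chart_map c p))"
      using transition_derivative[of c d p] assms has_derivative_linear by blast
    then show ?thesis using True by (simp add: coord_tvec_def tvec_scale_def linear_cmul)
  qed (auto simp: coord_tvec_def tvec_scale_def)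
qed

lemma tangent_vector_coord:
  assumes "v \<in> tangent_space \<A> p" "c \<in> \<A>" "p \<in> chart_dom c"
  shows "v = coord_tvec \<A> c p (v c)"
proof
  fix d
  show "v d = coord_tvec \<A> c p (v c) d"
  proof (cases "d \<in> \<A> \<and> p \<in> chart_dom d")
    case True
    then have "v d = fd (transition c d) (chart_map c p) (v c)" using assms unfolding tangent_space_def by blast
    then show ?thesis using True by (simp add: coord_tvec_def)
  next
    case False
    then have "v d = 0" using assms(1) unfolding tangent_space_def by blast
    then show ?thesis using False by (auto simp: coord_tvec_def)
  qed
qed

context
  fixes A :: "('p \<times> ('p, 'n) tvec) set" and F :: "'p \<times> ('p, 'n) tvec \<Rightarrow> real"
  assumes F: "finsler_metric T \<A> A F"
begin

text \<open>Rests on the projection of A being all of M, and on a tangent vector being recovered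
  from its components in one chart.\<close>

lemma TM_coords_image:
  assumes c: "c \<in> \<A>"
  shows "fst ` TM_coords \<A> c A = chart_image c"
proof
  show "fst ` TM_coords \<A> c A \<subseteq> chart_image c" by (auto simp: TM_coords_def)
  show "chart_image c \<subseteq> fst ` TM_coords \<A> c A"
  proof
    fix x assume x: "x \<in> chart_image c"
    define p where "p = chart_inv c x"
    have p: "p \<in> chart_dom c" "chart_map c p = x"
      using chart_inv_in[OF is_chart[OF c] x] chart_map_inv[OF is_chart[OF c] x] by (auto simp: p_def)
    then have "p \<in> topspace T" using c charts_cover by blast
    then have "p \<in> fst ` A" using F by (simp add: finsler_metric_def conic_subbundle_def)
    then obtain v where v: "(p, v) \<in> A" by force
    then have "v \<in> tangent_space \<A> p"
      using F by (auto simp: finsler_metric_def conic_subbundle_def tangent_bundle_def)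
    then have "(x, v c) \<in> TM_coords \<A> c A"
      using v x tangent_vector_coord[OF _ c p(1)] TM_point_map[OF c p(1), of "v c"] by (simp add: TM_coords_def p(2))
    then show "x \<in> fst ` TM_coords \<A> c A" by force
  qed
qed

lemma finsler_chart_TM:
  assumes c: "c \<in> \<A>"
  shows "finsler_chart (F \<circ> TM_point \<A> c) (TM_coords \<A> c A)"
proof
  have scale: "TM_point \<A> c (x, r *\<^sub>R y) = (fst (TM_point \<A> c (x, y)), tvec_scale r (snd (TM_point \<A> c (x, y))))"
    if "x \<in> chart_image c" for x y r
    using coord_tvec_scale[OF c chart_inv_in[OF is_chart[OF c] that]] by (simp add: TM_point_def)
  show "open (TM_coords \<A> c A)" "smooth_on (TM_coords \<A> c A) (F \<circ> TM_point \<A> c)"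
    "\<And>z. z \<in> TM_coords \<A> c A \<Longrightarrow> invertible (fundamental_tensor (F \<circ> TM_point \<A> c) z)"
    using F c by (auto simp: finsler_metric_def conic_subbundle_def)
  have A: "(p, v) \<in> A \<Longrightarrow> r > 0 \<Longrightarrow> (p, tvec_scale r v) \<in> A \<and> F (p, tvec_scale r v) = r * F (p, v)" for p v r
    using F by (auto simp: finsler_metric_def conic_subbundle_def)
  show "cone (TM_coords \<A> c A)"
    unfolding cone_def
  proof (intro allI impI, elim conjE)
    fix x y and r :: real assume z: "(x, y) \<in> TM_coords \<A> c A" "r > 0"
    then show "(x, r *\<^sub>R y) \<in> TM_coords \<A> c A"
      using scale[of x r y] A[of "fst (TM_point \<A> c (x, y))" "snd (TM_point \<A> c (x, y))" r] by (simp add: TM_coords_def)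
  qed
  show "homog (TM_coords \<A> c A) 1 (F \<circ> TM_point \<A> c)"
    unfolding homog_def
  proof (intro allI impI, elim conjE)
    fix x y and r :: real assume z: "(x, y) \<in> TM_coords \<A> c A" "r > 0"
    then show "(F \<circ> TM_point \<A> c) (x, r *\<^sub>R y) = r ^ 1 * (F \<circ> TM_point \<A> c) (x, y)"
      using scale[of x r y] A[of "fst (TM_point \<A> c (x, y))" "snd (TM_point \<A> c (x, y))" r] by (simp add: TM_coords_def)
  qed
qed

lemma TM_coords_change:
  assumes cd: "c \<in> \<A>" "d \<in> \<A>" and z: "(x, y) \<in> TM_coords \<A> c A" and x: "x \<in> overlap c d"
  shows "(transition c d x, fd (transition c d) x y) \<in> TM_coords \<A> d A"
    "(F \<circ> TM_point \<A> c) (x, y) = (F \<circ> TM_point \<A> d) (transition c d x, fd (transition c d) x y)"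
proof -
  obtain p where p: "p \<in> chart_dom d" "transition c d x = chart_map d p" using x by (auto simp: transition_map cd)
  show "(transition c d x, fd (transition c d) x y) \<in> TM_coords \<A> d A"
    "(F \<circ> TM_point \<A> c) (x, y) = (F \<circ> TM_point \<A> d) (transition c d x, fd (transition c d) x y)"
    using z TM_point_change[OF cd x, of y] chart_map_in[OF is_chart[OF cd(2)] p(1)] by (simp_all add: TM_coords_def p(2))
qed

text \<open>Ricci-flatness is demanded in every chart, while the assumption offers one good chart
  near each point. The transition map into the good chart serves as the coordinates \<tau> of
  \<open>pullback_ricci_flat\<close>, so the Ricci tensor itself never has to be
  transformed.\<close>

lemma ricci_flat_if_locally_constant:
  assumes loc: "\<And>p. p \<in> topspace T \<Longrightarrow> \<exists>c\<in>\<A>. p \<in> chart_dom c \<and>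
      (\<exists>\<Lambda>. \<forall>(x, y)\<in>TM_coords \<A> c A. (F \<circ> TM_point \<A> c) (x, y) = \<Lambda> y)"
  shows "ricci_flat \<A> A F"
  unfolding ricci_flat_def
proof (intro ballI allI)
  fix d z i j assume d: "d \<in> \<A>" and z: "z \<in> TM_coords \<A> d A"
  define p where "p = chart_inv d (fst z)"
  have z1: "fst z \<in> chart_image d" using z by (simp add: TM_coords_def)
  have p: "p \<in> chart_dom d" "chart_map d p = fst z"
    using chart_inv_in[OF is_chart[OF d] z1] chart_map_inv[OF is_chart[OF d] z1] by (auto simp: p_def)
  then have "p \<in> topspace T" using d charts_cover by blast
  then obtain c \<Lambda> where c: "c \<in> \<A>" "p \<in> chart_dom c"
    and \<Lambda>: "\<And>x y. (x, y) \<in> TM_coords \<A> c A \<Longrightarrow> (F \<circ> TM_point \<A> c) (x, y) = \<Lambda> y"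
    using loc by blast
  let ?S = "overlap d c" and ?fc = "F \<circ> TM_point \<A> c" and ?fd = "F \<circ> TM_point \<A> d"
  \<comment> \<open>Only the base is cut down to the overlap, so the set stays open and
    conic.\<close>
  let ?\<Omega> = "TM_coords \<A> d A \<inter> (?S \<times> UNIV)"
  interpret C: finsler_chart ?fc "TM_coords \<A> c A" by (rule finsler_chart_TM[OF c(1)])
  interpret D: finsler_chart ?fd "TM_coords \<A> d A" by (rule finsler_chart_TM[OF d])
  have S: "open ?S" by (rule open_overlap[OF d c(1)])
  have fin: "finsler_chart ?fd ?\<Omega>"
  proof
    show "open ?\<Omega>" by (intro open_Int D.open_\<Omega> open_Times S open_UNIV)
    show "cone ?\<Omega>" "homog ?\<Omega> 1 ?fd" using D.cone_\<Omega> D.homog_f by (auto simp: cone_def homog_def)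
    show "smooth_on ?\<Omega> ?fd" by (rule smooth_on_subset[OF D.smooth_f]) simp
    show "invertible (fundamental_tensor ?fd z)" if "z \<in> ?\<Omega>" for z using D.nondegenerate that by simp
  qed
  have inv: "invertible (matrix (fd (transition d c) x))" if "x \<in> ?S" for x
  proof -
    obtain q where q: "q \<in> chart_dom d" "q \<in> chart_dom c" "x = chart_map d q" using \<open>x \<in> ?S\<close> by blast
    have l: "linear (fd (transition d c) x)" "linear (fd (transition c d) (chart_map c q))"
      using transition_derivative[OF d c(1) q(1,2)] transition_derivative[OF c(1) d q(2,1)] q(3) has_derivative_linear by auto
    have "fd (transition c d) (chart_map c q) (fd (transition d c) x y) = y" for y
      using transition_chain[OF d c(1) d q(1,2,1)] transition_self[OF d q(1)] by (simp add: q(3))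
    then have "matrix (fd (transition c d) (chart_map c q)) ** matrix (fd (transition d c) x) = mat 1"
      by (simp add: matrix_eq matrix_works_linear[OF l(1)] matrix_works_linear[OF l(2)] flip: matrix_vector_mul_assoc)
    then show ?thesis using invertible_left_inverse by blast
  qed
  show "finsler_ricci_tensor ?fd i j z = 0"
  proof (rule pullback_ricci_flat[OF S smooth_transition[OF d c(1)] inv fin])
    show "fst ` ?\<Omega> \<subseteq> ?S" by auto
    show "z \<in> ?\<Omega>" using z p c by (cases z) auto
    show "(transition d c x, fd (transition d c) x y) \<in> TM_coords \<A> c A"
      "?fd (x, y) = ?fc (transition d c x, fd (transition d c) x y)" if "(x, y) \<in> ?\<Omega>" for x y
      using TM_coords_change[OF d c(1), of x y] that by auto
    fix w assume w: "w \<in> TM_coords \<A> c A"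
    show diff: "(\<lambda>z. (?fc z)\<^sup>2) differentiable at w"
      using C.differentiable_L[OF w] by (simp add: C.L_def[abs_def])
    show "fd (\<lambda>z. (?fc z)\<^sup>2) w (u, 0) = 0" for u
    proof (rule fd_eq_line_derivative[OF C.open_\<Omega> w diff])
      show "(?fc (w + t *\<^sub>R (u, 0)))\<^sup>2 = (\<Lambda> (snd w))\<^sup>2" if "w + t *\<^sub>R (u, 0) \<in> TM_coords \<A> c A" for t
        using \<Lambda>[of "fst w + t *\<^sub>R u" "snd w"] that by (cases w) simp
      show "((\<lambda>t. (\<Lambda> (snd w))\<^sup>2) has_real_derivative 0) (at 0)" by simp
    qed
  qed
qed

end

text \<open>A chart followed by a local diffeomorphism has smooth transition maps to all charts of
  the atlas, being compositions with \<phi> or \<psi>; maximality then puts it into the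
  atlas.\<close>

lemma new_chart:
  assumes c: "c \<in> \<A>" and V: "open V" "V \<subseteq> chart_image c" and X: "open X" "homeomorphism V X \<phi> \<psi>"
    and smooth: "smooth_on V \<phi>" "smooth_on X \<psi>"
  defines "c' \<equiv> (chart_inv c ` V, \<phi> \<circ> chart_map c)"
  shows "c' \<in> \<A>" "chart_image c' = X" "\<And>x. x \<in> X \<Longrightarrow> chart_inv c' x = chart_inv c (\<psi> x)"
    "\<And>x. x \<in> X \<Longrightarrow> transition c' c x = \<psi> x"
proof -
  note ch = is_chart[OF c]
  have cm: "chart_map c (chart_inv c v) = v" "chart_inv c v \<in> chart_dom c" if "v \<in> V" for v
    using chart_map_inv[OF ch] chart_inv_in[OF ch] V(2) that by blast+
  have dom: "chart_dom c' = chart_inv c ` V" and map: "chart_map c' = \<phi> \<circ> chart_map c" by (simp_all add: c'_def)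
  have sub: "chart_inv c ` V \<subseteq> chart_dom c" using cm by blast
  have img: "chart_map c ` (chart_inv c ` V) = V" by (simp add: image_image cm)
  have hom: "\<phi> ` V = X" "\<psi> ` X = V" "\<And>v. v \<in> V \<Longrightarrow> \<psi> (\<phi> v) = v" "\<And>x. x \<in> X \<Longrightarrow> \<phi> (\<psi> x) = x"
    using X(2) by (auto simp: homeomorphism_def)
  show image: "chart_image c' = X"
    unfolding chart_image_def dom map image_comp[symmetric] img by (rule hom(1))
  have op: "openin T (chart_dom c')"
    using chart_openin_iff[OF ch sub] V(1) by (simp add: img dom)
  have "homeomorphic_map (subtopology (subtopology T (chart_dom c)) (chart_inv c ` V))
      (subtopology (top_of_set (chart_image c)) V) (chart_map c)"
  proof (rule homeomorphic_map_subtopologies)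
    show "homeomorphic_map (subtopology T (chart_dom c)) (top_of_set (chart_image c)) (chart_map c)"
      using ch by (simp add: is_chart_def)
    show "chart_map c ` (topspace (subtopology T (chart_dom c)) \<inter> chart_inv c ` V) = topspace (top_of_set (chart_image c)) \<inter> V"
      unfolding chart_topspace[OF ch] using sub img V(2) by (simp add: inf.absorb2)
  qed
  then have "homeomorphic_map (subtopology T (chart_inv c ` V)) (top_of_set V) (chart_map c)"
    using sub V(2) by (simp add: subtopology_subtopology inf.absorb2)
  then have "homeomorphic_map (subtopology T (chart_dom c')) (top_of_set X) (chart_map c')"
    unfolding dom map by (rule homeomorphic_map_compose) (rule homeomorphism_imp_homeomorphic_map[OF X(2)])
  then have ch': "is_chart T c'"
    using op X(1) by (simp add: is_chart_def image)
  show inv: "chart_inv c' x = chart_inv c (\<psi> x)" if x: "x \<in> X" for x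
  proof -
    have v: "\<psi> x \<in> V" using x hom by blast
    then have "chart_inv c (\<psi> x) \<in> chart_dom c'" "chart_map c' (chart_inv c (\<psi> x)) = x"
      using x hom(4) by (auto simp: dom map cm)
    then show ?thesis using chart_inv_map[OF ch'] by metis
  qed
  show "transition c' c x = \<psi> x" if "x \<in> X" for x
    using cm(1)[of "\<psi> x"] hom(2) that by (auto simp: transition_def inv)
  show "c' \<in> \<A>"
  proof (rule maximal[OF ch'])
    fix d assume d: "d \<in> \<A>"
    let ?O = "chart_dom c' \<inter> chart_dom d"
    have opO: "openin T ?O" using op is_chart[OF d] by (auto simp: is_chart_def)
    have o1: "open (chart_map c' ` ?O)" using chart_openin_iff[OF ch', of ?O] opO by simp
    have o2: "open (chart_map d ` ?O)" using chart_openin_iff[OF is_chart[OF d], of ?O] opO by simp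
    have O_eq: "chart_map d ` (chart_dom d \<inter> chart_dom c') = chart_map d ` ?O" by (simp add: Int_commute)
    have sX: "chart_map c' ` ?O \<subseteq> X" using image by (auto simp: chart_image_def)
    have 1: "smooth_on (chart_map c' ` ?O) (\<lambda>x. transition c d (\<psi> x))"
    proof (rule smooth_on_compose[OF o1 open_overlap[OF c d] _ smooth_transition[OF c d] smooth_on_subset[OF smooth(2) sX]])
      show "\<psi> ` chart_map c' ` ?O \<subseteq> overlap c d"
      proof clarify
        fix p assume p: "p \<in> chart_dom c'" "p \<in> chart_dom d"
        then obtain v where v: "v \<in> V" "p = chart_inv c v" by (auto simp: dom)
        have "\<psi> (chart_map c' p) = chart_map c p" using hom(3)[OF v(1)] cm(1)[OF v(1)] by (simp add: map v(2))
        then show "\<psi> (chart_map c' p) \<in> overlap c d" using p sub by (auto simp: dom)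
      qed
    qed
    have s1: "smooth_on (chart_map c' ` ?O) (transition c' d)"
      by (subst smooth_on_cong[OF o1, of _ "\<lambda>x. transition c d (\<psi> x)"])
        (use 1 sX in \<open>auto simp: transition_def inv subset_iff\<close>)
    have 2: "smooth_on (chart_map d ` ?O) (\<lambda>x. \<phi> (transition d c x))"
    proof (rule smooth_on_compose[OF o2 V(1) _ smooth(1)])
      show "transition d c ` chart_map d ` ?O \<subseteq> V"
      proof clarify
        fix p assume p: "p \<in> chart_dom c'" "p \<in> chart_dom d"
        then show "transition d c (chart_map d p) \<in> V" using cm(1) by (auto simp: transition_map[OF d] dom)
      qed
      show "smooth_on (chart_map d ` ?O) (transition d c)"
        by (rule smooth_on_subset[OF smooth_transition[OF d c]]) (use sub in \<open>auto simp: dom\<close>)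
    qed
    then have s2: "smooth_on (chart_map d ` ?O) (transition d c')"
      by (simp add: transition_def map o_def)
    show "smooth_compatible c' d"
      unfolding smooth_compatible_def using s1 s2 by simp
  qed
qed

end

section \<open>Ricci-flatness and flat charts on the manifold\<close>

lemma inner_matrix_sum: "y \<bullet> (M *v z) = (\<Sum>i\<in>UNIV. \<Sum>j\<in>UNIV. M $ i $ j * y $ i * z $ j)"
  for M :: "real ^ 'n ^ 'm"
  by (simp add: inner_vec_def matrix_vector_mult_def sum_distrib_left ac_simps)

theorem proposition18:
  fixes T :: "'p topology" and \<A> :: "('p, 4) chart set"
    and A :: "('p \<times> ('p, 4) tvec) set" and F :: "'p \<times> ('p, 4) tvec \<Rightarrow> real"
    and m :: real
    and a :: "'p \<Rightarrow> ('p, 4) tvec \<Rightarrow> ('p, 4) tvec \<Rightarrow> real"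
    and b :: "'p \<Rightarrow> ('p, 4) tvec \<Rightarrow> real"
  assumes "smooth_manifold T \<A>"
    and "m \<noteq> 0"
    and "m_kropina_metric T \<A> A F m a b"
    and "berwald_type \<A> A F"
    and "lorentzian_metric \<A> a"
    and "\<forall>c\<in>\<A>. \<forall>x\<in>chart_image c. one_form_norm_sq \<A> c a b x \<noteq> 0"
  shows "ricci_flat \<A> A F \<longleftrightarrow>
    (\<forall>p\<in>topspace T. \<exists>c\<in>\<A>. p \<in> chart_dom c \<and> (\<exists>k :: real ^ 4.
       \<forall>(x, y)\<in>TM_coords \<A> c A.
         kropina_domain m (\<Sum>i\<in>UNIV. \<Sum>j\<in>UNIV. minkowski $ i $ j * y $ i * y $ j) (\<Sum>i\<in>UNIV. k $ i * y $ i) \<and>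
         (F \<circ> TM_point \<A> c) (x, y) =
           \<bar>\<Sum>i\<in>UNIV. \<Sum>j\<in>UNIV. minkowski $ i $ j * y $ i * y $ j\<bar> powr ((1 + m) / 2) *
           real_power (\<Sum>i\<in>UNIV. k $ i * y $ i) (- m)))"
proof -
  interpret manifold T \<A> by unfold_locales (rule assms(1))
  have F: "finsler_metric T \<A> A F" and a: "pseudo_riemannian_metric \<A> a" and b: "one_form \<A> b"
    and Fv: "\<And>p v. (p, v) \<in> A \<Longrightarrow> kropina_domain m (a p v v) (b p v) \<and>
        F (p, v) = sqrt \<bar>a p v v\<bar> powr (1 + m) * real_power (b p v) (- m)"
    using assms(3) by (auto simp: m_kropina_metric_def)
  let ?form = "\<lambda>p. \<exists>c\<in>\<A>. p \<in> chart_dom c \<and> (\<exists>k :: real ^ 4.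
       \<forall>(x, y)\<in>TM_coords \<A> c A.
         kropina_domain m (\<Sum>i\<in>UNIV. \<Sum>j\<in>UNIV. minkowski $ i $ j * y $ i * y $ j) (\<Sum>i\<in>UNIV. k $ i * y $ i) \<and>
         (F \<circ> TM_point \<A> c) (x, y) =
           \<bar>\<Sum>i\<in>UNIV. \<Sum>j\<in>UNIV. minkowski $ i $ j * y $ i * y $ j\<bar> powr ((1 + m) / 2) *
           real_power (\<Sum>i\<in>UNIV. k $ i * y $ i) (- m))"
  have "ricci_flat \<A> A F \<longleftrightarrow> (\<forall>p\<in>topspace T. ?form p)"
  proof
    \<comment> \<open>With constant coefficients F depends on y alone in the given chart, which is
      all that this direction uses.\<close>
    assume "\<forall>p\<in>topspace T. ?form p"
    then have "\<exists>c\<in>\<A>. p \<in> chart_dom c \<and> (\<exists>\<Lambda>. \<forall>(x, y)\<in>TM_coords \<A> c A. (F \<circ> TM_point \<A> c) (x, y) = \<Lambda> y)"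
      if "p \<in> topspace T" for p
      using that by fast
    then show "ricci_flat \<A> A F" by (rule ricci_flat_if_locally_constant[OF F])
  next
    assume flat: "ricci_flat \<A> A F"
    show "\<forall>p\<in>topspace T. ?form p"
    proof
      fix p assume "p \<in> topspace T"
      then obtain c where c: "c \<in> \<A>" "p \<in> chart_dom c" using charts_cover by blast
      let ?f = "F \<circ> TM_point \<A> c" and ?\<Omega> = "TM_coords \<A> c A" and ?U = "chart_image c"
        and ?a = "metric_comp \<A> c a" and ?b = "one_form_comp \<A> c b"
      note ch = is_chart[OF c(1)]
      obtain \<Gamma> where \<Gamma>: "\<And>x y k i. (x, y) \<in> ?\<Omega> \<Longrightarrow> nonlinear_connection ?f k i (x, y) = (\<Sum>j\<in>UNIV. \<Gamma> k i j x * y $ j)"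
        using assms(4) c(1) unfolding berwald_type_def by fast
      define G :: "real ^ 4 \<Rightarrow> real ^ 4 \<Rightarrow> real ^ 4 \<Rightarrow> real ^ 4"
        where "G x u v = (\<chi> k. \<Sum>i\<in>UNIV. u $ i * (\<Sum>j\<in>UNIV. \<Gamma> k i j x * v $ j))" for x u v
      interpret fin: finsler_chart ?f ?\<Omega> by (rule finsler_chart_TM[OF F c(1)])
      interpret K: kropina_chart ?f ?\<Omega> ?U ?a ?b m G
      proof
        show "open ?U" using ch by (simp add: is_chart_def)
        show "fst ` ?\<Omega> = ?U" by (rule TM_coords_image[OF F c(1)])
        show "smooth_on ?U ?a" "\<And>x. x \<in> ?U \<Longrightarrow> transpose (?a x) = ?a x"
          using a c(1) by (auto simp: pseudo_riemannian_metric_def)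
        show "smooth_on ?U ?b" using b c(1) by (simp add: one_form_def)
        show "\<exists>P. invertible P \<and> transpose P ** ?a x ** P = minkowski" if "x \<in> ?U" for x
          using assms(5) c(1) that by (simp add: lorentzian_metric_def)
        show "?b x \<bullet> (matrix_inv (?a x) *v ?b x) \<noteq> 0" if "x \<in> ?U" for x
        proof -
          have "one_form_norm_sq \<A> c a b x \<noteq> 0" using assms(6) c(1) that by blast
          then show ?thesis by (simp add: one_form_norm_sq_def inner_matrix_sum)
        qed
        show "m \<noteq> 0" by (rule assms(2))
        show "bilinear (G x)" for x
          unfolding bilinear_def G_def
          by (auto intro!: linearI simp: vec_eq_iff sum.distrib sum_distrib_left algebra_simps)
        show "nonlinear_connection ?f k i (x, y) = G x (axis i 1) y $ k" if "(x, y) \<in> ?\<Omega>" for x y k i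
        proof -
          have "(\<Sum>l\<in>UNIV. axis i 1 $ l * h l) = h i" for h :: "4 \<Rightarrow> real"
            by (simp add: axis_def if_distrib[of "\<lambda>t. t * _"] cong: if_cong)
          then show ?thesis using \<Gamma>[OF that] by (simp add: G_def)
        qed
        show "kropina_domain m (y \<bullet> (?a x *v y)) (?b x \<bullet> y) \<and>
          ?f (x, y) = sqrt \<bar>y \<bullet> (?a x *v y)\<bar> powr (1 + m) * real_power (?b x \<bullet> y) (- m)" if z: "(x, y) \<in> ?\<Omega>" for x y
        proof -
          define q where "q = chart_inv c x"
          define v where "v = coord_tvec \<A> c q y"
          have q: "q \<in> chart_dom c" using z chart_inv_in[OF ch] by (simp add: q_def TM_coords_def)
          have tm: "TM_point \<A> c (x, y) = (q, v)" by (simp add: TM_point_def q_def v_def)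
          then have "(q, v) \<in> A" using z by (simp add: TM_coords_def)
          moreover have "a q v v = y \<bullet> (?a x *v y)"
          proof -
            have "bilinear (\<lambda>y z. a q (coord_tvec \<A> c q y) (coord_tvec \<A> c q z))"
              using a c(1) q by (simp add: pseudo_riemannian_metric_def)
            from bilinear_axis_sum[OF this, of y y] show ?thesis
              by (simp add: v_def inner_matrix_sum metric_comp_def q_def Let_def ac_simps)
          qed
          moreover have "b q v = ?b x \<bullet> y"
          proof -
            have "linear (\<lambda>y. b q (coord_tvec \<A> c q y))" using b c(1) q by (simp add: one_form_def)
            from linear_axis_sum[OF this, of y] show ?thesis
              by (simp add: v_def inner_vec_def one_form_comp_def q_def Let_def ac_simps)
          qed
          ultimately show ?thesis using Fv[of q v] tm by simp
        qed
      qed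
      interpret P: parallel_structure ?U K.g K.\<kappa> G by (rule K.parallel_structure_g)
      have ricci: "(\<Sum>i\<in>UNIV. curvature G x (axis i 1) v v $ i) = 0" if "x \<in> ?U" for x v
        by (rule K.ricci_flat_curvature[OF _ that]) (use flat c(1) in \<open>auto simp: ricci_flat_def\<close>)
      obtain V X \<phi> \<psi> \<kappa> where V: "open V" "chart_map c p \<in> V" "V \<subseteq> ?U" and X: "open X" "homeomorphism V X \<phi> \<psi>"
        and smooth: "smooth_on V \<phi>" "smooth_on X \<psi>"
        and metric: "\<And>x h k. x \<in> V \<Longrightarrow> fd \<phi> x h \<bullet> (minkowski *v fd \<phi> x k) = h \<bullet> (K.g x *v k)"
        and covector: "\<And>x h. x \<in> V \<Longrightarrow> K.\<kappa> x \<bullet> h = \<kappa> \<bullet> fd \<phi> x h"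
        using P.flat_chart[OF chart_map_in[OF ch c(2)] ricci] by blast
      \<comment> \<open>The isometry \<phi> is appended to the chart c and restricted to the set
        where it is invertible.\<close>
      define c' where "c' = (chart_inv c ` V, \<phi> \<circ> chart_map c)"
      note new = new_chart[OF c(1) V(1,3) X smooth, folded c'_def]
      have p: "p \<in> chart_dom c'" using V(2) chart_inv_map[OF ch c(2)] by (force simp: c'_def)
      have "kropina_domain m (w \<bullet> (minkowski *v w)) (\<kappa> \<bullet> w) \<and>
          (F \<circ> TM_point \<A> c') (u, w) = \<bar>w \<bullet> (minkowski *v w)\<bar> powr ((1 + m) / 2) * real_power (\<kappa> \<bullet> w) (- m)"
        if z: "(u, w) \<in> TM_coords \<A> c' A" for u w
      proof -
        have u: "u \<in> X" using z new(2) by (simp add: TM_coords_def)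
        have \<psi>u: "\<psi> u \<in> V" "\<phi> (\<psi> u) = u" using X(2) u by (auto simp: homeomorphism_def)
        have ov: "u \<in> overlap c' c"
        proof -
          have "chart_inv c' u \<in> chart_dom c'" "chart_map c' (chart_inv c' u) = u"
            using u new(2) chart_inv_in[OF is_chart[OF new(1)]] chart_map_inv[OF is_chart[OF new(1)]] by auto
          moreover have "chart_dom c' \<subseteq> chart_dom c" using V(3) chart_inv_in[OF ch] by (auto simp: c'_def)
          ultimately show ?thesis by (metis IntI image_eqI subsetD)
        qed
        \<comment> \<open>The components in the old chart of the vector with components w in the new
          one; there the rescaled fields express F, and \<phi> carries them to the constant
          ones.\<close>
        define y where "y = fd \<psi> u w"
        have "fd (transition c' c) u = fd \<psi> u" by (rule fd_cong_open[OF X(1) u]) (rule new(4))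
        then have zy: "(\<psi> u, y) \<in> ?\<Omega>" "(F \<circ> TM_point \<A> c') (u, w) = ?f (\<psi> u, y)"
          using TM_coords_change[OF F new(1) c(1) z ov] by (simp_all add: new(4)[OF u] y_def)
        have w: "fd \<phi> (\<psi> u) y = w"
        proof -
          have "fd (\<phi> \<circ> \<psi>) u = fd \<phi> (\<psi> u) \<circ> fd \<psi> u"
            by (intro fd_eq diff_chain_at smooth_on_has_derivative[OF smooth(2) u] smooth_on_has_derivative[OF smooth(1) \<psi>u(1)])
          moreover have "fd (\<phi> \<circ> \<psi>) u = fd (\<lambda>x. x) u"
            by (rule fd_cong_open[OF X(1) u]) (use X(2) in \<open>auto simp: homeomorphism_def\<close>)
          ultimately show ?thesis by (simp add: y_def fd_eq[OF has_derivative_ident] fun_eq_iff)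
        qed
        show ?thesis
          unfolding zy(2)
          using K.kropina_rescaled[OF zy(1)] metric[OF \<psi>u(1), of y y] covector[OF \<psi>u(1), of y] by (simp add: w)
      qed
      then show "?form p"
        using new(1) p by (intro bexI[of _ c'] conjI exI[of _ \<kappa>]) (auto simp: inner_matrix_sum inner_vec_def[of \<kappa>])
    qed
  qed
  then show ?thesis .
qed

end
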